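(* Let $G$ be a finitely generated fully residually free group and let $G_1, G_2$ be finitely generated subgroups of $G$. If $H \leq G_1\cap G_2$ is a finitely generated subgroup with $|G_1:H|<\infty$ and $|G_2:H|<\infty$, then $|\langle G_1,G_2\rangle : H|<\infty$.
   Context: A group $G$ is called fully residually free if for any finitely many non-trivial elements $g_1,\ldots,g_n\in G$ there exists a homomorphism $\phi$ from $G$ into a free group such that $\phi(g_i)\neq 1$ for all $i\in\{1,\ldots,n\}$. Here $\langle G_1,G_2\rangle$ denotes the subgroup of $G$ generated by $G_1\cup G_2$. *)

theory Defs
  imports "HOL-Algebra.Algebra"
begin

section \<open>Free groups as groups of reduced words\<close>

text \<open>A letter \<open>(x, True)\<close> stands for the generator \<open>x\<close>, and \<open>(x, False)\<close> for its inverse.\<close>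

definition inv_letter :: "'x \<times> bool \<Rightarrow> 'x \<times> bool" where
  "inv_letter a = (fst a, \<not> snd a)"

definition reduced :: "('x \<times> bool) list \<Rightarrow> bool" where
  "reduced w \<longleftrightarrow> successively (\<lambda>a b. b \<noteq> inv_letter a) w"

definition push :: "'x \<times> bool \<Rightarrow> ('x \<times> bool) list \<Rightarrow> ('x \<times> bool) list" where
  "push a w = (case w of [] \<Rightarrow> [a] | b # v \<Rightarrow> if b = inv_letter a then v else a # w)"

text \<open>For reduced words \<open>u\<close> and \<open>v\<close>, \<open>foldr push u v\<close> is the reduced form of the
  concatenation \<open>u @ v\<close>.\<close>

definition free_group :: "'x set \<Rightarrow> ('x \<times> bool) list monoid" where
  "free_group B =
     \<lparr>carrier = {w \<in> lists (B \<times> UNIV). reduced w}, monoid.mult = foldr push, one = []\<rparr>"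

lemma inv_letter_inv_letter [simp]: "inv_letter (inv_letter a) = a"
  by (simp add: inv_letter_def)

lemma inv_letter_neq [simp]: "inv_letter a \<noteq> a"
  by (cases a) (simp add: inv_letter_def)

lemma reduced_Nil [simp]: "reduced []"
  by (simp add: reduced_def)

lemma reduced_Cons: "reduced (a # w) \<longleftrightarrow> reduced w \<and> (w = [] \<or> hd w \<noteq> inv_letter a)"
  by (auto simp: reduced_def successively_Cons)

lemma reduced_push: "reduced w \<Longrightarrow> reduced (push a w)"
  by (auto simp: push_def reduced_Cons split: list.split)

lemma reduced_foldr_push: "reduced w \<Longrightarrow> reduced (foldr push u w)"
  by (induction u) (auto intro: reduced_push)

lemma push_push_inv: "reduced w \<Longrightarrow> push a (push (inv_letter a) w) = w"
  by (cases w) (auto simp: push_def reduced_Cons split: list.splits)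

lemma push_reduced: "reduced (a # w) \<Longrightarrow> push a w = a # w"
  by (auto simp: push_def reduced_Cons split: list.split)

lemma foldr_push_reduced: "reduced w \<Longrightarrow> foldr push w [] = w"
  by (induction w) (auto simp: push_reduced reduced_Cons)

lemma foldr_push_push:
  assumes "reduced v" "reduced w"
  shows "foldr push (push a v) w = push a (foldr push v w)"
proof (cases "v \<noteq> [] \<and> hd v = inv_letter a")
  case True
  then obtain u where "v = inv_letter a # u"
    by (cases v) auto
  then show ?thesis
    using push_push_inv[OF reduced_foldr_push[OF assms(2), of u], of a] by (simp add: push_def)
next
  case False
  then have "push a v = a # v"
    by (cases v) (auto simp: push_def)
  then show ?thesis by simp
qed

lemma foldr_push_assoc:
  assumes "reduced v" "reduced w"
  shows "foldr push (foldr push u v) w = foldr push u (foldr push v w)"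
  by (induction u) (simp_all add: foldr_push_push reduced_foldr_push assms)

lemma foldr_push_inv_word:
  assumes "reduced w"
  shows "foldr push (map inv_letter (rev u)) (foldr push u w) = w"
  using assms
proof (induction u arbitrary: w)
  case (Cons a u)
  then show ?case
    using push_push_inv[of "foldr push u w" "inv_letter a"]
    by (simp add: reduced_foldr_push)
qed simp

lemma push_in_lists: "a \<in> A \<Longrightarrow> w \<in> lists A \<Longrightarrow> push a w \<in> lists A"
  by (auto simp: push_def split: list.split)

lemma foldr_push_in_lists: "u \<in> lists A \<Longrightarrow> w \<in> lists A \<Longrightarrow> foldr push u w \<in> lists A"
proof (induction u)
  case (Cons a u)
  then show ?case using push_in_lists[of a A "foldr push u w"] by simp
qed simp

lemma group_free_group: "group (free_group B)"
proof (rule groupI)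
  fix x assume x: "x \<in> carrier (free_group B)"
  let ?y = "foldr push (map inv_letter (rev x)) []"
  have "foldr push ?y x = foldr push (map inv_letter (rev x)) (foldr push [] x)"
    using x foldr_push_assoc[of "[]" x] by (simp add: free_group_def)
  also have "\<dots> = []"
    using foldr_push_inv_word[of "[]" x] foldr_push_reduced[of x] x by (simp add: free_group_def)
  finally have "?y \<otimes>\<^bsub>free_group B\<^esub> x = \<one>\<^bsub>free_group B\<^esub>"
    by (simp add: free_group_def)
  moreover have "map inv_letter (rev x) \<in> lists (B \<times> UNIV)"
    using x by (fastforce simp: free_group_def inv_letter_def in_lists_conv_set)
  then have "?y \<in> carrier (free_group B)"
    by (simp only: free_group_def partial_object.simps mem_Collect_eq)
      (simp only: foldr_push_in_lists lists.Nil reduced_foldr_push reduced_Nil simp_thms)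
  ultimately show "\<exists>y\<in>carrier (free_group B). y \<otimes>\<^bsub>free_group B\<^esub> x = \<one>\<^bsub>free_group B\<^esub>"
    by blast
next
  fix x y assume "x \<in> carrier (free_group B)" "y \<in> carrier (free_group B)"
  then show "x \<otimes>\<^bsub>free_group B\<^esub> y \<in> carrier (free_group B)"
    using foldr_push_in_lists[of x "B \<times> UNIV" y] by (simp add: free_group_def reduced_foldr_push)
qed (auto simp: free_group_def foldr_push_assoc)

text \<open>The universal property: a map \<open>f\<close> from \<open>B\<close> to a group extends uniquely to a homomorphism.\<close>

definition eval_letter :: "('g, 'm) monoid_scheme \<Rightarrow> ('x \<Rightarrow> 'g) \<Rightarrow> 'x \<times> bool \<Rightarrow> 'g" where
  "eval_letter K f a = (if snd a then f (fst a) else inv\<^bsub>K\<^esub> f (fst a))"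

definition eval_word :: "('g, 'm) monoid_scheme \<Rightarrow> ('x \<Rightarrow> 'g) \<Rightarrow> ('x \<times> bool) list \<Rightarrow> 'g" where
  "eval_word K f w = foldr (\<lambda>a g. eval_letter K f a \<otimes>\<^bsub>K\<^esub> g) w \<one>\<^bsub>K\<^esub>"

context group
begin

lemma eval_letter_closed:
  "f \<in> B \<rightarrow> carrier G \<Longrightarrow> a \<in> B \<times> UNIV \<Longrightarrow> eval_letter G f a \<in> carrier G"
  by (auto simp: eval_letter_def)

lemma eval_word_closed:
  "f \<in> B \<rightarrow> carrier G \<Longrightarrow> w \<in> lists (B \<times> UNIV) \<Longrightarrow> eval_word G f w \<in> carrier G"
proof (induction w)
  case (Cons a w)
  then show ?case
    using eval_letter_closed[of f B a] by (simp add: eval_word_def)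
qed (simp add: eval_word_def)

lemma eval_word_push:
  assumes f: "f \<in> B \<rightarrow> carrier G" and a: "a \<in> B \<times> UNIV" and w: "w \<in> lists (B \<times> UNIV)"
  shows "eval_word G f (push a w) = eval_letter G f a \<otimes> eval_word G f w"
proof (cases "w \<noteq> [] \<and> hd w = inv_letter a")
  case True
  then obtain v where v: "w = inv_letter a # v"
    by (cases w) auto
  have fa: "f (fst a) \<in> carrier G"
    using f a by auto
  have "eval_letter G f a \<otimes> eval_letter G f (inv_letter a) = \<one>"
    using fa by (simp add: eval_letter_def inv_letter_def)
  moreover have "eval_letter G f (inv_letter a) \<in> carrier G" "eval_letter G f a \<in> carrier G"
    using fa by (simp_all add: eval_letter_def inv_letter_def)
  moreover have "eval_word G f v \<in> carrier G"
    using eval_word_closed[OF f, of v] w v by simp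
  ultimately show ?thesis
    using v by (simp add: push_def eval_word_def m_assoc[symmetric])
next
  case False
  then show ?thesis by (cases w) (auto simp: push_def eval_word_def)
qed

lemma eval_word_hom:
  assumes f: "f \<in> B \<rightarrow> carrier G"
  shows "eval_word G f \<in> hom (free_group B) G"
proof (rule homI)
  fix u v assume "u \<in> carrier (free_group B)" "v \<in> carrier (free_group B)"
  then have "u \<in> lists (B \<times> UNIV)" and v: "v \<in> lists (B \<times> UNIV)"
    by (auto simp: free_group_def)
  then have "eval_word G f (foldr push u v) = eval_word G f u \<otimes> eval_word G f v"
  proof (induction u)
    case Nil
    then show ?case using eval_word_closed[OF f v] by (simp add: eval_word_def)
  next
    case (Cons a u)
    then have a: "a \<in> B \<times> UNIV" and u: "u \<in> lists (B \<times> UNIV)"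
      by auto
    have "eval_word G f (foldr push (a # u) v)
        = eval_letter G f a \<otimes> eval_word G f (foldr push u v)"
      using eval_word_push[OF f a foldr_push_in_lists[OF u v]] by simp
    also have "\<dots> = eval_letter G f a \<otimes> (eval_word G f u \<otimes> eval_word G f v)"
      using Cons.IH v by simp
    also have "\<dots> = eval_word G f (a # u) \<otimes> eval_word G f v"
      using m_assoc[OF eval_letter_closed[OF f a] eval_word_closed[OF f u] eval_word_closed[OF f v]]
      by (simp add: eval_word_def)
    finally show ?case .
  qed
  then show "eval_word G f (u \<otimes>\<^bsub>free_group B\<^esub> v) = eval_word G f u \<otimes> eval_word G f v"
    by (simp add: free_group_def)
qed (simp add: free_group_def eval_word_closed[OF f])

lemma eval_word_generator:
  assumes "f \<in> B \<rightarrow> carrier G" "x \<in> B"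
  shows "eval_word G f [(x, True)] = f x"
  using assms by (auto simp: eval_word_def eval_letter_def intro!: r_one)

lemma hom_free_group_unique:
  assumes h: "h \<in> hom (free_group B) G" and w: "w \<in> carrier (free_group B)"
  shows "h w = eval_word G (\<lambda>x. h [(x, True)]) w"
  using w
proof (induction w)
  interpret F: group "free_group B" by (rule group_free_group)
  interpret h: group_hom "free_group B" G h
    by unfold_locales (rule h)
  {
    case Nil
    show ?case using h.hom_one by (simp add: eval_word_def free_group_def)
  next
    case (Cons a w)
    obtain x b where a: "a = (x, b)" by (cases a)
    have w: "w \<in> carrier (free_group B)" and x: "x \<in> B" and red: "reduced (a # w)"
      using Cons.prems a by (auto simp: free_group_def reduced_Cons)
    have gen: "[(x, c)] \<in> carrier (free_group B)" for c
      using x by (simp add: free_group_def reduced_Cons)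
    have "[(x, False)] \<otimes>\<^bsub>free_group B\<^esub> [(x, True)] = \<one>\<^bsub>free_group B\<^esub>"
      by (simp add: free_group_def push_def inv_letter_def)
    then have "[(x, False)] = inv\<^bsub>free_group B\<^esub> [(x, True)]"
      using F.inv_equality gen by metis
    then have "h [(x, False)] = inv h [(x, True)]"
      using h.hom_inv[OF gen] by simp
    then have "h [a] = eval_letter G (\<lambda>x. h [(x, True)]) a"
      by (simp add: eval_letter_def a)
    moreover have "a # w = [a] \<otimes>\<^bsub>free_group B\<^esub> w"
      by (simp add: free_group_def push_reduced[OF red])
    then have "h (a # w) = h [a] \<otimes> h w"
      using h.hom_mult[OF gen w] a by simp
    ultimately show ?case
      using Cons.IH[OF w] by (simp add: eval_word_def)
  }
qed

end


section \<open>Finitely generated and fully residually free groups\<close>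

definition finitely_generated :: "('a, 'b) monoid_scheme \<Rightarrow> bool" where
  "finitely_generated G \<longleftrightarrow> (\<exists>S. finite S \<and> S \<subseteq> carrier G \<and> generate G S = carrier G)"

text \<open>Free generators are taken from \<open>nat\<close> because a definition cannot quantify over types.
  This is no restriction: \<open>fully_residually_freeI\<close> below allows
  generators of any type, since finitely many elements of a free group involve only
  finitely many generators, and the other generators can be sent to \<open>1\<close>.\<close>

definition fully_residually_free :: "('a, 'b) monoid_scheme \<Rightarrow> bool" where
  "fully_residually_free G \<longleftrightarrow>
     (\<forall>S. finite S \<and> S \<subseteq> carrier G - {\<one>\<^bsub>G\<^esub>} \<longrightarrow>
        (\<exists>(B :: nat set) \<phi>. \<phi> \<in> hom G (free_group B) \<and>
           (\<forall>g\<in>S. \<phi> g \<noteq> \<one>\<^bsub>free_group B\<^esub>)))"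

lemma free_group_relabel:
  fixes B :: "'x set"
  assumes W: "finite W" "W \<subseteq> carrier (free_group B) - {\<one>\<^bsub>free_group B\<^esub>}"
  shows "\<exists>(Y :: nat set) \<psi>. \<psi> \<in> hom (free_group B) (free_group Y) \<and>
           (\<forall>w\<in>W. \<psi> w \<noteq> \<one>\<^bsub>free_group Y\<^esub>)"
proof -
  define L where "L = (\<Union>w\<in>W. fst ` set w)"
  have "finite L" using W(1) by (auto simp: L_def)
  then obtain g :: "'x \<Rightarrow> nat" where g: "inj_on g L"
    using finite_imp_inj_to_nat_seg by blast
  let ?Y = "g ` L"
  interpret F: group "free_group ?Y" by (rule group_free_group)
  define f where "f x = (if x \<in> L then [(g x, True)] else [])" for x
  have f: "f \<in> B \<rightarrow> carrier (free_group ?Y)"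
    by (auto simp: f_def free_group_def reduced_Cons)
  have letter: "eval_letter (free_group ?Y) f a = [(g (fst a), snd a)]" if "fst a \<in> L" for a
  proof (cases "snd a")
    case False
    have "[(g (fst a), False)] \<otimes>\<^bsub>free_group ?Y\<^esub> [(g (fst a), True)] = \<one>\<^bsub>free_group ?Y\<^esub>"
      by (simp add: free_group_def push_def inv_letter_def)
    then have "inv\<^bsub>free_group ?Y\<^esub> [(g (fst a), True)] = [(g (fst a), False)]"
      using that by (intro F.inv_equality) (auto simp: free_group_def reduced_Cons)
    then show ?thesis using False that by (simp add: eval_letter_def f_def)
  qed (use that in \<open>simp add: eval_letter_def f_def\<close>)
  have ev: "eval_word (free_group ?Y) f w = map (\<lambda>a. (g (fst a), snd a)) w"
    if "reduced w" "fst ` set w \<subseteq> L" for w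
    using that
  proof (induction w)
    case (Cons a w)
    have "(g (fst y), snd y) \<noteq> inv_letter (g (fst x), snd x)"
      if "x \<in> set (a # w)" "y \<in> set (a # w)" "y \<noteq> inv_letter x" for x y
    proof -
      have "fst x \<in> L" "fst y \<in> L"
        using that(1,2) Cons.prems(2) by blast+
      then have "g (fst y) = g (fst x) \<longleftrightarrow> fst y = fst x"
        using inj_on_eq_iff[OF g] by blast
      then show ?thesis
        using that(3) by (cases x; cases y) (simp add: inv_letter_def)
    qed
    then have red: "reduced (map (\<lambda>a. (g (fst a), snd a)) (a # w))"
      using successively_mono[OF Cons.prems(1)[unfolded reduced_def],
          of "\<lambda>x y. (g (fst y), snd y) \<noteq> inv_letter (g (fst x), snd x)"]
      unfolding reduced_def successively_map by blast
    have "eval_word (free_group ?Y) f w = map (\<lambda>a. (g (fst a), snd a)) w"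
      using Cons.IH Cons.prems reduced_Cons[of a w] by simp
    moreover have "eval_letter (free_group ?Y) f a = [(g (fst a), snd a)]"
      using letter[of a] Cons.prems(2) by simp
    ultimately show ?case
      using push_reduced[of "(g (fst a), snd a)" "map (\<lambda>a. (g (fst a), snd a)) w"] red
      by (simp add: eval_word_def free_group_def)
  qed (simp add: eval_word_def free_group_def)
  have "eval_word (free_group ?Y) f w \<noteq> \<one>\<^bsub>free_group ?Y\<^esub>" if "w \<in> W" for w
  proof -
    have "reduced w" "w \<noteq> []" "fst ` set w \<subseteq> L"
      using that W(2) by (auto simp: free_group_def L_def)
    then show ?thesis using ev[of w] by (simp add: free_group_def)
  qed
  then show ?thesis using F.eval_word_hom[OF f] by blast
qed

lemma fully_residually_freeI:
  assumes "\<And>S. finite S \<Longrightarrow> S \<subseteq> carrier G - {\<one>\<^bsub>G\<^esub>} \<Longrightarrow>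
    \<exists>(B :: 'x set) \<phi>. \<phi> \<in> hom G (free_group B) \<and> (\<forall>g\<in>S. \<phi> g \<noteq> \<one>\<^bsub>free_group B\<^esub>)"
  shows "fully_residually_free G"
  unfolding fully_residually_free_def
proof (intro allI impI)
  fix S assume S: "finite S \<and> S \<subseteq> carrier G - {\<one>\<^bsub>G\<^esub>}"
  then have "\<exists>(B :: 'x set) \<phi>. \<phi> \<in> hom G (free_group B) \<and>
      (\<forall>g\<in>S. \<phi> g \<noteq> \<one>\<^bsub>free_group B\<^esub>)"
    by (intro assms) simp_all
  then obtain B :: "'x set" and \<phi>
    where \<phi>: "\<phi> \<in> hom G (free_group B)" "\<forall>g\<in>S. \<phi> g \<noteq> \<one>\<^bsub>free_group B\<^esub>"
    by (elim exE conjE)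
  have "\<phi> ` S \<subseteq> carrier (free_group B) - {\<one>\<^bsub>free_group B\<^esub>}"
    using \<phi>(2) S hom_in_carrier[OF \<phi>(1)] by auto
  then have "\<exists>(Y :: nat set) \<psi>. \<psi> \<in> hom (free_group B) (free_group Y) \<and>
      (\<forall>w\<in>\<phi> ` S. \<psi> w \<noteq> \<one>\<^bsub>free_group Y\<^esub>)"
    using S by (intro free_group_relabel) simp_all
  then obtain Y :: "nat set" and \<psi> where \<psi>: "\<psi> \<in> hom (free_group B) (free_group Y)"
    "\<forall>w\<in>\<phi> ` S. \<psi> w \<noteq> \<one>\<^bsub>free_group Y\<^esub>"
    by (elim exE conjE)
  have "\<psi> \<circ> \<phi> \<in> hom G (free_group Y)"
    using \<phi>(1) \<psi>(1) by (rule hom_compose)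
  then show "\<exists>(Y :: nat set) \<chi>. \<chi> \<in> hom G (free_group Y) \<and> (\<forall>g\<in>S. \<chi> g \<noteq> \<one>\<^bsub>free_group Y\<^esub>)"
    using \<psi>(2) by (intro exI[of _ Y] exI[of _ "\<psi> \<circ> \<phi>"]) simp
qed

end

theory Submission
  imports Defs "HOL-Analysis.Analysis"
begin

text \<open>
  Only the case of a non-abelian \<open>H\<close> is difficult, since fully residually free groups are torsion-free
  and commutative transitive. Every \<open>t\<close> in \<open>K = \<langle>G1, G2\<rangle>\<close> satisfies \<open>t H \<subseteq> H T\<close> for a finite \<open>T\<close>.
  The proof adapts the vanishing of the first \<open>l\<^sup>2\<close>-Betti number of a group with a commensurated
  subgroup of this kind of infinite index.

  By the Nielsen--Schreier theorem \<open>K\<close> maps onto a non-abelian free group, injectively on any given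
  finite set, and from there to a finite group \<open>L\<close>. On \<open>L\<close> the cocycles form a space of dimension at
  least \<open>2 |L|\<close>, so there are harmonic cocycles of energy at most \<open>1\<close> that are bounded away from
  \<open>0\<close> at some point, and by compactness there is a non-constant harmonic function of finite energy on \<open>K\<close>.

  If the gradient of such a function vanishes on the edges of \<open>H\<close>, then up to a constant the function is
  square-summable on every coset \<open>t H\<close>, hence on \<open>K\<close> because \<open>H\<close> has a spectral gap, and so it is
  constant. The projection \<open>P\<close> onto the space of these gradients therefore meets the vectors vanishing
  on the edges of \<open>H\<close> trivially, and its \<open>H\<close>-trace is at most the number of generators of \<open>H\<close>. But this
  trace is \<open>|K : H|\<close> times the positive \<open>K\<close>-trace of \<open>P\<close>, so the index is finite.
\<close>

hide_const (open) Brouwer_Fixpoint.reduced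
hide_fact (open) Brouwer_Fixpoint.reduced_def

section \<open>Cocycles of free groups\<close>

text \<open>Two points shape the argument. The harmonic functions must have a non-constant limit, so
  the estimates on the finite quotients \<open>L\<close> have to be independent of \<open>L\<close>.
  Two free generators leave \<open>2 |L|\<close> coefficients and harmonicity costs
  \<open>|L|\<close> equations; the remaining \<open>|L|\<close> orthonormal cocycles on
  \<open>|L|\<close> points have average local mass one. Hence some point carries mass at least one,
  and it can be moved to the identity.

  The second is a conflict of sides. Gradients are taken along right multiplication, so a function
  vanishing on \<open>H\<close> is controlled on the right cosets \<open>H t\<close>, whereas the
  spectral gap of \<open>H\<close>, acting by right multiplication, lives on the left cosets
  \<open>t H\<close>. The inclusion \<open>t H \<subseteq> H T\<close> carries square-summability
  from the one kind to the other.

  Von Neumann dimension is replaced by an elementary double sum over an invariant kernel with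
  bounded column sums.\<close>

definition right_action :: "('g, 'm) monoid_scheme \<Rightarrow> 'p set \<Rightarrow> ('p \<Rightarrow> 'g \<Rightarrow> 'p) \<Rightarrow> bool" where
  "right_action K Z act \<longleftrightarrow> (\<forall>p\<in>Z. act p \<one>\<^bsub>K\<^esub> = p \<and>
     (\<forall>g\<in>carrier K. act p g \<in> Z \<and> (\<forall>h\<in>carrier K. act p (g \<otimes>\<^bsub>K\<^esub> h) = act (act p g) h)))"

text \<open>A functor to \<open>L\<close> from the action groupoid of \<open>K\<close> on
  \<open>Z\<close>, so a homomorphism if \<open>Z\<close> is a point. Cosets with values in a free
  group serve for the Nielsen--Schreier theorem, a finite group with real values for harmonic
  functions.\<close>

definition cocycle :: "('g, 'm) monoid_scheme \<Rightarrow> 'p set \<Rightarrow> ('p \<Rightarrow> 'g \<Rightarrow> 'p) \<Rightarrow>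
    ('l, 'n) monoid_scheme \<Rightarrow> ('p \<Rightarrow> 'g \<Rightarrow> 'l) \<Rightarrow> bool" where
  "cocycle K Z act L c \<longleftrightarrow> (\<forall>p\<in>Z. \<forall>g\<in>carrier K. c p g \<in> carrier L \<and>
     (\<forall>h\<in>carrier K. c p (g \<otimes>\<^bsub>K\<^esub> h) = c p g \<otimes>\<^bsub>L\<^esub> c (act p g) h))"

lemma right_actionD:
  assumes "right_action K Z act" "p \<in> Z"
  shows "act p \<one>\<^bsub>K\<^esub> = p" "g \<in> carrier K \<Longrightarrow> act p g \<in> Z"
    "g \<in> carrier K \<Longrightarrow> h \<in> carrier K \<Longrightarrow> act p (g \<otimes>\<^bsub>K\<^esub> h) = act (act p g) h"
  using assms by (auto simp: right_action_def)

lemma cocycleD: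
  assumes "cocycle K Z act L c" "p \<in> Z" "g \<in> carrier K"
  shows "c p g \<in> carrier L"
    "h \<in> carrier K \<Longrightarrow> c p (g \<otimes>\<^bsub>K\<^esub> h) = c p g \<otimes>\<^bsub>L\<^esub> c (act p g) h"
  using assms by (auto simp: cocycle_def)

lemma cocycle_one:
  assumes "group K" "group L" "right_action K Z act" "cocycle K Z act L c" "p \<in> Z"
  shows "c p \<one>\<^bsub>K\<^esub> = \<one>\<^bsub>L\<^esub>"
proof -
  interpret K: group K by fact
  interpret L: group L by fact
  have "c p \<one>\<^bsub>K\<^esub> \<otimes>\<^bsub>L\<^esub> c p \<one>\<^bsub>K\<^esub> = c p \<one>\<^bsub>K\<^esub>"
    using cocycleD(2)[OF assms(4,5), of "\<one>\<^bsub>K\<^esub>" "\<one>\<^bsub>K\<^esub>"] right_actionD(1)[OF assms(3,5)] by simp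
  then show ?thesis
    using cocycleD(1)[OF assms(4,5), of "\<one>\<^bsub>K\<^esub>"] L.r_cancel_one by auto
qed

lemma free_group_simps [simp]:
  "u \<otimes>\<^bsub>free_group B\<^esub> v = foldr push u v" "\<one>\<^bsub>free_group B\<^esub> = []"
  by (simp_all add: free_group_def)

lemma in_carrier_free_group:
  "w \<in> carrier (free_group B) \<longleftrightarrow> w \<in> lists (B \<times> UNIV) \<and> reduced w"
  by (simp add: free_group_def)

lemma letter_in_free_group: "[a] \<in> carrier (free_group B) \<longleftrightarrow> fst a \<in> B"
  by (cases a) (simp add: in_carrier_free_group reduced_Cons)

lemma foldr_push_snoc: "reduced (w @ [a]) \<Longrightarrow> foldr push w [a] = w @ [a]"
  using foldr_push_reduced[of "w @ [a]"] by (simp add: push_def)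

lemma Cons_in_free_group:
  assumes "a # w \<in> carrier (free_group B)"
  shows "fst a \<in> B" "w \<in> carrier (free_group B)" "foldr push [a] w = a # w"
  using assms by (auto simp: in_carrier_free_group reduced_Cons push_def split: list.split)

lemma inv_letter_fst [simp]: "fst (inv_letter a) = fst a"
  by (simp add: inv_letter_def)

lemma push_letter_inv: "push a [inv_letter a] = []"
  by (simp add: push_def)

text \<open>The value on an inverse letter is forced: going along it and back along the positive
  letter must multiply to one, and the positive letter is then read at
  \<open>act p [a]\<close>.\<close>

definition cocycle_letter :: "('l, 'n) monoid_scheme \<Rightarrow> ('p \<Rightarrow> ('x \<times> bool) list \<Rightarrow> 'p) \<Rightarrow>
    ('p \<Rightarrow> 'x \<Rightarrow> 'l) \<Rightarrow> 'p \<Rightarrow> 'x \<times> bool \<Rightarrow> 'l" where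
  "cocycle_letter L act f p a = (if snd a then f p (fst a) else inv\<^bsub>L\<^esub> f (act p [a]) (fst a))"

primrec word_cocycle :: "('l, 'n) monoid_scheme \<Rightarrow> ('p \<Rightarrow> ('x \<times> bool) list \<Rightarrow> 'p) \<Rightarrow>
    ('p \<Rightarrow> 'x \<Rightarrow> 'l) \<Rightarrow> ('x \<times> bool) list \<Rightarrow> 'p \<Rightarrow> 'l" where
  "word_cocycle L act f [] = (\<lambda>p. \<one>\<^bsub>L\<^esub>)"
| "word_cocycle L act f (a # w) =
     (\<lambda>p. cocycle_letter L act f p a \<otimes>\<^bsub>L\<^esub> word_cocycle L act f w (act p [a]))"

text \<open>The product along an arbitrary word does not change when an adjacent inverse pair is
  removed, which is all that \<open>push\<close> does. Hence the values on positive letters can be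
  prescribed freely, just as for homomorphisms.\<close>

lemma free_group_cocycle_exists:
  fixes L (structure)
  assumes L: "group L" and act: "right_action (free_group B) Z act"
    and f: "\<And>p x. p \<in> Z \<Longrightarrow> x \<in> B \<Longrightarrow> f p x \<in> carrier L"
  shows "\<exists>c. cocycle (free_group B) Z act L c \<and> (\<forall>p\<in>Z. \<forall>x\<in>B. c p [(x, True)] = f p x)"
proof -
  interpret L: group L by fact
  let ?l = "cocycle_letter L act f" and ?c = "\<lambda>p w. word_cocycle L act f w p"
  have actX: "act p [a] \<in> Z" if "p \<in> Z" "fst a \<in> B" for p a
    using right_actionD(2)[OF act that(1)] letter_in_free_group that(2) by blast
  have act_inv: "act (act p [a]) [inv_letter a] = p" if "p \<in> Z" "fst a \<in> B" for p a
    using right_actionD(1)[OF act that(1)]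
      right_actionD(3)[OF act that(1), of "[a]" "[inv_letter a]"]
      that(2) by (simp add: letter_in_free_group push_letter_inv)
  have l_closed: "?l p a \<in> carrier L" if "p \<in> Z" "fst a \<in> B" for p a
    using actX[OF that] f that by (simp add: cocycle_letter_def)
  have l_inv: "?l p a \<otimes> ?l (act p [a]) (inv_letter a) = \<one>" if "p \<in> Z" "fst a \<in> B" for p a
    using act_inv[OF that] actX[OF that] f that
      by (simp add: cocycle_letter_def) (simp add: inv_letter_def)
  have closed: "?c p w \<in> carrier L" if "p \<in> Z" "w \<in> lists (B \<times> UNIV)" for p w
    using that
  proof (induction w arbitrary: p)
    case (Cons a w)
    then show ?case using l_closed[of p a] actX[of p a] by auto
  qed simp
  have push: "?c p (push a w) = ?l p a \<otimes> ?c (act p [a]) w"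
    if p: "p \<in> Z" and a: "fst a \<in> B" and w: "w \<in> lists (B \<times> UNIV)" for p a w
  proof (cases "w \<noteq> [] \<and> hd w = inv_letter a")
    case True
    then obtain v where v: "w = inv_letter a # v"
      by (cases w) auto
    have 1: "?l p a \<in> carrier L" "?l (act p [a]) (inv_letter a) \<in> carrier L" "?c p v \<in> carrier L"
      using l_closed[OF p a] l_closed[of "act p [a]" "inv_letter a"] actX[OF p a] a
        closed[OF p, of v] w v
      by auto
    have "?l p a \<otimes> ?c (act p [a]) w = ?l p a \<otimes> (?l (act p [a]) (inv_letter a) \<otimes> ?c p v)"
      using v act_inv[OF p a] by simp
    also have "\<dots> = ?c p v"
      using l_inv[OF p a] 1 L.m_assoc[symmetric] by simp
    finally show ?thesis
      using v by (simp add: push_def)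
  next
    case False
    then have "push a w = a # w"
      by (cases w) (auto simp: push_def)
    then show ?thesis by simp
  qed
  have mult: "?c p (foldr push u v) = ?c p u \<otimes> ?c (act p u) v"
    if "p \<in> Z" "u \<in> carrier (free_group B)" "v \<in> carrier (free_group B)" for p u v
    using that
  proof (induction u arbitrary: p)
    case Nil
    then show ?case
      using closed[of p v] right_actionD(1)[OF act, of p] by (simp add: in_carrier_free_group)
  next
    case (Cons a u)
    note u = Cons_in_free_group[OF Cons.prems(2)]
    have uv: "foldr push u v \<in> lists (B \<times> UNIV)" "u \<in> lists (B \<times> UNIV)" "v \<in> lists (B \<times> UNIV)"
      using u(2) Cons.prems(3) foldr_push_in_lists[of u "B \<times> UNIV" v]
      by (simp_all add: in_carrier_free_group)
    have "act p (a # u) = act (act p [a]) u"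
      using right_actionD(3)[OF act Cons.prems(1), of "[a]" u] u by (simp add: letter_in_free_group)
    then show ?case
      using push[OF Cons.prems(1) u(1) uv(1)]
        Cons.IH[OF actX[OF Cons.prems(1) u(1)] u(2) Cons.prems(3)]
        L.m_assoc[OF l_closed[OF Cons.prems(1) u(1)] closed[OF actX[OF Cons.prems(1) u(1)] uv(2)] closed[of _ v]]
        uv right_actionD(2)[OF act actX[OF Cons.prems(1) u(1)] u(2)]
      by simp
  qed
  have "cocycle (free_group B) Z act L ?c"
    unfolding cocycle_def using closed mult by (auto simp: in_carrier_free_group)
  moreover have "?c p [(x, True)] = f p x" if "p \<in> Z" "x \<in> B" for p x
    using f[OF that] by (simp add: cocycle_letter_def)
  ultimately show ?thesis by blast
qed

lemma free_group_cocycle_unique: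
  assumes L: "group L" and act: "right_action (free_group B) Z act"
    and c: "cocycle (free_group B) Z act L c" and c': "cocycle (free_group B) Z act L c'"
    and eq: "\<And>p x. p \<in> Z \<Longrightarrow> x \<in> B \<Longrightarrow> c p [(x, True)] = c' p [(x, True)]"
    and w: "w \<in> carrier (free_group B)" and p: "p \<in> Z"
  shows "c p w = c' p w"
  using w p
proof (induction w arbitrary: p)
  case Nil
  then show ?case
    using cocycle_one[OF group_free_group L act c Nil.prems(2)]
      cocycle_one[OF group_free_group L act c' Nil.prems(2)] by simp
next
  case (Cons a w)
  interpret L: group L by fact
  note w = Cons_in_free_group[OF Cons.prems(1)]
  have a: "[a] \<in> carrier (free_group B)" "[inv_letter a] \<in> carrier (free_group B)"
    using w(1) by (simp_all add: letter_in_free_group)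
  have pa: "act p [a] \<in> Z"
    using right_actionD(2)[OF act Cons.prems(2) a(1)] .
  have "c p [a] = c' p [a]"
  proof (cases "snd a")
    case True
    then show ?thesis using eq[OF Cons.prems(2) w(1)] by (cases a) simp
  next
    case False
    then have ia: "inv_letter a = (fst a, True)"
      by (simp add: inv_letter_def)
    have *: "c'' p [a] \<otimes>\<^bsub>L\<^esub> c'' (act p [a]) [inv_letter a] = \<one>\<^bsub>L\<^esub>"
      "c'' p [a] \<in> carrier L" "c'' (act p [a]) [inv_letter a] \<in> carrier L"
      if "cocycle (free_group B) Z act L c''" for c''
      using cocycleD(1)[OF that Cons.prems(2) a(1)] cocycleD(2)[OF that Cons.prems(2) a(1) a(2)]
        cocycleD(1)[OF that pa a(2)] cocycle_one[OF group_free_group L act that Cons.prems(2)]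
      by (auto simp: push_letter_inv)
    have "c (act p [a]) [inv_letter a] = c' (act p [a]) [inv_letter a]"
      using eq[OF pa w(1)] ia by simp
    then show ?thesis
      using *[OF c] *[OF c'] by (metis L.inv_solve_right' L.l_one L.one_closed)
  qed
  then show ?case
    using cocycleD(2)[OF c Cons.prems(2) a(1) w(2)] cocycleD(2)[OF c' Cons.prems(2) a(1) w(2)] w(3)
      Cons.IH[OF w(2) pa] by (metis free_group_simps(1))
qed


section \<open>The Nielsen--Schreier theorem\<close>

lemma length_foldr_push: "length (foldr push u v) \<le> length u + length v"
proof (induction u)
  case (Cons a u)
  have "length (push a w) \<le> Suc (length w)" for w
    by (auto simp: push_def split: list.split)
  from this[of "foldr push u v"] Cons show ?case by simp
qed simp

text \<open>A spanning tree of the Schreier graph: \<open>t C\<close> is the label of the tree path from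
  the base coset \<open>Q\<close> to \<open>C\<close>.\<close>

lemma schreier_tree:
  assumes Q: "subgroup Q (free_group B)"
  obtains t d where "t Q = []" "d Q = (0::nat)"
    and "\<And>C. C \<in> rcosets\<^bsub>free_group B\<^esub> Q \<Longrightarrow> t C \<in> C"
    and "\<And>C. C \<in> rcosets\<^bsub>free_group B\<^esub> Q \<Longrightarrow> C \<noteq> Q \<Longrightarrow>
      \<exists>D\<in>rcosets\<^bsub>free_group B\<^esub> Q. \<exists>a. fst a \<in> B \<and> C = D #>\<^bsub>free_group B\<^esub> [a] \<and>
        d C = Suc (d D) \<and> t C = foldr push (t D) [a]"
proof -
  let ?F = "free_group B"
  interpret F: group ?F by (rule group_free_group)
  interpret Q: subgroup Q ?F by fact
  define d where "d C = (LEAST n. \<exists>w\<in>C. length w = n)" for C :: "('a \<times> bool) list set"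
  have d_le: "d C \<le> length w" if "w \<in> C" for C w
    unfolding d_def by (rule Least_le) (use that in blast)
  have d_ex: "\<exists>w\<in>C. length w = d C" if "w \<in> C" for C w
    unfolding d_def by (rule LeastI_ex) (use that in blast)
  have rep: "Q #>\<^bsub>?F\<^esub> w = C" "w \<in> carrier ?F" if C: "C \<in> rcosets\<^bsub>?F\<^esub> Q" and w: "w \<in> C" for C w
  proof -
    obtain v where "v \<in> carrier ?F" "C = Q #>\<^bsub>?F\<^esub> v"
      using C by (auto simp: RCOSETS_def)
    then show "w \<in> carrier ?F" "Q #>\<^bsub>?F\<^esub> w = C"
      using w F.repr_independence[OF _ _ Q] F.r_coset_subset_G[OF Q.subset] by blast+
  qed
  have parent: "\<exists>D\<in>rcosets\<^bsub>?F\<^esub> Q. \<exists>a. fst a \<in> B \<and> C = D #>\<^bsub>?F\<^esub> [a] \<and> d C = Suc (d D)"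
    if C: "C \<in> rcosets\<^bsub>?F\<^esub> Q" and ne: "C \<noteq> Q" for C
  proof -
    obtain v where "v \<in> carrier ?F" "C = Q #>\<^bsub>?F\<^esub> v"
      using C by (auto simp: RCOSETS_def)
    then have "v \<in> C"
      using F.rcos_self[OF _ Q] by simp
    then obtain w where w: "w \<in> C" "length w = d C"
      using d_ex by blast
    have "w \<noteq> []"
      using rep(1)[OF C w(1)] ne F.coset_mult_one[OF Q.subset] by auto
    \<comment> \<open>Deleting the last letter of a shortest word of \<open>C\<close> gives a word
      of a neighbouring coset \<open>?D\<close>. Comparing minimal lengths in both directions shows
      that \<open>?D\<close> is exactly one step closer to \<open>Q\<close>.\<close>
    then obtain u a where ua: "w = u @ [a]"
      by (metis rev_exhaust)
    have u: "u \<in> carrier ?F" "fst a \<in> B" "[a] \<in> carrier ?F" "reduced w"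
      using rep(2)[OF C w(1)] ua
      by (auto simp: in_carrier_free_group letter_in_free_group reduced_def successively_append_iff)

    let ?D = "Q #>\<^bsub>?F\<^esub> u"
    have D: "?D \<in> rcosets\<^bsub>?F\<^esub> Q"
      using F.rcosetsI[OF Q.subset u(1)] .
    have CD: "C = ?D #>\<^bsub>?F\<^esub> [a]"
      using rep(1)[OF C w(1)] F.coset_mult_assoc[OF Q.subset u(1,3)] foldr_push_snoc[of u a] u(4) ua
        by simp
    have "u \<in> ?D"
      using F.rcos_self[OF u(1) Q] .
    then have "Suc (d ?D) \<le> d C"
      using d_le[of u ?D] w(2) ua by simp
    moreover obtain v where v: "v \<in> ?D" "length v = d ?D"
      using d_ex[OF \<open>u \<in> ?D\<close>] by blast
    have "foldr push v [a] \<in> C"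
      using v(1) unfolding CD by (auto simp: r_coset_def)
    then have "d C \<le> Suc (d ?D)"
      using d_le[of "foldr push v [a]" C] length_foldr_push[of v "[a]"] v(2) by simp
    ultimately show ?thesis
      using D CD u(2) by (intro bexI[OF _ D] exI[of _ a]) simp
  qed
  have "\<exists>D a. D \<in> rcosets\<^bsub>?F\<^esub> Q \<and> fst a \<in> B \<and> C = D #>\<^bsub>?F\<^esub> [a] \<and> d C = Suc (d D)"
    if "C \<in> rcosets\<^bsub>?F\<^esub> Q - {Q}" for C
    using parent[of C] that by blast
  then obtain par lab where par: "\<And>C. C \<in> rcosets\<^bsub>?F\<^esub> Q - {Q} \<Longrightarrow> par C \<in> rcosets\<^bsub>?F\<^esub> Q \<and>
      fst (lab C) \<in> B \<and> C = par C #>\<^bsub>?F\<^esub> [lab C] \<and> d C = Suc (d (par C))"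
    by metis
  \<comment> \<open>The recursion runs over the number of steps to the root, since a parent is one
    step closer; only the value with \<open>n = d C\<close> is used.\<close>
  define tt where "tt = rec_nat (\<lambda>C. []) (\<lambda>n r C. foldr push (r (par C)) [lab C])"
  define t where "t C = tt (d C) C" for C
  have dQ: "d Q = 0"
    using d_le[OF Q.one_closed] by simp
  have t: "t C = foldr push (t (par C)) [lab C]" if "C \<in> rcosets\<^bsub>?F\<^esub> Q - {Q}" for C
    using par[OF that] by (simp add: t_def tt_def)
  have "t C \<in> C" if "C \<in> rcosets\<^bsub>?F\<^esub> Q" for C
    using that
  proof (induction "d C" arbitrary: C rule: less_induct)
    case less
    show ?case
    proof (cases "C = Q")
      case True
      then show ?thesis using Q.one_closed dQ by (simp add: t_def tt_def)
    next
      case False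
      then have C: "C \<in> rcosets\<^bsub>?F\<^esub> Q - {Q}"
        using less.prems by simp
      have "t (par C) \<in> par C"
        using less.hyps[of "par C"] par[OF C] by simp
      then have "t C \<in> par C #>\<^bsub>?F\<^esub> [lab C]"
        unfolding t[OF C] by (auto simp: r_coset_def)
      then show ?thesis using par[OF C] by simp
    qed
  qed
  moreover have "t Q = []"
    using dQ by (simp add: t_def tt_def)
  ultimately show ?thesis
    using that[of t d] dQ par t by blast
qed

lemma free_group_hom_eqI:
  assumes "group L" "h \<in> hom (free_group B) L" "k \<in> hom (free_group B) L"
    and eq: "\<And>x. x \<in> B \<Longrightarrow> h [(x, True)] = k [(x, True)]" and w: "w \<in> carrier (free_group B)"
  shows "h w = k w"
proof -
  interpret L: group L by fact
  have "eval_word L (\<lambda>x. h [(x, True)]) w = eval_word L (\<lambda>x. k [(x, True)]) w"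
    using w unfolding in_carrier_free_group
    by (elim conjE, induction w) (use eq in \<open>auto simp: eval_word_def eval_letter_def reduced_Cons\<close>)
  then show ?thesis
    using L.hom_free_group_unique assms(2,3) w by metis
qed

text \<open>The free generators are the positive edges outside a spanning tree of the Schreier
  graph. Reading a word from \<open>Q\<close> and recording the crossed edges outside the tree
  defines \<open>c Q\<close>; sending each such edge to its Schreier element defines the inverse
  \<open>\<theta>\<close>.\<close>

theorem nielsen_schreier:
  fixes B :: "'x set"
  assumes Q: "subgroup Q (free_group B)"
  obtains Y :: "(('x \<times> bool) list set \<times> 'x) set" and \<Psi>
  where "\<Psi> \<in> iso ((free_group B)\<lparr>carrier := Q\<rparr>) (free_group Y)"
proof -
  let ?F = "free_group B" and ?FQ = "(free_group B)\<lparr>carrier := Q\<rparr>"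
    and ?Z = "rcosets\<^bsub>free_group B\<^esub> Q"
  interpret F: group ?F by (rule group_free_group)
  interpret Q: subgroup Q ?F by fact
  interpret FQ: group ?FQ using F.subgroup_imp_group[OF Q] .
  obtain t d where t: "t Q = []" "d Q = (0::nat)" "\<And>C. C \<in> ?Z \<Longrightarrow> t C \<in> C"
    "\<And>C. C \<in> ?Z \<Longrightarrow> C \<noteq> Q \<Longrightarrow> \<exists>D\<in>?Z. \<exists>a. fst a \<in> B \<and> C = D #>\<^bsub>?F\<^esub> [a] \<and>
        d C = Suc (d D) \<and> t C = foldr push (t D) [a]"
    using schreier_tree[OF Q] by metis
  have subset: "C \<subseteq> carrier ?F" if "C \<in> ?Z" for C
    using that F.rcosets_part_G[OF Q] by blast
  have QZ: "Q \<in> ?Z"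
    using F.rcosetsI[OF Q.subset F.one_closed] F.coset_mult_one[OF Q.subset] by simp
  have act: "right_action ?F ?Z (\<lambda>C w. C #>\<^bsub>?F\<^esub> w)"
    unfolding right_action_def
  proof (intro ballI conjI)
    fix C g h assume C: "C \<in> ?Z" and g: "g \<in> carrier ?F"
    obtain v where v: "v \<in> carrier ?F" "C = Q #>\<^bsub>?F\<^esub> v"
      using C by (auto simp: RCOSETS_def)
    show "C #>\<^bsub>?F\<^esub> g \<in> ?Z"
      using F.coset_mult_assoc[OF Q.subset v(1) g] F.rcosetsI[OF Q.subset F.m_closed[OF v(1) g]]
        v(2)
      by simp
    show "h \<in> carrier ?F \<Longrightarrow> C #>\<^bsub>?F\<^esub> (g \<otimes>\<^bsub>?F\<^esub> h) = C #>\<^bsub>?F\<^esub> g #>\<^bsub>?F\<^esub> h"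
      using F.coset_mult_assoc[OF subset[OF C] g] by simp
  next
    fix C assume "C \<in> ?Z"
    then show "C #>\<^bsub>?F\<^esub> \<one>\<^bsub>?F\<^esub> = C"
      using F.coset_mult_one[OF subset] by blast
  qed
  have tF: "t C \<in> carrier ?F" if "C \<in> ?Z" for C
    using t(3)[OF that] subset[OF that] by blast
  have Qt: "Q #>\<^bsub>?F\<^esub> t C = C" if C: "C \<in> ?Z" for C
  proof -
    obtain v where "v \<in> carrier ?F" "C = Q #>\<^bsub>?F\<^esub> v"
      using C by (auto simp: RCOSETS_def)
    then show ?thesis
      using t(3)[OF C] F.repr_independence[OF _ _ Q] by simp
  qed
  \<comment> \<open>A positive edge that runs along a tree edge in the opposite direction satisfies
    the equality too, so tree edges of both orientations are excluded.\<close>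
  define Y where "Y = {(C, x). C \<in> ?Z \<and> x \<in> B \<and>
    t C \<otimes>\<^bsub>?F\<^esub> [(x, True)] \<noteq> t (C #>\<^bsub>?F\<^esub> [(x, True)])}"
  let ?FY = "free_group Y"
  interpret FY: group ?FY by (rule group_free_group)
  define f where "f C x = (if (C, x) \<in> Y then [((C, x), True)] else [])" for C x
  have "f C x \<in> carrier ?FY" for C x
    using letter_in_free_group[of "((C, x), True)" Y] FY.one_closed by (auto simp: f_def)
  then obtain c where c: "cocycle ?F ?Z (\<lambda>C w. C #>\<^bsub>?F\<^esub> w) ?FY c"
    "\<And>C x. C \<in> ?Z \<Longrightarrow> x \<in> B \<Longrightarrow> c C [(x, True)] = f C x"
    using free_group_cocycle_exists[OF group_free_group act, of f Y] by metis
  note c1 = cocycle_one[OF group_free_group group_free_group act c(1)]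
  \<comment> \<open>Tree paths cross no edge outside the tree; a tree edge labelled by an inverse
    letter is treated through its reverse.\<close>
  have tree: "c Q (t C) = []" if "C \<in> ?Z" for C
    using that
  proof (induction "d C" arbitrary: C rule: less_induct)
    case less
    show ?case
    proof (cases "C = Q")
      case True
      then show ?thesis using c1[OF QZ] t(1) by simp
    next
      case False
      obtain D a where D: "D \<in> ?Z" "fst a \<in> B" "C = D #>\<^bsub>?F\<^esub> [a]" "d C = Suc (d D)"
        "t C = foldr push (t D) [a]"
        using t(4)[OF less.prems False] by blast
      have a: "[a] \<in> carrier ?F" "[inv_letter a] \<in> carrier ?F"
        using D(2) by (simp_all add: letter_in_free_group)
      have ret: "C #>\<^bsub>?F\<^esub> [inv_letter a] = D"
        using right_actionD(3)[OF act D(1) a] right_actionD(1)[OF act D(1)] D(3)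
        by (simp add: push_letter_inv)
      have "c D [a] = []"
      proof (cases "snd a")
        case True
        then have "a = (fst a, True)" by (cases a) simp
        then show ?thesis
          using c(2)[OF D(1,2)] D(1,2) D(3)[symmetric] D(5)[symmetric] by (simp add: f_def Y_def)
      next
        case False
        then have ia: "inv_letter a = (fst a, True)"
          by (simp add: inv_letter_def)
        have "t C \<otimes>\<^bsub>?F\<^esub> [inv_letter a] = t D \<otimes>\<^bsub>?F\<^esub> ([a] \<otimes>\<^bsub>?F\<^esub> [inv_letter a])"
          using D(5) F.m_assoc[OF tF[OF D(1)] a] by simp
        also have "\<dots> = t D"
          using tF[OF D(1)] by (simp add: push_letter_inv in_carrier_free_group foldr_push_reduced)
        finally have "c C [inv_letter a] = []"
          using c(2)[OF less.prems D(2)] ret ia by (auto simp: f_def Y_def)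
        then show ?thesis
          using cocycleD(1)[OF c(1) D(1) a(1)] cocycleD(2)[OF c(1) D(1) a] c1[OF D(1)] D(3)
            foldr_push_reduced[of "c D [a]"]
          by (simp add: push_letter_inv in_carrier_free_group[of _ Y])
      qed
      then show ?thesis
        using cocycleD(2)[OF c(1) QZ tF[OF D(1)] a(1)] Qt[OF D(1)] less.hyps[OF _ D(1)] D(4,5)
          by simp
    qed
  qed
  \<comment> \<open>The loop that follows the tree to \<open>C\<close>, then \<open>w\<close>, then
    the tree back. It is a cocycle because the tree paths in the middle cancel, and at the base
    coset it is the identity on \<open>Q\<close> since \<open>t Q\<close> is empty.\<close>
  define g where "g C w = t C \<otimes>\<^bsub>?F\<^esub> w \<otimes>\<^bsub>?F\<^esub> inv\<^bsub>?F\<^esub> t (C #>\<^bsub>?F\<^esub> w)" for C w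
  have gQ: "g C w \<in> Q" if C: "C \<in> ?Z" and w: "w \<in> carrier ?F" for C w
  proof -
    have Cw: "C #>\<^bsub>?F\<^esub> w \<in> ?Z"
      using right_actionD(2)[OF act C w] .
    have "Q #>\<^bsub>?F\<^esub> (t C \<otimes>\<^bsub>?F\<^esub> w) = Q #>\<^bsub>?F\<^esub> t (C #>\<^bsub>?F\<^esub> w)"
      using F.coset_mult_assoc[OF Q.subset tF[OF C] w] Qt[OF C] Qt[OF Cw] by simp
    then have "Q #>\<^bsub>?F\<^esub> g C w = Q"
      unfolding g_def by (rule F.coset_mult_inv2[OF _ F.m_closed[OF tF[OF C] w] tF[OF Cw] Q.subset])
    then show ?thesis
      by (rule F.coset_join1[OF _ _ Q]) (unfold g_def, intro F.m_closed F.inv_closed tF C w Cw)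
  qed
  have g: "cocycle ?F ?Z (\<lambda>C w. C #>\<^bsub>?F\<^esub> w) ?FQ g"
    unfolding cocycle_def
  proof (intro ballI conjI)
    fix C u v assume C: "C \<in> ?Z" and u: "u \<in> carrier ?F"
    show "g C u \<in> carrier ?FQ" using gQ[OF C u] by simp
    assume v: "v \<in> carrier ?F"
    have Cu: "C #>\<^bsub>?F\<^esub> u \<in> ?Z" and Cuv: "C #>\<^bsub>?F\<^esub> u #>\<^bsub>?F\<^esub> v \<in> ?Z"
      using right_actionD(2)[OF act] C u v by auto
    have "C #>\<^bsub>?F\<^esub> (u \<otimes>\<^bsub>?F\<^esub> v) = C #>\<^bsub>?F\<^esub> u #>\<^bsub>?F\<^esub> v"
      using right_actionD(3)[OF act C u v] .
    moreover have "inv\<^bsub>?F\<^esub> t (C #>\<^bsub>?F\<^esub> u) \<otimes>\<^bsub>?F\<^esub> (t (C #>\<^bsub>?F\<^esub> u) \<otimes>\<^bsub>?F\<^esub> z) = z" if "z \<in> carrier ?F"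
        for z
      using tF[OF Cu] that by (simp del: free_group_simps add: F.m_assoc[symmetric])
    ultimately show "g C (u \<otimes>\<^bsub>?F\<^esub> v) = g C u \<otimes>\<^bsub>?FQ\<^esub> g (C #>\<^bsub>?F\<^esub> u) v"
      using tF[OF C] tF[OF Cu] tF[OF Cuv] u v unfolding g_def
      by (simp del: free_group_simps add: F.m_assoc)
  qed
  define b where "b = (\<lambda>(C, x). g C [(x, True)])"
  have b: "b \<in> Y \<rightarrow> carrier ?FQ"
    using gQ by (auto simp: b_def Y_def letter_in_free_group)
  define \<theta> where "\<theta> = eval_word ?FQ b"
  have \<theta>: "\<theta> \<in> hom ?FY ?FQ"
    unfolding \<theta>_def using FQ.eval_word_hom[OF b] .
  interpret \<theta>: group_hom ?FY ?FQ \<theta>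
    by unfold_locales (rule \<theta>)
  have \<theta>c: "cocycle ?F ?Z (\<lambda>C w. C #>\<^bsub>?F\<^esub> w) ?FQ (\<lambda>C w. \<theta> (c C w))"
    unfolding cocycle_def
  proof (intro ballI conjI)
    fix C u v assume C: "C \<in> ?Z" and u: "u \<in> carrier ?F"
    show "\<theta> (c C u) \<in> carrier ?FQ"
      using cocycleD(1)[OF c(1) C u] by (rule \<theta>.hom_closed)
    assume v: "v \<in> carrier ?F"
    show "\<theta> (c C (u \<otimes>\<^bsub>?F\<^esub> v)) = \<theta> (c C u) \<otimes>\<^bsub>?FQ\<^esub> \<theta> (c (C #>\<^bsub>?F\<^esub> u) v)"
      unfolding cocycleD(2)[OF c(1) C u v]
      by (rule \<theta>.hom_mult[OF cocycleD(1)[OF c(1) C u] cocycleD(1)[OF c(1) right_actionD(2)[OF act C u] v]])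
  qed
  \<comment> \<open>Two cocycles need comparing on positive letters only: there they agree on
    \<open>Y\<close> by the choice of \<open>b\<close>, and elsewhere both are trivial.\<close>
  have \<theta>_eq: "\<theta> (c C w) = g C w" if "w \<in> carrier ?F" "C \<in> ?Z" for C w
  proof (rule free_group_cocycle_unique[OF FQ.is_group act \<theta>c g _ that])
    fix C x assume C: "C \<in> ?Z" "x \<in> B"
    show "\<theta> (c C [(x, True)]) = g C [(x, True)]"
    proof (cases "(C, x) \<in> Y")
      case True
      then show ?thesis
        using c(2)[OF C] FQ.eval_word_generator[OF b True] by (simp add: f_def \<theta>_def b_def)
    next
      case False
      then have "t C \<otimes>\<^bsub>?F\<^esub> [(x, True)] = t (C #>\<^bsub>?F\<^esub> [(x, True)])"
        using C by (simp add: Y_def)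
      then have "g C [(x, True)] = \<one>\<^bsub>?F\<^esub>"
        using F.r_inv tF right_actionD(2)[OF act C(1)] C(2)
        by (simp del: free_group_simps add: g_def letter_in_free_group)
      then show ?thesis
        using False c(2)[OF C] \<theta>.hom_one by (simp add: f_def)
    qed
  qed
  have QQ: "Q #>\<^bsub>?F\<^esub> q = Q" if "q \<in> Q" for q
    using F.coset_join2[OF _ Q that] Q.subset that by blast
  have hom: "c Q \<in> hom ?FQ ?FY"
    using cocycleD[OF c(1) QZ] Q.subset QQ by (intro homI) auto
  have \<theta>c_id: "\<theta> (c Q q) = q" if "q \<in> Q" for q
  proof -
    have "q \<in> carrier ?F" using that Q.subset by blast
    moreover have "inv\<^bsub>?F\<^esub> [] = []" "foldr push [] q = q"
      using F.inv_one by simp_all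
    ultimately show ?thesis
      using \<theta>_eq[OF _ QZ, of q] QQ[OF that] t(1)
      by (simp add: g_def in_carrier_free_group foldr_push_reduced)
  qed
  \<comment> \<open>Of the three stretches of the loop \<open>g C [(x, True)]\<close>, the two along
    the tree contribute nothing and the middle one contributes its edge.\<close>
  have c\<theta>_gen: "c Q (\<theta> [((C, x), True)]) = [((C, x), True)]" if Y: "(C, x) \<in> Y" for C x
  proof -
    let ?D = "C #>\<^bsub>?F\<^esub> [(x, True)]"
    have C: "C \<in> ?Z" "x \<in> B" and xF: "[(x, True)] \<in> carrier ?F" and D: "?D \<in> ?Z"
      using Y right_actionD(2)[OF act, of C "[(x, True)]"]
        by (auto simp: Y_def letter_in_free_group)
    have cD: "c ?D (inv\<^bsub>?F\<^esub> t ?D) = []"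
    proof -
      have "c Q (t ?D \<otimes>\<^bsub>?F\<^esub> inv\<^bsub>?F\<^esub> t ?D) = c Q (t ?D) \<otimes>\<^bsub>?FY\<^esub> c ?D (inv\<^bsub>?F\<^esub> t ?D)"
        using cocycleD(2)[OF c(1) QZ tF[OF D], of "inv\<^bsub>?F\<^esub> t ?D"] Qt[OF D] tF[OF D] F.inv_closed
          by simp
      then show ?thesis
        using F.r_inv[OF tF[OF D]] c1[OF QZ] tree[OF D] by simp
    qed
    have Dq: "Q #>\<^bsub>?F\<^esub> (t C \<otimes>\<^bsub>?F\<^esub> [(x, True)]) = ?D"
      using F.coset_mult_assoc[OF Q.subset tF[OF C(1)] xF] Qt[OF C(1)] by simp
    have "c Q (g C [(x, True)]) = c Q (t C \<otimes>\<^bsub>?F\<^esub> [(x, True)]) \<otimes>\<^bsub>?FY\<^esub> c ?D (inv\<^bsub>?F\<^esub> t ?D)"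
      unfolding g_def
        using cocycleD(2)[OF c(1) QZ F.m_closed[OF tF[OF C(1)] xF] F.inv_closed[OF tF[OF D]]] Dq
      by simp
    also have "c Q (t C \<otimes>\<^bsub>?F\<^esub> [(x, True)]) = c Q (t C) \<otimes>\<^bsub>?FY\<^esub> c C [(x, True)]"
      using cocycleD(2)[OF c(1) QZ tF[OF C(1)] xF] Qt[OF C(1)] by simp
    also have "c C [(x, True)] = [((C, x), True)]"
      using c(2)[OF C] Y by (simp add: f_def)
    finally have "c Q (g C [(x, True)]) = [((C, x), True)]"
      using tree[OF C(1)] cD by (simp add: push_def)
    moreover have "\<theta> [((C, x), True)] = g C [(x, True)]"
      using FQ.eval_word_generator[OF b Y] by (simp add: \<theta>_def b_def)
    ultimately show ?thesis by simp
  qed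
  have c\<theta>_id: "c Q (\<theta> v) = v" if v: "v \<in> carrier ?FY" for v
  proof -
    have h: "c Q \<circ> \<theta> \<in> hom ?FY ?FY"
      using hom_compose[OF \<theta> hom] .
    have "id \<in> hom ?FY ?FY"
      by (simp add: hom_def)
    then show ?thesis
      using free_group_hom_eqI[OF FY.is_group h _ _ v] c\<theta>_gen by force
  qed
  have "bij_betw (c Q) Q (carrier ?FY)"
    using \<theta>c_id c\<theta>_id \<theta>.hom_closed cocycleD(1)[OF c(1) QZ] Q.subset
    by (intro bij_betw_byWitness[where f' = \<theta>]) auto
  then have "c Q \<in> iso ?FQ ?FY"
    using hom by (simp add: iso_def)
  then show ?thesis by (rule that)
qed

section \<open>Free groups: residual finiteness and commutative transitivity\<close>

text \<open>In a finite set the complements of the domain and of the range of a partial injection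
  are equally large.\<close>

lemma Bij_extend:
  assumes S: "finite S" and D: "D \<subseteq> S" "inj_on g D" "g ` D \<subseteq> S"
  shows "\<exists>f\<in>Bij S. \<forall>v\<in>D. f v = g v"
proof -
  have "card (S - D) = card (S - g ` D)"
    using S D card_image[OF D(2)] by (simp add: card_Diff_subset finite_subset)
  then obtain h where h: "bij_betw h (S - D) (S - g ` D)"
    using S by (metis finite_Diff finite_same_card_bij)
  let ?f = "\<lambda>v\<in>S. if v \<in> D then g v else h v"
  have "bij_betw (\<lambda>v. if v \<in> D then g v else h v) (D \<union> (S - D)) (g ` D \<union> (S - g ` D))"
  proof (rule bij_betw_combine)
    show "bij_betw (\<lambda>v. if v \<in> D then g v else h v) D (g ` D)"
      using inj_on_imp_bij_betw[OF D(2)] by (rule bij_betw_cong[THEN iffD1, rotated]) simp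
    show "bij_betw (\<lambda>v. if v \<in> D then g v else h v) (S - D) (S - g ` D)"
      using h by (rule bij_betw_cong[THEN iffD1, rotated]) simp
  qed auto
  moreover have "D \<union> (S - D) = S" "g ` D \<union> (S - g ` D) = S"
    using D by blast+
  ultimately have "bij_betw (\<lambda>v. if v \<in> D then g v else h v) S S"
    by simp
  then have "bij_betw ?f S S"
    by (rule bij_betw_cong[THEN iffD1, rotated]) simp
  then have "?f \<in> Bij S"
    by (simp add: Bij_def)
  then show ?thesis
    using D(1) by (intro bexI[of _ ?f]) auto
qed

text \<open>The generators act by partial injections on the ball of radius \<open>n\<close> around the empty word;
  extending them to permutations of this finite ball separates all words of length at most \<open>n\<close>.\<close>

lemma free_group_residually_finite:
  fixes B :: "'x set"
  assumes W: "finite W" "W \<subseteq> carrier (free_group B)"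
  shows "\<exists>(L :: (('x \<times> bool) list \<Rightarrow> ('x \<times> bool) list) monoid) \<pi>. group L \<and> finite (carrier L) \<and>
    \<pi> \<in> hom (free_group B) L \<and> (\<forall>w\<in>W. w \<noteq> [] \<longrightarrow> \<pi> w \<noteq> \<one>\<^bsub>L\<^esub>)"
proof -
  define A where "A = (\<Union>w\<in>W. set w)"
  define n where "n = Max (insert 0 (length ` W))"
  define S where "S = {v. reduced v \<and> set v \<subseteq> A \<and> length v \<le> n}"
  have "finite A"
    using W(1) by (auto simp: A_def)
  then have finS: "finite S"
    using finite_subset[OF _ finite_lists_length_le[of A n], of S] by (auto simp: S_def)
  have WS: "W \<subseteq> S"
    using W by (auto simp: S_def A_def n_def in_carrier_free_group intro!: Max_ge)
  let ?D = "\<lambda>x. {v \<in> S. push (x, True) v \<in> S}"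
  have "\<exists>f\<in>Bij S. \<forall>v\<in>?D x. f v = push (x, True) v" for x
  proof (rule Bij_extend[OF finS])
    show "inj_on (push (x, True)) (?D x)"
    proof (rule inj_on_inverseI)
      fix v assume "v \<in> ?D x"
      then show "push (x, False) (push (x, True) v) = v"
        using push_push_inv[of v "(x, False)"] by (simp add: S_def inv_letter_def)
    qed
  qed auto
  then have "\<exists>f. \<forall>x. f x \<in> Bij S \<and> (\<forall>v\<in>?D x. f x v = push (x, True) v)"
    by (intro choice) blast
  then obtain f where f: "\<And>x. f x \<in> Bij S" "\<And>x v. v \<in> ?D x \<Longrightarrow> f x v = push (x, True) v"
    by blast
  let ?L = "BijGroup S"
  interpret L: group ?L by (rule group_BijGroup)
  have fL: "f \<in> B \<rightarrow> carrier ?L"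
    using f(1) by (simp add: BijGroup_def)
  define \<pi> where "\<pi> = eval_word ?L f"
  have \<pi>: "\<pi> \<in> hom (free_group B) ?L"
    unfolding \<pi>_def using L.eval_word_hom[OF fL] .
  have letter: "eval_letter ?L f a v = a # v" if "a # v \<in> S" for a v
  proof (cases "snd a")
    case True
    then have a: "a = (fst a, True)" by (cases a) simp
    have "push a v = a # v" "v \<in> S"
      using that by (auto simp: S_def reduced_Cons push_reduced)
    then have "v \<in> ?D (fst a)"
      using that a by simp
    then show ?thesis
      using True f(2)[of v "fst a"] \<open>push a v = a # v\<close> a by (simp add: eval_letter_def)
  next
    case False
    then have a: "inv_letter a = (fst a, True)" by (simp add: inv_letter_def)
    have v: "v \<in> S"
      using that by (auto simp: S_def reduced_Cons)
    have "push (fst a, True) (a # v) = v"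
      unfolding a[symmetric] by (simp add: push_def)
    then have "f (fst a) (a # v) = v"
      using f(2)[of "a # v" "fst a"] that v by simp
    then have "inv_into S (f (fst a)) v = a # v"
      using f(1)[of "fst a"] that by (auto simp: Bij_def bij_betw_def intro: inv_into_f_eq)
    then show ?thesis
      using False v f(1) by (simp add: eval_letter_def inv_BijGroup)
  qed
  \<comment> \<open>Applied from the right, the permutations build \<open>w\<close> up from the
    empty word one letter at a time. All suffixes stay in the ball, where the extensions agree with
    the action by \<open>push\<close>.\<close>
  have eval: "\<pi> w [] = w" if "w \<in> S" "w \<in> carrier (free_group B)" for w
    using that
  proof (induction w)
    case Nil
    then show ?case by (simp add: \<pi>_def eval_word_def BijGroup_def)
  next
    case (Cons a w)
    have "w \<in> S" "[] \<in> S" and "w \<in> carrier (free_group B)"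
      using Cons.prems Cons_in_free_group(2)[OF Cons.prems(2)] by (auto simp: S_def reduced_Cons)
    have "a \<in> B \<times> UNIV"
      using Cons_in_free_group(1)[OF Cons.prems(2)] by (cases a) simp
    then have "eval_letter ?L f a \<in> carrier ?L"
      by (rule L.eval_letter_closed[OF fL])
    moreover have "w \<in> lists (B \<times> UNIV)"
      using Cons_in_free_group(2)[OF Cons.prems(2)] by (simp only: in_carrier_free_group)
    then have "\<pi> w \<in> carrier ?L"
      unfolding \<pi>_def by (rule L.eval_word_closed[OF fL])
    moreover have "g \<otimes>\<^bsub>?L\<^esub> h = compose S g h" if "g \<in> carrier ?L" "h \<in> carrier ?L" for g h
      using that by (simp add: BijGroup_def)
    ultimately have "\<pi> (a # w) = compose S (eval_letter ?L f a) (\<pi> w)"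
      by (simp add: \<pi>_def eval_word_def)
    then show ?case
      using Cons.IH \<open>w \<in> S\<close> \<open>w \<in> carrier (free_group B)\<close> letter[OF Cons.prems(1)]
      by (simp add: compose_eq[OF \<open>[] \<in> S\<close>])
  qed
  have "\<pi> w \<noteq> \<one>\<^bsub>?L\<^esub>" if "w \<in> W" "w \<noteq> []" for w
  proof -
    have "\<pi> w [] = w" "[] \<in> S"
      using eval[of w] that W(2) WS by (auto simp: S_def)
    then show ?thesis
      using that(2) by (auto simp: BijGroup_def)
  qed
  moreover have "finite (carrier ?L)"
    using finite_subset[OF _ finite_PiE[OF finS, of "\<lambda>_. S"], of "Bij S"] finS
    by (auto simp: BijGroup_def Bij_def bij_betw_def PiE_def)
  ultimately show ?thesis
    using L.is_group \<pi> by blast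
qed

section \<open>Centres, centralizers and torsion in free groups\<close>

lemma free_group_two_generators:
  assumes uv: "u \<in> carrier (free_group Y)" "v \<in> carrier (free_group Y)"
    and ne: "foldr push u v \<noteq> foldr push v u"
  obtains y1 y2 where "y1 \<in> Y" "y2 \<in> Y" "y1 \<noteq> y2"
proof -
  let ?F = "free_group Y"
  interpret F: group ?F by (rule group_free_group)
  have conj: "(\<lambda>w. p \<otimes>\<^bsub>?F\<^esub> w \<otimes>\<^bsub>?F\<^esub> inv\<^bsub>?F\<^esub> p) \<in> hom ?F ?F" if "p \<in> carrier ?F" for p
    using that by (intro homI)
      (simp_all del: free_group_simps add: F.m_assoc F.inv_solve_left[symmetric] F.m_assoc[symmetric, of "inv\<^bsub>?F\<^esub> p" p])
  \<comment> \<open>Conjugation by \<open>p\<close> is a homomorphism that agrees with the identity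
    on the generators. With at most one generator this applies twice: first the generator is
    central, then every element is.\<close>
  have comm: "foldr push p w = foldr push w p"
    if "p \<in> carrier ?F" "w \<in> carrier ?F"
      "\<And>y. y \<in> Y \<Longrightarrow> foldr push p [(y, True)] = foldr push [(y, True)] p"
    for p w
  proof -
    have "p \<otimes>\<^bsub>?F\<^esub> w \<otimes>\<^bsub>?F\<^esub> inv\<^bsub>?F\<^esub> p = id w"
    proof (rule free_group_hom_eqI[OF F.is_group conj[OF that(1)] _ _ that(2)])
      fix y assume y: "y \<in> Y"
      then have "[(y, True)] \<in> carrier ?F"
        by (simp add: letter_in_free_group)
      then show "p \<otimes>\<^bsub>?F\<^esub> [(y, True)] \<otimes>\<^bsub>?F\<^esub> inv\<^bsub>?F\<^esub> p = id [(y, True)]"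
        using that(1) that(3)[OF y] F.inv_solve_right[of "[(y, True)]" "foldr push [(y, True)] p" p]
          F.m_closed[of "[(y, True)]" p] by simp
    qed (simp add: hom_def)
    then have "p \<otimes>\<^bsub>?F\<^esub> w = w \<otimes>\<^bsub>?F\<^esub> p"
      using that(1,2) F.inv_solve_right[of w "p \<otimes>\<^bsub>?F\<^esub> w" p] F.m_closed[of p w] by simp
    then show ?thesis by simp
  qed
  have "\<exists>y1 y2. y1 \<in> Y \<and> y2 \<in> Y \<and> y1 \<noteq> y2"
  proof (rule ccontr)
    assume "\<not> ?thesis"
    then have one: "\<And>y1 y2. y1 \<in> Y \<Longrightarrow> y2 \<in> Y \<Longrightarrow> y1 = y2" by blast
    have "foldr push [(y, True)] w = foldr push w [(y, True)]" if "y \<in> Y" "w \<in> carrier ?F" for y w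
    proof (rule comm)
      fix z assume "z \<in> Y"
      then have "z = y" using one that(1) by blast
      then show "foldr push [(y, True)] [(z, True)] = foldr push [(z, True)] [(y, True)]" by simp
    qed (use that in \<open>auto simp: letter_in_free_group\<close>)
    then show False
      using comm[OF uv] uv(1) ne by simp
  qed
  then show ?thesis using that by blast
qed

text \<open>A letter \<open>d\<close> whose generator differs from that of the first letter of
  \<open>w\<close> does not cancel on the left of \<open>w\<close>, so that product starts with
  \<open>d\<close>. The product in the other order keeps the first letter of \<open>w\<close> or has
  collapsed to a word that is too short.\<close>

lemma free_group_center_trivial:
  assumes y: "y1 \<in> Y" "y2 \<in> Y" "y1 \<noteq> y2" and w: "w \<in> carrier (free_group Y)"
    and comm: "\<And>y. y \<in> Y \<Longrightarrow> foldr push w [(y, True)] = foldr push [(y, True)] w"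
  shows "w = []"
proof (rule ccontr)
  assume "w \<noteq> []"
  then obtain c v where v: "w = c # v" by (cases w) auto
  obtain d where d: "d \<in> Y" "d \<noteq> fst c"
    using y by metis
  have "push (d, True) w = (d, True) # w"
    using d v by (auto simp: push_def inv_letter_def)
  then have eq: "push c (foldr push v [(d, True)]) = (d, True) # w"
    using comm[OF d(1)] v by simp
  have "length (foldr push v [(d, True)]) \<le> Suc (length v)"
    using length_foldr_push[of v "[(d, True)]"] by simp
  then show False
    using eq v d(2) by (auto simp: push_def split: list.splits if_splits)
qed

lemma (in group) subgroup_centralizer:
  assumes x: "x \<in> carrier G"
  shows "subgroup {q \<in> carrier G. x \<otimes> q = q \<otimes> x} G"
proof (rule subgroupI)
  fix q assume "q \<in> {q \<in> carrier G. x \<otimes> q = q \<otimes> x}"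
  then have q: "q \<in> carrier G" "x \<otimes> q = q \<otimes> x" by simp_all
  have "inv q \<otimes> x = inv q \<otimes> (x \<otimes> q) \<otimes> inv q"
    using q(1) x by (simp add: m_assoc)
  also have "\<dots> = x \<otimes> inv q"
    unfolding q(2) using q(1) x by (simp add: m_assoc[symmetric])
  finally show "inv q \<in> {q \<in> carrier G. x \<otimes> q = q \<otimes> x}" using q(1) by simp
next
  fix p q assume "p \<in> {q \<in> carrier G. x \<otimes> q = q \<otimes> x}" "q \<in> {q \<in> carrier G. x \<otimes> q = q \<otimes> x}"
  then have pq: "p \<in> carrier G" "q \<in> carrier G" "x \<otimes> p = p \<otimes> x" "x \<otimes> q = q \<otimes> x"
    by simp_all
  have "x \<otimes> (p \<otimes> q) = p \<otimes> x \<otimes> q"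
    using m_assoc[OF x pq(1,2)] pq(3) by simp
  also have "\<dots> = p \<otimes> q \<otimes> x"
    using m_assoc[OF pq(1) x pq(2)] m_assoc[OF pq(1,2) x] pq(4) by simp
  finally show "p \<otimes> q \<in> {q \<in> carrier G. x \<otimes> q = q \<otimes> x}" using pq by simp
qed (use x in auto)

text \<open>The centralizer of \<open>x\<close> is free by Nielsen--Schreier and has the nontrivial
  central element \<open>x\<close>. A free group with two generators has trivial centre, so the
  centralizer is commutative.\<close>

lemma free_group_commutative_transitive:
  fixes B :: "'x set"
  assumes "x \<in> carrier (free_group B)" "y \<in> carrier (free_group B)" "z \<in> carrier (free_group B)"
    and "x \<noteq> []" "foldr push x y = foldr push y x" "foldr push x z = foldr push z x"
  shows "foldr push y z = foldr push z y"
proof (rule ccontr)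
  assume ne: "foldr push y z \<noteq> foldr push z y"
  let ?F = "free_group B"
  interpret F: group ?F by (rule group_free_group)
  define Q where "Q = {q \<in> carrier ?F. x \<otimes>\<^bsub>?F\<^esub> q = q \<otimes>\<^bsub>?F\<^esub> x}"
  have "subgroup Q ?F"
    using F.subgroup_centralizer[OF assms(1)] by (simp only: Q_def)
  then obtain Y :: "(('x \<times> bool) list set \<times> 'x) set" and \<Psi>
      where \<Psi>: "\<Psi> \<in> iso (?F\<lparr>carrier := Q\<rparr>) (free_group Y)"
    by (rule nielsen_schreier)
  then have hom: "\<Psi> (foldr push p q) = foldr push (\<Psi> p) (\<Psi> q)" "\<Psi> p \<in> carrier (free_group Y)"
    if "p \<in> Q" "q \<in> Q" for p q
    using that by (auto simp: iso_def hom_def)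
  have bij: "bij_betw \<Psi> Q (carrier (free_group Y))"
    using \<Psi> by (simp add: iso_def)
  have xyz: "x \<in> Q" "y \<in> Q" "z \<in> Q" and one: "[] \<in> Q"
    using assms F.one_closed by (auto simp: Q_def foldr_push_reduced in_carrier_free_group)
  have yz: "foldr push y z \<in> Q" "foldr push z y \<in> Q"
    using \<open>subgroup Q ?F\<close> xyz subgroup.m_closed by fastforce+
  have "foldr push (\<Psi> y) (\<Psi> z) \<noteq> foldr push (\<Psi> z) (\<Psi> y)"
    using ne hom xyz yz bij by (metis bij_betw_def inj_onD)
  then obtain y1 y2 where y: "y1 \<in> Y" "y2 \<in> Y" "y1 \<noteq> y2"
    using free_group_two_generators hom(2) xyz by metis
  have "\<Psi> x = []"
  proof (rule free_group_center_trivial[OF y])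
    fix b assume "b \<in> Y"
    then obtain q where q: "q \<in> Q" "\<Psi> q = [(b, True)]"
      using bij letter_in_free_group[of "(b, True)" Y] unfolding bij_betw_def by force
    then show "foldr push (\<Psi> x) [(b, True)] = foldr push [(b, True)] (\<Psi> x)"
      using hom(1)[OF xyz(1) q(1)] hom(1)[OF q(1) xyz(1)] by (simp add: Q_def)
  qed (use hom(2) xyz in blast)
  moreover have "\<Psi> [] = []"
    using hom(1)[OF one one] hom(2)[OF one one]
      group.r_cancel_one[OF group_free_group, of "\<Psi> []" Y "\<Psi> []"]
    by simp
  ultimately show False
    using bij xyz one assms(4) by (metis bij_betw_def inj_onD)
qed

text \<open>A torsion element would generate a finite nontrivial subgroup, which is free and
  therefore contains infinitely many powers of a generator.\<close>

lemma free_group_torsion_free: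
  fixes B :: "'x set"
  assumes x: "x \<in> carrier (free_group B)" "x \<noteq> []" and n: "n > 0"
  shows "x [^]\<^bsub>free_group B\<^esub> (n::nat) \<noteq> []"
proof
  let ?F = "free_group B"
  interpret F: group ?F by (rule group_free_group)
  let ?Q = "generate ?F {x}"
  assume "x [^]\<^bsub>?F\<^esub> n = []"
  then have "F.ord x dvd n"
    using F.pow_eq_id[OF x(1), of n] by simp
  then have "finite ?Q"
    using n F.generate_pow_card[OF x(1)] card.infinite by fastforce
  have "subgroup ?Q ?F"
    using F.generate_is_subgroup x(1) by simp
  then obtain Y :: "(('x \<times> bool) list set \<times> 'x) set" and \<Psi>
      where \<Psi>: "\<Psi> \<in> iso (?F\<lparr>carrier := ?Q\<rparr>) (free_group Y)"
    by (rule nielsen_schreier)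
  then have bij: "bij_betw \<Psi> ?Q (carrier (free_group Y))"
    by (simp add: iso_def)
  have "x \<in> ?Q" "[] \<in> ?Q"
    using generate.incl[of x "{x}" ?F] generate.one[of ?F "{x}"] by auto
  then have "\<Psi> x \<noteq> \<Psi> []" "\<Psi> x \<in> carrier (free_group Y)" "\<Psi> [] \<in> carrier (free_group Y)"
    using bij x(2) by (auto simp: bij_betw_def inj_on_def)
  moreover have "w = []" if "w \<in> carrier (free_group Y)" "Y = {}" for w
    using that by (cases w) (auto simp: in_carrier_free_group)
  ultimately obtain b where b: "b \<in> Y"
    by (metis ex_in_conv)
  have "replicate k (b, True) \<in> carrier (free_group Y)" for k
    using b by (induction k)
      (auto simp: in_carrier_free_group reduced_Cons inv_letter_def hd_replicate)
  then have "range (\<lambda>k. replicate k (b, True)) \<subseteq> carrier (free_group Y)" by blast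
  moreover have "infinite (range (\<lambda>k. replicate k (b, True)))"
    by (rule range_inj_infinite) (auto intro!: injI dest: arg_cong[where f = length])
  ultimately have "infinite (carrier (free_group Y))"
    using finite_subset by blast
  then show False
    using bij \<open>finite ?Q\<close> bij_betw_finite by blast
qed

section \<open>Fully residually free groups\<close>

lemma fully_residually_free_subgroup:
  assumes G: "fully_residually_free G" and H: "subgroup H G"
  shows "fully_residually_free (G\<lparr>carrier := H\<rparr>)"
  unfolding fully_residually_free_def
proof (intro allI impI)
  fix S assume S: "finite S \<and> S \<subseteq> carrier (G\<lparr>carrier := H\<rparr>) - {\<one>\<^bsub>G\<lparr>carrier := H\<rparr>\<^esub>}"
  then have "finite S \<and> S \<subseteq> carrier G - {\<one>\<^bsub>G\<^esub>}"
    using subgroup.subset[OF H] by auto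
  then obtain B :: "nat set" and \<phi> where "\<phi> \<in> hom G (free_group B)" "\<forall>g\<in>S. \<phi> g \<noteq> \<one>\<^bsub>free_group B\<^esub>"
    using G unfolding fully_residually_free_def by meson
  moreover have "\<phi> \<in> hom (G\<lparr>carrier := H\<rparr>) (free_group B)"
    using calculation(1) subgroup.subset[OF H] by (auto simp: hom_def)
  ultimately show "\<exists>(B :: nat set) \<phi>. \<phi> \<in> hom (G\<lparr>carrier := H\<rparr>) (free_group B) \<and>
      (\<forall>g\<in>S. \<phi> g \<noteq> \<one>\<^bsub>free_group B\<^esub>)"
    by blast
qed

context group
begin

lemma commutator_eq_one_iff:
  assumes "x \<in> carrier G" "y \<in> carrier G"
  shows "x \<otimes> y \<otimes> inv (y \<otimes> x) = \<one> \<longleftrightarrow> x \<otimes> y = y \<otimes> x"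
  using assms by (metis inv_closed inv_inv inv_unique' m_closed r_inv inv_equality)

lemma frf_separating_hom:
  assumes "fully_residually_free G" "finite S" "S \<subseteq> carrier G - {\<one>}"
  obtains B :: "nat set" and \<phi> where "\<phi> \<in> hom G (free_group B)" "\<And>g. g \<in> S \<Longrightarrow> \<phi> g \<noteq> []"
  using assms unfolding fully_residually_free_def by (metis free_group_simps(2))

text \<open>The homomorphism has to keep \<open>x\<close> and the commutator of \<open>y\<close> and
  \<open>z\<close> nontrivial simultaneously; separating single elements would not be
  enough.\<close>

lemma frf_commutative_transitive:
  assumes frf: "fully_residually_free G" and c: "x \<in> carrier G" "y \<in> carrier G" "z \<in> carrier G"
    and x: "x \<noteq> \<one>" and xy: "x \<otimes> y = y \<otimes> x" and xz: "x \<otimes> z = z \<otimes> x"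
  shows "y \<otimes> z = z \<otimes> y"
proof (rule ccontr)
  assume ne: "y \<otimes> z \<noteq> z \<otimes> y"
  let ?k = "y \<otimes> z \<otimes> inv (z \<otimes> y)"
  have k: "?k \<in> carrier G" "?k \<noteq> \<one>"
    using c ne commutator_eq_one_iff by auto
  then obtain B :: "nat set" and \<phi> where \<phi>: "\<phi> \<in> hom G (free_group B)" "\<And>g. g \<in> {x, ?k} \<Longrightarrow> \<phi> g \<noteq> []"
    using frf_separating_hom[OF frf, of "{x, ?k}"] c(1) x
      by (metis Diff_iff empty_subsetI finite.emptyI finite_insert insert_subset singletonD)
  interpret \<phi>: group_hom G "free_group B" \<phi>
    by (intro group_hom.intro group_hom_axioms.intro is_group group_free_group \<phi>(1))
  have "foldr push (\<phi> x) (\<phi> y) = foldr push (\<phi> y) (\<phi> x)"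
      "foldr push (\<phi> x) (\<phi> z) = foldr push (\<phi> z) (\<phi> x)"
    using \<phi>.hom_mult[OF c(1,2)] \<phi>.hom_mult[OF c(2,1)] \<phi>.hom_mult[OF c(1,3)] \<phi>.hom_mult[OF c(3,1)] xy
      xz by auto
  then have "foldr push (\<phi> y) (\<phi> z) = foldr push (\<phi> z) (\<phi> y)"
    using free_group_commutative_transitive[OF \<phi>.hom_closed[OF c(1)] \<phi>.hom_closed[OF c(2)] \<phi>.hom_closed[OF c(3)]] \<phi>(2)
    by simp
  then have "\<phi> (y \<otimes> z) = \<phi> (z \<otimes> y)"
    using \<phi>.hom_mult[OF c(2,3)] \<phi>.hom_mult[OF c(3,2)] by simp
  then have "\<phi> ?k = \<one>\<^bsub>free_group B\<^esub>"
    using c \<phi>.hom_mult[of "y \<otimes> z" "inv (z \<otimes> y)"] \<phi>.hom_inv[of "z \<otimes> y"] \<phi>.hom_closed[of "z \<otimes> y"]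
      group.r_inv[OF group_free_group, of "\<phi> (z \<otimes> y)"] by (simp del: free_group_simps)
  then show False using \<phi>(2)[of ?k] by simp
qed

lemma frf_torsion_free:
  assumes frf: "fully_residually_free G" and x: "x \<in> carrier G" "x \<noteq> \<one>" and n: "n > 0"
  shows "x [^] (n::nat) \<noteq> \<one>"
proof
  assume eq: "x [^] n = \<one>"
  obtain B :: "nat set" and \<phi> where \<phi>: "\<phi> \<in> hom G (free_group B)" "\<And>g. g \<in> {x} \<Longrightarrow> \<phi> g \<noteq> []"
    using frf_separating_hom[OF frf, of "{x}"] x
      by (metis Diff_iff empty_subsetI finite.emptyI finite_insert insert_subset singletonD)
  interpret \<phi>: group_hom G "free_group B" \<phi>
    by (intro group_hom.intro group_hom_axioms.intro is_group group_free_group \<phi>(1))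
  have "\<phi> x [^]\<^bsub>free_group B\<^esub> n = []"
    using \<phi>.hom_nat_pow[OF x(1), of n] eq \<phi>.hom_one by simp
  then show False
    using free_group_torsion_free[OF \<phi>.hom_closed[OF x(1)] _ n] \<phi>(2) by simp
qed

text \<open>By the Nielsen--Schreier theorem the separating homomorphisms may be taken onto.\<close>

lemma frf_free_quotient:
  assumes frf: "fully_residually_free G" and S: "finite S" "S \<subseteq> carrier G - {\<one>}"
    and ab: "a \<in> carrier G" "b \<in> carrier G" "a \<otimes> b \<noteq> b \<otimes> a"
  obtains Y :: "((nat \<times> bool) list set \<times> nat) set" and \<phi> y1 y2
  where "\<phi> \<in> hom G (free_group Y)" "\<phi> ` carrier G = carrier (free_group Y)"
    "\<And>g. g \<in> S \<Longrightarrow> \<phi> g \<noteq> []" "y1 \<in> Y" "y2 \<in> Y" "y1 \<noteq> y2"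
proof -
  let ?k = "a \<otimes> b \<otimes> inv (b \<otimes> a)"
  have k: "?k \<in> carrier G" "?k \<noteq> \<one>"
    using ab commutator_eq_one_iff by auto
  \<comment> \<open>Keeping the commutator of \<open>a\<close> and \<open>b\<close> alive makes the
    image non-abelian, so that its free basis has two elements.\<close>
  obtain B :: "nat set" and \<phi> where \<phi>: "\<phi> \<in> hom G (free_group B)" "\<And>g. g \<in> insert ?k S \<Longrightarrow> \<phi> g \<noteq> []"
    by (rule frf_separating_hom[OF frf, of "insert ?k S"]) (use S k in auto)
  interpret \<phi>: group_hom G "free_group B" \<phi>
    by (intro group_hom.intro group_hom_axioms.intro is_group group_free_group \<phi>(1))
  let ?Q = "\<phi> ` carrier G"
  have Q: "subgroup ?Q (free_group B)"
    using \<phi>.img_is_subgroup .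
  obtain Y :: "((nat \<times> bool) list set \<times> nat) set" and \<Psi>
    where \<Psi>: "\<Psi> \<in> iso (free_group B\<lparr>carrier := ?Q\<rparr>) (free_group Y)"
    using nielsen_schreier[OF Q] .
  have hom: "\<Psi> \<circ> \<phi> \<in> hom G (free_group Y)"
  proof (rule Group.hom_compose)
    show "\<phi> \<in> hom G (free_group B\<lparr>carrier := ?Q\<rparr>)"
      using \<phi>(1) by (auto simp: hom_def)
    show "\<Psi> \<in> hom (free_group B\<lparr>carrier := ?Q\<rparr>) (free_group Y)"
      using \<Psi> by (simp add: iso_def)
  qed
  have bij: "bij_betw \<Psi> ?Q (carrier (free_group Y))"
    using \<Psi> by (simp add: iso_def)
  interpret \<Psi>\<phi>: group_hom G "free_group Y" "\<Psi> \<circ> \<phi>"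
    by (intro group_hom.intro group_hom_axioms.intro is_group group_free_group hom)
  have sep: "(\<Psi> \<circ> \<phi>) g \<noteq> []" if "g \<in> carrier G" "\<phi> g \<noteq> []" for g
  proof
    assume "(\<Psi> \<circ> \<phi>) g = []"
    then have "\<Psi> (\<phi> g) = \<Psi> (\<phi> \<one>)"
      using \<Psi>\<phi>.hom_one by simp
    then have "\<phi> g = \<phi> \<one>"
      using inj_onD[OF bij_betw_imp_inj_on[OF bij]] that(1) by blast
    then show False using that(2) \<phi>.hom_one by simp
  qed
  have "(\<Psi> \<circ> \<phi>) ?k \<noteq> []"
    using sep k(1) \<phi>(2) by blast
  moreover have "(\<Psi> \<circ> \<phi>) ?k = []"
      if "foldr push ((\<Psi> \<circ> \<phi>) a) ((\<Psi> \<circ> \<phi>) b) = foldr push ((\<Psi> \<circ> \<phi>) b) ((\<Psi> \<circ> \<phi>) a)"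
  proof -
    have "(\<Psi> \<circ> \<phi>) (a \<otimes> b) = (\<Psi> \<circ> \<phi>) (b \<otimes> a)"
      using \<Psi>\<phi>.hom_mult[OF ab(1,2)] \<Psi>\<phi>.hom_mult[OF ab(2,1)] that by (simp del: o_apply)
    then have "(\<Psi> \<circ> \<phi>) ?k = \<one>\<^bsub>free_group Y\<^esub>"
      using ab \<Psi>\<phi>.hom_mult[of "a \<otimes> b" "inv (b \<otimes> a)"] \<Psi>\<phi>.hom_inv[of "b \<otimes> a"]
        \<Psi>\<phi>.hom_closed[of "b \<otimes> a"]
        group.r_inv[OF group_free_group, of "(\<Psi> \<circ> \<phi>) (b \<otimes> a)"]
          by (simp del: free_group_simps o_apply)
    then show ?thesis by simp
  qed
  ultimately have "foldr push ((\<Psi> \<circ> \<phi>) a) ((\<Psi> \<circ> \<phi>) b) \<noteq> foldr push ((\<Psi> \<circ> \<phi>) b) ((\<Psi> \<circ> \<phi>) a)"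
    by blast
  then obtain y1 y2 where "y1 \<in> Y" "y2 \<in> Y" "y1 \<noteq> y2"
    by (rule free_group_two_generators[OF \<Psi>\<phi>.hom_closed[OF ab(1)] \<Psi>\<phi>.hom_closed[OF ab(2)]])
  moreover have "(\<Psi> \<circ> \<phi>) ` carrier G = carrier (free_group Y)"
    using bij by (simp add: bij_betw_def image_comp)
  moreover have "(\<Psi> \<circ> \<phi>) g \<noteq> []" if "g \<in> S" for g
    using sep[of g] that S(2) \<phi>(2) by blast
  ultimately show ?thesis
    using that[OF hom] by blast
qed

end

section \<open>Harmonic functions of finite energy\<close>

lemma homogeneous_system_nontrivial_solution:
  fixes a :: "'j \<Rightarrow> 'i \<Rightarrow> real"
  assumes "finite J" "finite I" "card J < card I"
  shows "\<exists>\<xi>. (\<exists>i\<in>I. \<xi> i \<noteq> 0) \<and> (\<forall>j\<in>J. (\<Sum>i\<in>I. a j i * \<xi> i) = 0)"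
  using assms
proof (induction J arbitrary: I a rule: finite_induct)
  case empty
  then obtain i where "i \<in> I" by fastforce
  then show ?case by (intro exI[of _ "\<lambda>_. 1"]) auto
next
  case (insert j J)
  show ?case
  proof (cases "\<forall>i\<in>I. a j i = 0")
    case True
    have "card J < card I" using insert by simp
    then obtain \<xi> where "\<exists>i\<in>I. \<xi> i \<noteq> 0" "\<forall>j\<in>J. (\<Sum>i\<in>I. a j i * \<xi> i) = 0"
      using insert.IH[OF insert.prems(1), of a] by blast
    then show ?thesis using True by (intro exI[of _ \<xi>]) auto
  next
    case False
    then obtain i0 where i0: "i0 \<in> I" "a j i0 \<noteq> 0" by blast
    \<comment> \<open>Equation \<open>j\<close> is solved for the unknown \<open>i0\<close> and
      substituted into the others; \<open>\<xi>'\<close> restores that unknown afterwards.\<close>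
    define a' where "a' k i = a k i - a k i0 * a j i / a j i0" for k i
    have "card J < card (I - {i0})"
      using insert i0(1) by simp
    then obtain \<xi> where \<xi>: "\<exists>i\<in>I - {i0}. \<xi> i \<noteq> 0" "\<forall>k\<in>J. (\<Sum>i\<in>I - {i0}. a' k i * \<xi> i) = 0"
      using insert.IH[of "I - {i0}" a'] insert.prems(1) by blast
    define s where "s = (\<Sum>i\<in>I - {i0}. a j i * \<xi> i)"
    define \<xi>' where "\<xi>' = \<xi>(i0 := - s / a j i0)"
    have sum: "(\<Sum>i\<in>I. a k i * \<xi>' i) = (\<Sum>i\<in>I - {i0}. a k i * \<xi> i) - a k i0 * s / a j i0" for k
      using sum.remove[OF insert.prems(1) i0(1), of "\<lambda>i. a k i * \<xi>' i"] by (simp add: \<xi>'_def)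
    have "(\<Sum>i\<in>I - {i0}. a' k i * \<xi> i) = (\<Sum>i\<in>I - {i0}. a k i * \<xi> i) - a k i0 * s / a j i0" for k
      by (simp add: a'_def s_def left_diff_distrib sum_subtractf sum_distrib_left sum_divide_distrib mult.assoc)
    then have "\<forall>k\<in>J. (\<Sum>i\<in>I. a k i * \<xi>' i) = 0"
      using \<xi>(2) sum by simp
    moreover have "(\<Sum>i\<in>I. a j i * \<xi>' i) = 0"
      using i0(2) by (simp add: sum s_def)
    moreover have "\<exists>i\<in>I. \<xi>' i \<noteq> 0"
      using \<xi>(1) by (auto simp: \<xi>'_def)
    ultimately show ?thesis by blast
  qed
qed

context group
begin

text \<open>The edge \<open>(x, s)\<close> of the graph of the quotient carries the value
  \<open>z x s\<close>. The function \<open>z x\<close> is a primitive, based at \<open>x\<close>,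
  of the lift of this edge function to \<open>G\<close>; it need not descend to
  \<open>L\<close>.\<close>

definition additive_cocycle :: "('l, 'n) monoid_scheme \<Rightarrow> ('a \<Rightarrow> 'l) \<Rightarrow> ('l \<Rightarrow> 'a \<Rightarrow> real) \<Rightarrow> bool" where
  "additive_cocycle L \<pi> z \<longleftrightarrow> (\<forall>x\<in>carrier L. \<forall>g\<in>carrier G. \<forall>h\<in>carrier G.
     z x (g \<otimes> h) = z x g + z (x \<otimes>\<^bsub>L\<^esub> \<pi> g) h)"

abbreviation pairing :: "('l, 'n) monoid_scheme \<Rightarrow> 'a set \<Rightarrow> ('l \<Rightarrow> 'a \<Rightarrow> real) \<Rightarrow> ('l \<Rightarrow> 'a \<Rightarrow> real) \<Rightarrow>
  real" where
  "pairing L S z w \<equiv> \<Sum>x\<in>carrier L. \<Sum>s\<in>S. z x s * w x s"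

text \<open>Zero divergence at every vertex of the quotient graph, which makes the primitives
  \<open>z x\<close> harmonic on \<open>G\<close>.\<close>

definition balanced :: "'a set \<Rightarrow> ('l, 'n) monoid_scheme \<Rightarrow> ('a \<Rightarrow> 'l) \<Rightarrow> ('l \<Rightarrow> 'a \<Rightarrow> real) \<Rightarrow> bool" where
  "balanced S L \<pi> z \<longleftrightarrow> (\<forall>x\<in>carrier L. (\<Sum>s\<in>S. z x s - z (x \<otimes>\<^bsub>L\<^esub> inv\<^bsub>L\<^esub> \<pi> s) s) = 0)"

lemma additive_cocycleD:
  "additive_cocycle L \<pi> z \<Longrightarrow> x \<in> carrier L \<Longrightarrow> g \<in> carrier G \<Longrightarrow> h \<in> carrier G \<Longrightarrow>
    z x (g \<otimes> h) = z x g + z (x \<otimes>\<^bsub>L\<^esub> \<pi> g) h"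
  by (simp add: additive_cocycle_def)

lemma additive_cocycle_one:
  assumes "group L" "\<pi> \<in> hom G L" "additive_cocycle L \<pi> z" "x \<in> carrier L"
  shows "z x \<one> = 0"
proof -
  interpret \<pi>: group_hom G L \<pi>
    by (intro group_hom.intro group_hom_axioms.intro is_group assms)
  show ?thesis
    using additive_cocycleD[OF assms(3,4), of \<one> \<one>] assms(4) by simp
qed

lemma additive_cocycle_sum:
  assumes "\<And>i. i \<in> I \<Longrightarrow> additive_cocycle L \<pi> (z i)"
  shows "additive_cocycle L \<pi> (\<lambda>x g. \<Sum>i\<in>I. c i * z i x g)"
  using assms by (simp add: additive_cocycle_def sum.distrib[symmetric] ring_distribs)

lemma balanced_sum:
  assumes "\<And>i. i \<in> I \<Longrightarrow> balanced S L \<pi> (z i)"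
  shows "balanced S L \<pi> (\<lambda>x g. \<Sum>i\<in>I. c i * z i x g)"
proof -
  have "(\<Sum>s\<in>S. (\<Sum>i\<in>I. c i * z i x s) - (\<Sum>i\<in>I. c i * z i (x \<otimes>\<^bsub>L\<^esub> inv\<^bsub>L\<^esub> \<pi> s) s)) =
      (\<Sum>i\<in>I. c i * (\<Sum>s\<in>S. z i x s - z i (x \<otimes>\<^bsub>L\<^esub> inv\<^bsub>L\<^esub> \<pi> s) s))" for x
    unfolding sum_distrib_left sum_subtractf[symmetric] right_diff_distrib[symmetric]
      by (rule sum.swap)
  then show ?thesis
    using assms by (simp add: balanced_def)
qed

text \<open>Prescribing a cocycle freely on two generators of the free quotient gives \<open>2 |L|\<close>
  linearly independent cocycles.\<close>

lemma cocycle_basis: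
  assumes \<phi>: "\<phi> \<in> hom G (free_group Y)" "\<phi> ` carrier G = carrier (free_group Y)"
    and y: "y1 \<in> Y" "y2 \<in> Y" "y1 \<noteq> y2" and L: "group L" and \<pi>: "\<pi> \<in> hom (free_group Y) L"
  obtains k :: "bool \<Rightarrow> 'a" and z where "\<And>j. k j \<in> carrier G"
    "\<And>i. additive_cocycle L (\<pi> \<circ> \<phi>) (z i)"
    "\<And>i x j. x \<in> carrier L \<Longrightarrow> z i x (k j) = (if i = (x, j) then 1 else 0)"
proof -
  interpret \<phi>: group_hom G "free_group Y" \<phi>
    by (intro group_hom.intro group_hom_axioms.intro is_group group_free_group \<phi>)
  interpret \<pi>: group_hom "free_group Y" L \<pi>
    by (intro group_hom.intro group_hom_axioms.intro L group_free_group \<pi>)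
  let ?act = "\<lambda>x w. x \<otimes>\<^bsub>L\<^esub> \<pi> w"
  let ?R = "\<lparr>carrier = UNIV, monoid.mult = (+), one = 0\<rparr> :: real monoid"
  have R: "group ?R"
    by (rule groupI) (auto intro: exI[of _ "- x" for x])
  have act: "right_action (free_group Y) (carrier L) ?act"
    unfolding right_action_def
  proof (intro ballI conjI)
    fix p assume "p \<in> carrier L"
    then show "p \<otimes>\<^bsub>L\<^esub> \<pi> \<one>\<^bsub>free_group Y\<^esub> = p"
      by (simp del: free_group_simps)
  next
    fix p g h assume "p \<in> carrier L" "g \<in> carrier (free_group Y)"
    then show "p \<otimes>\<^bsub>L\<^esub> \<pi> g \<in> carrier L"
      by simp
    assume "h \<in> carrier (free_group Y)"
    then show "p \<otimes>\<^bsub>L\<^esub> \<pi> (g \<otimes>\<^bsub>free_group Y\<^esub> h) = p \<otimes>\<^bsub>L\<^esub> \<pi> g \<otimes>\<^bsub>L\<^esub> \<pi> h"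
      using \<open>p \<in> carrier L\<close> \<open>g \<in> _\<close> by (simp del: free_group_simps add: \<pi>.H.m_assoc)
  qed
  define y where "y j = (if j then y1 else y2)" for j
  have "\<exists>c. cocycle (free_group Y) (carrier L) ?act ?R c \<and>
      (\<forall>x\<in>carrier L. \<forall>b\<in>Y. c x [(b, True)] = (if x = fst i \<and> b = y (snd i) then 1 else 0))" for i
    by (rule free_group_cocycle_exists[OF R act]) simp
  then have "\<exists>c. \<forall>i. cocycle (free_group Y) (carrier L) ?act ?R (c i) \<and>
      (\<forall>x\<in>carrier L. \<forall>b\<in>Y. c i x [(b, True)] = (if x = fst i \<and> b = y (snd i) then 1 else 0))"
    by (intro choice) blast
  then obtain c where c: "\<And>i. cocycle (free_group Y) (carrier L) ?act ?R (c i)"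
    "\<And>i x b. x \<in> carrier L \<Longrightarrow> b \<in> Y \<Longrightarrow> c i x [(b, True)] = (if x = fst i \<and> b =
      y (snd i) then 1 else 0)"
    by blast
  have yY: "y j \<in> Y" for j using y by (simp add: y_def)
  have "\<exists>k. k \<in> carrier G \<and> \<phi> k = [(y j, True)]" for j
  proof -
    have "[(y j, True)] \<in> \<phi> ` carrier G"
      unfolding \<phi>(2) using yY by (simp add: letter_in_free_group)
    then show ?thesis by auto
  qed
  then have "\<exists>k. \<forall>j. k j \<in> carrier G \<and> \<phi> (k j) = [(y j, True)]"
    by (intro choice) blast
  then obtain k where k: "\<And>j. k j \<in> carrier G" "\<And>j. \<phi> (k j) = [(y j, True)]"
    by blast
  show ?thesis
  proof (rule that[of k "\<lambda>i x g. c i x (\<phi> g)"])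
    show "additive_cocycle L (\<pi> \<circ> \<phi>) (\<lambda>x g. c i x (\<phi> g))" for i
      unfolding additive_cocycle_def
    proof (intro ballI)
      fix x g h assume "x \<in> carrier L" "g \<in> carrier G" "h \<in> carrier G"
      then show "c i x (\<phi> (g \<otimes> h)) = c i x (\<phi> g) + c i (x \<otimes>\<^bsub>L\<^esub> (\<pi> \<circ> \<phi>) g) (\<phi> h)"
        using cocycleD(2)[OF c(1), of x "\<phi> g" "\<phi> h" i] by (simp del: free_group_simps)
    qed
    show "c i x (\<phi> (k j)) = (if i = (x, j) then 1 else 0)" if "x \<in> carrier L" for i x j
      using c(2)[OF that yY] k(2) y(3) by (cases i) (auto simp: y_def split: if_splits)
  qed (rule k(1))
qed

text \<open>Gram--Schmidt by counting: the \<open>2 |L|\<close> coefficients of a combination of the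
  \<open>z i\<close> face \<open>|L|\<close> equations for zero divergence and \<open>m\<close> for
  orthogonality, so a nonzero solution exists as long as \<open>m < |L|\<close>.\<close>

lemma orthonormal_cocycles:
  fixes L :: "('l, 'n) monoid_scheme"
  assumes L: "group L" "finite (carrier L)" and \<pi>: "\<pi> \<in> hom G L"
    and S: "finite S" "S \<subseteq> carrier G" "generate G S = carrier G"
    and k: "\<And>j. k j \<in> carrier G" and z: "\<And>i. additive_cocycle L \<pi> (z i)"
    and zk: "\<And>i x j. x \<in> carrier L \<Longrightarrow> z i x (k j) = (if i = (x, j :: bool) then 1 else 0)"
  shows "m \<le> card (carrier L) \<Longrightarrow> \<exists>w :: nat \<Rightarrow> 'l \<Rightarrow> 'a \<Rightarrow> real. (\<forall>i<m. additive_cocycle L \<pi> (w i) \<and>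
    balanced S L \<pi> (w i)) \<and>
    (\<forall>i<m. \<forall>j<m. pairing L S (w i) (w j) = (if i = j then 1 else 0))"
proof (induction m)
  case 0
  then show ?case by simp
next
  case (Suc m)
  interpret L: group L by fact
  interpret \<pi>: group_hom G L \<pi>
    by (intro group_hom.intro group_hom_axioms.intro is_group L \<pi>)
  obtain w :: "nat \<Rightarrow> 'l \<Rightarrow> 'a \<Rightarrow> real" where w: "\<And>i. i < m \<Longrightarrow> additive_cocycle L \<pi> (w i)"
      "\<And>i. i < m \<Longrightarrow> balanced S L \<pi> (w i)"
    "\<And>i j. i < m \<Longrightarrow> j < m \<Longrightarrow> pairing L S (w i) (w j) = (if i = j then 1 else 0)"
    using Suc by auto
  let ?I = "carrier L \<times> (UNIV :: bool set)"
  define a :: "'l + nat \<Rightarrow> 'l \<times> bool \<Rightarrow> real" where "a j i = (case j of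
      Inl x \<Rightarrow> (\<Sum>s\<in>S. z i x s - z i (x \<otimes>\<^bsub>L\<^esub> inv\<^bsub>L\<^esub> \<pi> s) s)
    | Inr l \<Rightarrow> pairing L S (w l) (z i))" for j i
  have "\<exists>\<xi>. (\<exists>i\<in>?I. \<xi> i \<noteq> 0) \<and> (\<forall>j\<in>carrier L <+> {..<m}. (\<Sum>i\<in>?I. a j i * \<xi> i) = 0)"
  proof (rule homogeneous_system_nontrivial_solution)
    show "card (carrier L <+> {..<m}) < card ?I"
      using L(2) Suc.prems by (simp add: card_Plus card_cartesian_product)
  qed (use L(2) in auto)
  then obtain \<xi> where \<xi>: "\<exists>i\<in>?I. \<xi> i \<noteq> 0" "\<forall>j\<in>carrier L <+> {..<m}. (\<Sum>i\<in>?I. a j i * \<xi> i) = 0"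
    by blast
  define v where "v x g = (\<Sum>i\<in>?I. \<xi> i * z i x g)" for x g
  have v: "additive_cocycle L \<pi> v"
    unfolding v_def by (rule additive_cocycle_sum) (rule z)
  have bal: "balanced S L \<pi> v"
    unfolding balanced_def
  proof
    fix x assume x: "x \<in> carrier L"
    have "(\<Sum>s\<in>S. v x s - v (x \<otimes>\<^bsub>L\<^esub> inv\<^bsub>L\<^esub> \<pi> s) s) = (\<Sum>i\<in>?I. a (Inl x) i * \<xi> i)"
      unfolding v_def a_def sum.case sum_distrib_right sum_subtractf[symmetric] left_diff_distrib
      by (subst sum.swap) (simp add: mult.commute)
    then show "(\<Sum>s\<in>S. v x s - v (x \<otimes>\<^bsub>L\<^esub> inv\<^bsub>L\<^esub> \<pi> s) s) = 0"
      using bspec[OF \<xi>(2) InlI[OF x]] by simp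
  qed
  have orth: "pairing L S (w l) v = 0" if "l < m" for l
  proof -
    have "pairing L S (w l) v = (\<Sum>x\<in>carrier L. \<Sum>i\<in>?I. \<Sum>s\<in>S. w l x s * z i x s * \<xi> i)"
      unfolding v_def sum_distrib_left by (intro sum.cong refl, subst sum.swap) (simp add: ac_simps)
    also have "\<dots> = (\<Sum>i\<in>?I. a (Inr l) i * \<xi> i)"
      unfolding a_def sum.case sum_distrib_right by (rule sum.swap)
    finally show ?thesis
      using bspec[OF \<xi>(2) InrI[of l "{..<m}"]] that by simp
  qed
  define n where "n = pairing L S v v"
  \<comment> \<open>A cocycle that vanishes on the generating set \<open>S\<close> vanishes on all
    of \<open>G\<close>, in particular at the elements \<open>k j\<close>, where its values are the
    coefficients \<open>\<xi>\<close>.\<close>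
  have "n \<noteq> 0"
  proof
    assume "n = 0"
    then have 0: "v x s = 0" if "x \<in> carrier L" "s \<in> S" for x s
      using that L(2) S(1) unfolding n_def by (simp add: sum_nonneg_eq_0_iff sum_nonneg)
    have "\<forall>x\<in>carrier L. v x g = 0" if "g \<in> generate G S" for g
      using that
    proof (induction rule: generate.induct)
      case one
      then show ?case using additive_cocycle_one[OF L(1) \<pi> v] by blast
    next
      case (incl h)
      then show ?case using 0 by blast
    next
      case (inv h)
      then have h: "h \<in> carrier G" using S(2) by blast
      show ?case
      proof
        fix x assume x: "x \<in> carrier L"
        then have "v x (inv h \<otimes> h) = v x (inv h) + v (x \<otimes>\<^bsub>L\<^esub> \<pi> (inv h)) h"
          using additive_cocycleD[OF v x, of "inv h" h] h by simp
        then show "v x (inv h) = 0"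
          using 0[of "x \<otimes>\<^bsub>L\<^esub> \<pi> (inv h)" h] x h inv additive_cocycle_one[OF L(1) \<pi> v x] by simp
      qed
    next
      case (eng h1 h2)
      then have "h1 \<in> carrier G" "h2 \<in> carrier G" using S(3) by auto
      then show ?case using eng.IH additive_cocycleD[OF v] by simp
    qed
    then have "v x (k j) = 0" if "x \<in> carrier L" for x j
      using that k S(3) by simp
    moreover have "v x (k j) = \<xi> (x, j)" if "x \<in> carrier L" for x j
    proof -
      have "v x (k j) = (\<Sum>i\<in>?I. if i = (x, j) then \<xi> i else 0)"
        unfolding v_def using zk[OF that] by (intro sum.cong) auto
      then show ?thesis using that L(2) by (simp add: sum.delta)
    qed
    ultimately show False using \<xi>(1) by auto
  qed
  moreover have "n \<ge> 0" by (simp add: n_def sum_nonneg)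
  ultimately have n: "n > 0" by simp
  \<comment> \<open>a one-term sum, so that \<open>additive_cocycle_sum\<close> and \<open>balanced_sum\<close> apply\<close>
  define w' where "w' = w(m := \<lambda>x g. \<Sum>i\<in>{()}. (1 / sqrt n) * v x g)"
  have w'm: "w' m x g = v x g / sqrt n" for x g by (simp add: w'_def)
  have w'l: "w' l = w l" if "l < m" for l using that by (simp add: w'_def)
  have norm: "pairing L S (w' m) (w' m) = 1"
    using n by (simp add: w'm sum_divide_distrib[symmetric] n_def[symmetric])
  have o1: "pairing L S (w' l) (w' m) = 0" if "l < m" for l
    using orth[OF that] by (simp add: w'm w'l[OF that] sum_divide_distrib[symmetric])
  then have o2: "pairing L S (w' m) (w' l) = 0" if "l < m" for l
    using that by (simp add: mult.commute)
  show ?case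
  proof (intro exI[of _ w'] conjI allI impI)
    fix i assume i: "i < Suc m"
    show "additive_cocycle L \<pi> (w' i)"
      using i w(1)[of i] additive_cocycle_sum[of "{()}" L \<pi> "\<lambda>_. v" "\<lambda>_. 1 / sqrt n"] v
      by (auto simp: w'_def less_Suc_eq)
    show "balanced S L \<pi> (w' i)"
      using i w(2)[of i] balanced_sum[of "{()}" S L \<pi> "\<lambda>_. v" "\<lambda>_. 1 / sqrt n"] bal
      by (auto simp: w'_def less_Suc_eq)
    fix j assume j: "j < Suc m"
    consider "i < m" "j < m" | "i < m" "j = m" | "i = m" "j < m" | "i = m" "j = m"
      using i j by linarith
    then show "pairing L S (w' i) (w' j) = (if i = j then 1 else 0)"
      by cases (use w(3) w'l o1 o2 norm in auto)
  qed
qed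

text \<open>The reproducing vector, at a suitable point, of the space spanned by the orthonormal system.\<close>

lemma concentrated_cocycle:
  fixes L :: "('l, 'n) monoid_scheme"
  assumes L: "group L" "finite (carrier L)" and \<pi>: "\<pi> \<in> hom G L"
    and S: "finite S" "S \<subseteq> carrier G" "generate G S = carrier G"
    and k: "\<And>j. k j \<in> carrier G" and z: "\<And>i. additive_cocycle L \<pi> (z i)"
    and zk: "\<And>i x j. x \<in> carrier L \<Longrightarrow> z i x (k j) = (if i = (x, j :: bool) then 1 else 0)"
  obtains v x where "additive_cocycle L \<pi> v" "balanced S L \<pi> v" "x \<in> carrier L"
    "(\<Sum>x\<in>carrier L. \<Sum>s\<in>S. (v x s)\<^sup>2) \<le> 1" "(\<Sum>s\<in>S. \<bar>v x s\<bar>) \<ge> 1 / real (card S)"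
proof -
  interpret L: group L by fact
  let ?N = "card (carrier L)"
  have N: "?N > 0"
    using L(2) L.one_closed card_gt_0_iff by blast
  obtain w :: "nat \<Rightarrow> 'l \<Rightarrow> 'a \<Rightarrow> real" where w: "\<And>i. i < ?N \<Longrightarrow> additive_cocycle L \<pi> (w i)"
      "\<And>i. i < ?N \<Longrightarrow> balanced S L \<pi> (w i)"
    "\<And>i j. i < ?N \<Longrightarrow> j < ?N \<Longrightarrow> pairing L S (w i) (w j) = (if i = j then 1 else 0)"
    using orthonormal_cocycles[OF L \<pi> S k z zk order_refl] by auto
  \<comment> \<open>The diagonal of the projection onto the span of the \<open>w i\<close>. Its
    trace is \<open>|L|\<close>, so its sum over some fibre \<open>{x} \<times> S\<close> reaches
    \<open>1\<close>.\<close>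
  define t where "t x s = (\<Sum>i<?N. (w i x s)\<^sup>2)" for x s
  have "(\<Sum>x\<in>carrier L. \<Sum>s\<in>S. t x s) = (\<Sum>x\<in>carrier L. \<Sum>i<?N. \<Sum>s\<in>S. (w i x s)\<^sup>2)"
    unfolding t_def by (intro sum.cong refl) (rule sum.swap)
  also have "\<dots> = (\<Sum>i<?N. \<Sum>x\<in>carrier L. \<Sum>s\<in>S. (w i x s)\<^sup>2)"
    by (rule sum.swap)
  also have "\<dots> = ?N"
    using w(3) by (simp add: power2_eq_square)
  finally have total: "(\<Sum>x\<in>carrier L. \<Sum>s\<in>S. t x s) = ?N" .
  have "\<exists>x\<in>carrier L. (\<Sum>s\<in>S. t x s) \<ge> 1"
  proof (rule ccontr)
    assume "\<not> ?thesis"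
    then have "(\<Sum>x\<in>carrier L. \<Sum>s\<in>S. t x s) < (\<Sum>x\<in>carrier L. 1)"
      using L(2) L.one_closed by (intro sum_strict_mono) (auto simp: not_le)
    then show False using total by simp
  qed
  then obtain x where x: "x \<in> carrier L" "(\<Sum>s\<in>S. t x s) \<ge> 1" by blast
  have "S \<noteq> {}" using x(2) by auto
  then have cS: "card S > 0" using S(1) by (simp add: card_gt_0_iff)
  have "\<exists>s\<in>S. t x s \<ge> 1 / card S"
  proof (rule ccontr)
    assume "\<not> ?thesis"
    then have "(\<Sum>s\<in>S. t x s) < (\<Sum>s\<in>S. 1 / card S)"
      using S(1) \<open>S \<noteq> {}\<close> by (intro sum_strict_mono) (auto simp: not_le)
    then show False using x(2) cS by simp
  qed
  then obtain s where s: "s \<in> S" "t x s \<ge> 1 / card S" by blast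
  \<comment> \<open>On the span, pairing with this \<open>v\<close> evaluates at
    \<open>(x, s)\<close>, so its squared norm equals its own value \<open>t x s\<close> there. That
    value is at least \<open>1 / card S\<close> by averaging, and at most \<open>1\<close> because
    its square is one term of the squared norm.\<close>
  define v where "v y g = (\<Sum>i<?N. w i x s * w i y g)" for y g
  have vt: "v x s = t x s" by (simp add: v_def t_def power2_eq_square)
  have "(\<Sum>y\<in>carrier L. \<Sum>r\<in>S. (v y r)\<^sup>2) =
      (\<Sum>y\<in>carrier L. \<Sum>r\<in>S. \<Sum>i<?N. \<Sum>j<?N. w i x s * w j x s * (w i y r * w j y r))"
    unfolding v_def power2_eq_square sum_product by (intro sum.cong refl) (simp add: ac_simps)
  also have "\<dots> = (\<Sum>y\<in>carrier L. \<Sum>i<?N. \<Sum>r\<in>S. \<Sum>j<?N. w i x s * w j x s * (w i y r * w j y r))"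
    by (intro sum.cong refl) (rule sum.swap)
  also have "\<dots> = (\<Sum>y\<in>carrier L. \<Sum>i<?N. \<Sum>j<?N. \<Sum>r\<in>S. w i x s * w j x s * (w i y r * w j y r))"
    by (intro sum.cong refl) (rule sum.swap)
  also have "\<dots> = (\<Sum>i<?N. \<Sum>y\<in>carrier L. \<Sum>j<?N. \<Sum>r\<in>S. w i x s * w j x s * (w i y r * w j y r))"
    by (rule sum.swap)
  also have "\<dots> = (\<Sum>i<?N. \<Sum>j<?N. \<Sum>y\<in>carrier L. \<Sum>r\<in>S. w i x s * w j x s * (w i y r * w j y r))"
    by (intro sum.cong refl) (rule sum.swap)
  also have "\<dots> = (\<Sum>i<?N. \<Sum>j<?N. w i x s * w j x s * (if i = j then 1 else 0))"
    using w(3) by (simp add: sum_distrib_left[symmetric])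
  also have "\<dots> = t x s"
    by (simp add: t_def power2_eq_square if_distrib cong: if_cong)
  finally have norm: "(\<Sum>y\<in>carrier L. \<Sum>r\<in>S. (v y r)\<^sup>2) = t x s" .
  have "(t x s)\<^sup>2 \<le> (\<Sum>r\<in>S. (v x r)\<^sup>2)"
    using member_le_sum[of s S "\<lambda>r. (v x r)\<^sup>2"] s(1) S(1) vt by simp
  also have "\<dots> \<le> t x s"
    unfolding norm[symmetric]
    by (rule member_le_sum[of x "carrier L" "\<lambda>y. \<Sum>r\<in>S. (v y r)\<^sup>2"])
      (use x(1) L(2) in \<open>auto intro: sum_nonneg\<close>)
  finally have sq: "(t x s)\<^sup>2 \<le> t x s" .
  have "t x s \<le> 1"
  proof (rule ccontr)
    assume "\<not> t x s \<le> 1"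
    then have "t x s * 1 < t x s * t x s"
      by (intro mult_strict_left_mono) auto
    then show False using sq by (simp add: power2_eq_square)
  qed
  show ?thesis
  proof (rule that[of v x])
    show "additive_cocycle L \<pi> v"
      unfolding v_def by (rule additive_cocycle_sum) (use w in auto)
    show "balanced S L \<pi> v"
      unfolding v_def by (rule balanced_sum) (use w in auto)
    show "(\<Sum>x\<in>carrier L. \<Sum>s\<in>S. (v x s)\<^sup>2) \<le> 1"
      using norm \<open>t x s \<le> 1\<close> by simp
    have "\<bar>v x s\<bar> \<le> (\<Sum>s\<in>S. \<bar>v x s\<bar>)"
      by (rule member_le_sum[of s S "\<lambda>s. \<bar>v x s\<bar>"]) (use s S in auto)
    then show "(\<Sum>s\<in>S. \<bar>v x s\<bar>) \<ge> 1 / real (card S)"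
      using s(2) vt by simp
  qed (rule x(1))
qed

end

section \<open>Harmonic functions as limits of lifts from finite quotients\<close>

context group
begin

text \<open>Grouped as outgoing minus incoming increment, this is the divergence of the gradient and
  matches the expression in \<open>balanced\<close>.\<close>

abbreviation laplacian :: "'a set \<Rightarrow> ('a \<Rightarrow> real) \<Rightarrow> 'a \<Rightarrow> real" where
  "laplacian S u g \<equiv> \<Sum>s\<in>S. (u (g \<otimes> s) - u g) - (u g - u (g \<otimes> inv s))"

definition harmonic :: "'a set \<Rightarrow> ('a \<Rightarrow> real) \<Rightarrow> bool" where
  "harmonic S u \<longleftrightarrow> (\<forall>g\<in>carrier G. laplacian S u g = 0)"

text \<open>When the finite quotient is injective on \<open>D\<close>, the energy of a lifted
  function over \<open>D\<close> is part of the energy on \<open>L\<close>. The primitive based at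
  the concentration point \<open>x\<close> has its large gradient at the identity.\<close>

lemma harmonic_small_energy_on_finite_set:
  assumes frf: "fully_residually_free G"
    and S: "finite S" "S \<subseteq> carrier G" "generate G S = carrier G"
    and ab: "a \<in> carrier G" "b \<in> carrier G" "a \<otimes> b \<noteq> b \<otimes> a" and D: "finite D" "D \<subseteq> carrier G"
  obtains u where "u \<one> = 0" "harmonic S u" "\<And>g s. g \<in> carrier G \<Longrightarrow> s \<in> S \<Longrightarrow> \<bar>u (g \<otimes> s) - u g\<bar> \<le> 1"
    "(\<Sum>g\<in>D. \<Sum>s\<in>S. (u (g \<otimes> s) - u g)\<^sup>2) \<le> 1" "(\<Sum>s\<in>S. \<bar>u s\<bar>) \<ge> 1 / real (card S)"
proof -
  \<comment> \<open>The elements that the quotient must not kill in order to be injective on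
    \<open>D\<close>.\<close>
  define E where "E = (\<lambda>(g, h). g \<otimes> inv h) ` {(g, h) \<in> D \<times> D. g \<noteq> h}"
  have E: "finite E" "E \<subseteq> carrier G - {\<one>}"
  proof -
    have "finite {(g, h) \<in> D \<times> D. g \<noteq> h}"
      using D(1) by (auto intro: finite_subset[of _ "D \<times> D"])
    then show "finite E" by (simp add: E_def)
    show "E \<subseteq> carrier G - {\<one>}"
      using D(2) inv_solve_right'[of \<one>] by (force simp: E_def subset_iff)
  qed
  obtain Y :: "((nat \<times> bool) list set \<times> nat) set" and \<phi> y1 y2
    where \<phi>: "\<phi> \<in> hom G (free_group Y)" "\<phi> ` carrier G = carrier (free_group Y)"
      "\<And>g. g \<in> E \<Longrightarrow> \<phi> g \<noteq> []" and y: "y1 \<in> Y" "y2 \<in> Y" "y1 \<noteq> y2"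
    by (rule frf_free_quotient[OF frf E ab]) blast
  have "\<phi> ` E \<subseteq> carrier (free_group Y)"
    using E(2) \<phi>(2) by blast
  then obtain L :: "((((nat \<times> bool) list set \<times> nat) \<times> bool) list \<Rightarrow>
      (((nat \<times> bool) list set \<times> nat) \<times> bool) list) monoid" and \<pi>
    where L: "group L" "finite (carrier L)" and \<pi>: "\<pi> \<in> hom (free_group Y) L"
      "\<forall>w\<in>\<phi> ` E. w \<noteq> [] \<longrightarrow> \<pi> w \<noteq> \<one>\<^bsub>L\<^esub>"
    using free_group_residually_finite[of "\<phi> ` E" Y] E(1) by (metis finite_imageI)
  interpret L: group L by fact
  have hom: "\<pi> \<circ> \<phi> \<in> hom G L"
    using Group.hom_compose[OF \<phi>(1) \<pi>(1)] .
  interpret \<pi>\<phi>: group_hom G L "\<pi> \<circ> \<phi>"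
    by (intro group_hom.intro group_hom_axioms.intro is_group L hom)
  obtain k :: "bool \<Rightarrow> 'a" and z where z: "\<And>j. k j \<in> carrier G"
    "\<And>i. additive_cocycle L (\<pi> \<circ> \<phi>) (z i)"
    "\<And>i x j. x \<in> carrier L \<Longrightarrow> z i x (k j) = (if i = (x, j) then 1 else 0)"
    using cocycle_basis[OF \<phi>(1,2) y L(1) \<pi>(1)] by blast
  obtain v x where v: "additive_cocycle L (\<pi> \<circ> \<phi>) v" "balanced S L (\<pi> \<circ> \<phi>) v" "x \<in> carrier L"
    "(\<Sum>x\<in>carrier L. \<Sum>s\<in>S. (v x s)\<^sup>2) \<le> 1" "(\<Sum>s\<in>S. \<bar>v x s\<bar>) \<ge> 1 / real (card S)"
    using concentrated_cocycle[OF L hom S z] by blast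
  have v1: "v y \<one> = 0" if "y \<in> carrier L" for y
    using additive_cocycle_one[OF L(1) hom v(1) that] .
  let ?p = "\<lambda>g. x \<otimes>\<^bsub>L\<^esub> (\<pi> \<circ> \<phi>) g"
  have p: "?p g \<in> carrier L" if "g \<in> carrier G" for g
    using v(3) \<pi>\<phi>.hom_closed[OF that] by simp
  have grad: "v x (g \<otimes> h) - v x g = v (?p g) h" if "g \<in> carrier G" "h \<in> carrier G" for g h
    using additive_cocycleD[OF v(1,3) that] by simp
  have inj: "inj_on ?p D"
  proof
    fix g h assume g: "g \<in> D" "h \<in> D" and eq: "?p g = ?p h"
    show "g = h"
    proof (rule ccontr)
      assume "g \<noteq> h"
      then have e: "g \<otimes> inv h \<in> E" using g by (auto simp: E_def)
      have gh: "g \<in> carrier G" "h \<in> carrier G" using g D by auto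
      have "(\<pi> \<circ> \<phi>) g = (\<pi> \<circ> \<phi>) h"
        using eq v(3) \<pi>\<phi>.hom_closed[OF gh(1)] \<pi>\<phi>.hom_closed[OF gh(2)] by (simp only: L.l_cancel)
      then have "(\<pi> \<circ> \<phi>) (g \<otimes> inv h) = \<one>\<^bsub>L\<^esub>"
        using gh \<pi>\<phi>.hom_closed[OF gh(2)] \<pi>\<phi>.hom_mult[of g "inv h"] \<pi>\<phi>.hom_inv[of h]
        by (simp del: o_apply)
      then show False
        using \<pi>(2) \<phi>(3)[OF e] e by auto
    qed
  qed
  have bound: "(\<Sum>y\<in>A. \<Sum>s\<in>S. (v y s)\<^sup>2) \<le> 1" if "A \<subseteq> carrier L" for A
    using sum_mono2[OF L(2) that, of "\<lambda>y. \<Sum>s\<in>S. (v y s)\<^sup>2"] v(4) by (simp add: sum_nonneg)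
  show ?thesis
  proof (rule that[of "v x"])
    show "v x \<one> = 0" using v1 v(3) .
    show "harmonic S (v x)"
      unfolding harmonic_def
    proof
      fix g assume g: "g \<in> carrier G"
      have "v x (g \<otimes> s) - v x g - (v x g - v x (g \<otimes> inv s)) =
          v (?p g) s - v (?p g \<otimes>\<^bsub>L\<^esub> inv\<^bsub>L\<^esub> (\<pi> \<circ> \<phi>) s) s" if "s \<in> S" for s
      proof -
        have s: "s \<in> carrier G" using that S by blast
        have "v (?p g) (inv s \<otimes> s) = v (?p g) (inv s) + v (?p g \<otimes>\<^bsub>L\<^esub> (\<pi> \<circ> \<phi>) (inv s)) s"
          using additive_cocycleD[OF v(1) p[OF g], of "inv s" s] s by simp
        then have "v (?p g) (inv s) = - v (?p g \<otimes>\<^bsub>L\<^esub> inv\<^bsub>L\<^esub> (\<pi> \<circ> \<phi>) s) s"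
          using s v1[OF p[OF g]] \<pi>\<phi>.hom_inv[OF s] by (simp del: o_apply)
        then show ?thesis
          using grad[OF g s] grad[OF g inv_closed[OF s]] by simp
      qed
      then show "laplacian S (v x) g = 0"
        using v(2) p[OF g] by (simp del: o_apply add: balanced_def)
    qed
    show "\<bar>v x (g \<otimes> s) - v x g\<bar> \<le> 1" if g: "g \<in> carrier G" and s: "s \<in> S" for g s
    proof -
      have "(v (?p g) s)\<^sup>2 \<le> (\<Sum>s\<in>S. (v (?p g) s)\<^sup>2)"
        by (rule member_le_sum[of s S "\<lambda>s. (v (?p g) s)\<^sup>2"]) (use s S in auto)
      also have "\<dots> \<le> 1"
        using bound[of "{?p g}"] p[OF g] by simp
      finally show ?thesis
        using grad[OF g, of s] s S(2) abs_square_le_1[of "v (?p g) s"] by auto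
    qed
    have "(\<Sum>g\<in>D. \<Sum>s\<in>S. (v x (g \<otimes> s) - v x g)\<^sup>2) = (\<Sum>g\<in>D. \<Sum>s\<in>S. (v (?p g) s)\<^sup>2)"
      by (intro sum.cong refl arg_cong[where f = "\<lambda>t. t\<^sup>2"] grad) (use D S in auto)
    also have "\<dots> = (\<Sum>y\<in>?p ` D. \<Sum>s\<in>S. (v y s)\<^sup>2)"
      using sum.reindex[OF inj, of "\<lambda>y. \<Sum>s\<in>S. (v y s)\<^sup>2"] by simp
    also have "\<dots> \<le> 1"
      by (rule bound) (use p D in auto)
    finally show "(\<Sum>g\<in>D. \<Sum>s\<in>S. (v x (g \<otimes> s) - v x g)\<^sup>2) \<le> 1" .
  qed (rule v(5))
qed

text \<open>The bound, essentially the word length of \<open>g\<close>, does not depend on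
  \<open>u\<close>; it supplies the box for the compactness argument.\<close>

lemma word_length_bound:
  assumes "S \<subseteq> carrier G" "g \<in> generate G S"
  shows "\<exists>c\<ge>0. \<forall>u :: 'a \<Rightarrow> real. u \<one> = 0 \<longrightarrow>
    (\<forall>g\<in>carrier G. \<forall>s\<in>S. \<bar>u (g \<otimes> s) - u g\<bar> \<le> 1) \<longrightarrow> \<bar>u g\<bar> \<le> c"
proof -
  \<comment> \<open>For products the increment must be controlled from every starting point, not
    only from \<open>\<one>\<close>.\<close>
  have "\<exists>c\<ge>0. \<forall>u :: 'a \<Rightarrow> real. (\<forall>g\<in>carrier G. \<forall>s\<in>S. \<bar>u (g \<otimes> s) - u g\<bar> \<le> 1) \<longrightarrow>
      (\<forall>x\<in>carrier G. \<bar>u (x \<otimes> g) - u x\<bar> \<le> c)"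
    using assms(2)
  proof (induction rule: generate.induct)
    case one
    then show ?case by (intro exI[of _ 0]) auto
  next
    case (incl h)
    then show ?case by (intro exI[of _ 1]) auto
  next
    case (inv h)
    then have h: "h \<in> carrier G" using assms(1) by blast
    have "\<bar>u (x \<otimes> inv h) - u x\<bar> \<le> 1"
      if "\<forall>g\<in>carrier G. \<forall>s\<in>S. \<bar>u (g \<otimes> s) - u g\<bar> \<le> 1" "x \<in> carrier G" for u :: "'a \<Rightarrow> real" and x
    proof -
      have "\<bar>u (x \<otimes> inv h \<otimes> h) - u (x \<otimes> inv h)\<bar> \<le> 1"
        using that h inv by blast
      then show ?thesis
        using that(2) h by (simp add: m_assoc abs_minus_commute)
    qed
    then show ?case by (intro exI[of _ 1]) auto
  next
    case (eng h1 h2)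
    then have h: "h1 \<in> carrier G" "h2 \<in> carrier G"
      using generate_in_carrier[OF assms(1)] by auto
    obtain c1 c2 where c: "c1 \<ge> 0" "c2 \<ge> 0"
      "\<forall>u :: 'a \<Rightarrow> real. (\<forall>g\<in>carrier G. \<forall>s\<in>S. \<bar>u (g \<otimes> s) - u g\<bar> \<le>
        1) \<longrightarrow> (\<forall>x\<in>carrier G. \<bar>u (x \<otimes> h1) - u x\<bar> \<le> c1)"
      "\<forall>u :: 'a \<Rightarrow> real. (\<forall>g\<in>carrier G. \<forall>s\<in>S. \<bar>u (g \<otimes> s) - u g\<bar> \<le>
        1) \<longrightarrow> (\<forall>x\<in>carrier G. \<bar>u (x \<otimes> h2) - u x\<bar> \<le> c2)"
      using eng.IH by blast
    have "\<bar>u (x \<otimes> (h1 \<otimes> h2)) - u x\<bar> \<le> c1 + c2"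
      if "\<forall>g\<in>carrier G. \<forall>s\<in>S. \<bar>u (g \<otimes> s) - u g\<bar> \<le> 1" "x \<in> carrier G" for u :: "'a \<Rightarrow> real" and x
    proof -
      have "\<bar>u (x \<otimes> h1) - u x\<bar> \<le> c1" "\<bar>u (x \<otimes> h1 \<otimes> h2) - u (x \<otimes> h1)\<bar> \<le> c2"
        using c(3,4) that h by blast+
      then show ?thesis
        using m_assoc[OF that(2) h] by simp
    qed
    then show ?case using c(1,2) by (intro exI[of _ "c1 + c2"]) auto
  qed
  then obtain c where "c \<ge> 0" and c: "\<And>u :: 'a \<Rightarrow> real. \<forall>g\<in>carrier G. \<forall>s\<in>S. \<bar>u (g \<otimes> s) - u g\<bar> \<le> 1 \<Longrightarrow>
      \<bar>u (\<one> \<otimes> g) - u \<one>\<bar> \<le> c"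
    by blast
  moreover have "\<one> \<otimes> g = g"
    using generate_in_carrier[OF assms] by simp
  ultimately show ?thesis
    by (intro exI[of _ c]) (metis diff_zero)
qed

text \<open>Functions with increments bounded by \<open>1\<close> lie in a compact product of
  intervals, where each constraint is closed because it involves finitely many coordinates. Finite
  intersections are nonempty by taking the union of the sets \<open>D\<close>. The lower bound on
  \<open>\<Sum>s\<in>S. \<bar>u s\<bar>\<close> survives and rules out a constant limit.\<close>

lemma harmonic_of_finite_energy_exists:
  assumes frf: "fully_residually_free G"
    and S: "finite S" "S \<subseteq> carrier G" "generate G S = carrier G"
    and ab: "a \<in> carrier G" "b \<in> carrier G" "a \<otimes> b \<noteq> b \<otimes> a"
  obtains u where "harmonic S u" "(\<lambda>(g, s). (u (g \<otimes> s) - u g)\<^sup>2) summable_on carrier G \<times> S"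
    "\<exists>s\<in>S. u s \<noteq> u \<one>"
proof -
  have "\<exists>c\<ge>0. \<forall>u :: 'a \<Rightarrow> real. u \<one> = 0 \<longrightarrow>
      (\<forall>g\<in>carrier G. \<forall>s\<in>S. \<bar>u (g \<otimes> s) - u g\<bar> \<le> 1) \<longrightarrow> \<bar>u g\<bar> \<le> c" if "g \<in> carrier G" for g
    using word_length_bound[OF S(2)] that S(3) by simp
  then obtain c where c: "\<And>g. g \<in> carrier G \<Longrightarrow> c g \<ge> 0"
    "\<And>g u. g \<in> carrier G \<Longrightarrow> u \<one> = 0 \<Longrightarrow> (\<forall>g\<in>carrier G. \<forall>s\<in>S. \<bar>u (g \<otimes> s) - u g\<bar> \<le> (1::real)) \<Longrightarrow> \<bar>u g\<bar> \<le>
      c g"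
    by metis
  \<comment> \<open>Coordinates outside the group are pinned to \<open>0\<close>, since the product
    topology is that of functions on the whole type.\<close>
  define C where "C = PiE UNIV (\<lambda>g. if g \<in> carrier G then {- c g..c g} else {0 :: real})"
  have "compactin (product_topology (\<lambda>_. euclidean) UNIV) C"
    unfolding C_def by (subst compactin_PiE) auto
  then have C: "compact C"
    by (simp add: euclidean_product_topology)
  define F where "F D = {u :: 'a \<Rightarrow> real. u \<one> = 0 \<and> harmonic S u \<and>
    (\<Sum>g\<in>D. \<Sum>s\<in>S. (u (g \<otimes> s) - u g)\<^sup>2) \<le> 1 \<and> (\<Sum>s\<in>S. \<bar>u s\<bar>) \<ge> 1 / real (card S)}" for D
  have closed: "closed (F D)" for D
  proof -
    have 1: "closed {u :: 'a \<Rightarrow> real. u \<one> = 0}"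
      by (intro closed_Collect_eq continuous_intros continuous_on_product_coordinates)
    have "closed {u :: 'a \<Rightarrow> real. laplacian S u g = 0}" for g
      by (intro closed_Collect_eq continuous_intros continuous_on_product_coordinates)
    then have "closed (\<Inter>g\<in>carrier G. {u :: 'a \<Rightarrow> real. laplacian S u g = 0})"
      by blast
    also have "(\<Inter>g\<in>carrier G. {u :: 'a \<Rightarrow> real. laplacian S u g = 0}) = {u. harmonic S u}"
      by (auto simp: harmonic_def)
    finally have 2: "closed {u :: 'a \<Rightarrow> real. harmonic S u}" .
    have 3: "closed {u :: 'a \<Rightarrow> real. (\<Sum>g\<in>D. \<Sum>s\<in>S. (u (g \<otimes> s) - u g)\<^sup>2) \<le> 1}"
      by (intro closed_Collect_le continuous_intros continuous_on_product_coordinates)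
    have 4: "closed {u :: 'a \<Rightarrow> real. (\<Sum>s\<in>S. \<bar>u s\<bar>) \<ge> 1 / real (card S)}"
      by (intro closed_Collect_le continuous_intros continuous_on_product_coordinates)
    show ?thesis
      unfolding F_def using closed_Int[OF 1 closed_Int[OF 2 closed_Int[OF 3 4]]]
      by (simp add: Collect_conj_eq)
  qed
  have nonempty: "C \<inter> F D \<noteq> {}" if D: "finite D" "D \<subseteq> carrier G" for D
  proof -
    obtain u where u: "u \<one> = 0" "harmonic S u" "\<And>g s. g \<in> carrier G \<Longrightarrow> s \<in> S \<Longrightarrow> \<bar>u (g \<otimes> s) - u g\<bar> \<le> 1"
      "(\<Sum>g\<in>D. \<Sum>s\<in>S. (u (g \<otimes> s) - u g)\<^sup>2) \<le> 1" "(\<Sum>s\<in>S. \<bar>u s\<bar>) \<ge> 1 / real (card S)"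
      using harmonic_small_energy_on_finite_set[OF frf S ab D] by blast
    let ?u = "\<lambda>g. if g \<in> carrier G then u g else 0"
    have "(\<Sum>g\<in>D. \<Sum>s\<in>S. (?u (g \<otimes> s) - ?u g)\<^sup>2) = (\<Sum>g\<in>D. \<Sum>s\<in>S. (u (g \<otimes> s) - u g)\<^sup>2)"
      using D S by (intro sum.cong refl) auto
    moreover have "(\<Sum>s\<in>S. \<bar>?u s\<bar>) = (\<Sum>s\<in>S. \<bar>u s\<bar>)"
      using S by (intro sum.cong refl) auto
    moreover have "harmonic S ?u"
      unfolding harmonic_def
    proof
      fix g assume g: "g \<in> carrier G"
      have "laplacian S ?u g =
          laplacian S u g"
        using g S by (intro sum.cong refl) auto
      then show "laplacian S ?u g = 0"
        using u(2) g by (simp add: harmonic_def)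
    qed
    ultimately have "?u \<in> F D"
      using u by (simp add: F_def)
    moreover have "\<bar>u g\<bar> \<le> c g" if "g \<in> carrier G" for g
      using c(2)[of g u, OF that u(1)] u(3) by blast
    then have "?u \<in> C"
      by (auto simp: C_def abs_le_iff minus_le_iff)
    ultimately show ?thesis by blast
  qed
  have "C \<inter> (\<Inter>D\<in>{D. finite D \<and> D \<subseteq> carrier G}. F D) \<noteq> {}"
  proof (rule compact_imp_fip_image[OF C closed])
    fix I assume I: "finite I" "I \<subseteq> {D. finite D \<and> D \<subseteq> carrier G}"
    then have "finite (\<Union>I)" "\<Union>I \<subseteq> carrier G" by auto
    then obtain u where u: "u \<in> C" "u \<in> F (\<Union>I)"
      using nonempty[of "\<Union>I"] by blast
    have "u \<in> F D" if "D \<in> I" for D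
    proof -
      have "(\<Sum>g\<in>D. \<Sum>s\<in>S. (u (g \<otimes> s) - u g)\<^sup>2) \<le> (\<Sum>g\<in>\<Union>I. \<Sum>s\<in>S. (u (g \<otimes> s) - u g)\<^sup>2)"
        using \<open>finite (\<Union>I)\<close> that by (intro sum_mono2) (auto intro: sum_nonneg)
      then show ?thesis using u(2) by (simp add: F_def)
    qed
    then show "C \<inter> (\<Inter>D\<in>I. F D) \<noteq> {}" using u(1) by blast
  qed
  then obtain u where u: "\<And>D. finite D \<Longrightarrow> D \<subseteq> carrier G \<Longrightarrow> u \<in> F D"
    by blast
  have u0: "u \<one> = 0" "harmonic S u" "(\<Sum>s\<in>S. \<bar>u s\<bar>) \<ge> 1 / real (card S)"
    using u[of "{}"] by (simp_all add: F_def)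
  have "(\<lambda>(g, s). (u (g \<otimes> s) - u g)\<^sup>2) summable_on carrier G \<times> S"
  proof (rule nonneg_bdd_above_summable_on)
    show "bdd_above (sum (\<lambda>(g, s). (u (g \<otimes> s) - u g)\<^sup>2) ` {F. F \<subseteq> carrier G \<times> S \<and> finite F})"
    proof (rule bdd_aboveI2)
      fix A assume A: "A \<in> {F. F \<subseteq> carrier G \<times> S \<and> finite F}"
      then have D: "finite (fst ` A)" "fst ` A \<subseteq> carrier G" by auto
      have "(\<Sum>(g, s)\<in>A. (u (g \<otimes> s) - u g)\<^sup>2) \<le> (\<Sum>(g, s)\<in>fst ` A \<times> S. (u (g \<otimes> s) - u g)\<^sup>2)"
        using A D S(1) by (intro sum_mono2) (force simp: case_prod_beta)+
      also have "\<dots> = (\<Sum>g\<in>fst ` A. \<Sum>s\<in>S. (u (g \<otimes> s) - u g)\<^sup>2)"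
        by (rule sum.cartesian_product[symmetric])
      also have "\<dots> \<le> 1"
        using u[OF D] by (simp add: F_def)
      finally show "(\<Sum>(g, s)\<in>A. (u (g \<otimes> s) - u g)\<^sup>2) \<le> 1" .
    qed
  qed auto
  moreover have "\<exists>s\<in>S. u s \<noteq> u \<one>"
  proof (rule ccontr)
    assume "\<not> ?thesis"
    then have *: "\<And>s. s \<in> S \<Longrightarrow> u s = 0" using u0(1) by auto
    have "S \<noteq> {}"
    proof
      assume "S = {}"
      then have "carrier G = {\<one>}"
        using S(3) by (simp add: generate_empty)
      then have "a = \<one>" "b = \<one>"
        using ab(1,2) by blast+
      then show False using ab(3) by simp
    qed
    then have "1 / real (card S) > 0" using S(1) by (simp add: card_gt_0_iff)
    then show False using u0(3) * by simp
  qed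
  ultimately show ?thesis using that u0(2) by blast
qed

end

section \<open>Square-summable families\<close>

lemma summable_on_diff_real:
  fixes f g :: "'a \<Rightarrow> real"
  assumes "f summable_on A" "g summable_on A"
  shows "(\<lambda>x. f x - g x) summable_on A"
  using summable_on_add[OF assms(1), of "\<lambda>x. - g x"] assms(2) by (simp add: summable_on_uminus)

lemma infsum_diff_real:
  fixes f g :: "'a \<Rightarrow> real"
  assumes "f summable_on A" "g summable_on A"
  shows "(\<Sum>\<^sub>\<infinity>x\<in>A. f x - g x) = infsum f A - infsum g A"
  using infsum_add[OF assms(1), of "\<lambda>x. - g x"] assms(2)
    by (simp add: summable_on_uminus infsum_uminus)

lemma summable_on_bounded_mult:
  fixes f g :: "'a \<Rightarrow> real"
  assumes "g summable_on A" "\<And>x. x \<in> A \<Longrightarrow> \<bar>f x\<bar> \<le> c * g x"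
  shows "f summable_on A"
proof -
  have "(\<lambda>x. c * g x) summable_on A"
    using assms(1) by (rule summable_on_cmult_right)
  then have "(\<lambda>x. norm (f x)) summable_on A"
    by (rule summable_on_comparison_test) (use assms(2) in auto)
  then show ?thesis by (rule abs_summable_summable)
qed

lemma power2_diff_le: "((p::real) - q)\<^sup>2 \<le> 2 * p\<^sup>2 + 2 * q\<^sup>2"
  using zero_le_power2[of "p + q"] by (simp add: power2_sum power2_diff)

section \<open>A spectral gap\<close>

context group
begin

lemma bij_betw_right_mult: "a \<in> carrier G \<Longrightarrow> bij_betw (\<lambda>x. x \<otimes> a) (carrier G) (carrier G)"
  by (rule bij_betw_byWitness[where f' = "\<lambda>x. x \<otimes> inv a"]) (auto simp: m_assoc)

abbreviation sqnorm :: "('a \<Rightarrow> real) \<Rightarrow> real" where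
  "sqnorm f \<equiv> \<Sum>\<^sub>\<infinity>x\<in>carrier G. (f x)\<^sup>2"

abbreviation energy :: "('a \<Rightarrow> real) \<Rightarrow> 'a \<Rightarrow> real" where
  "energy f a \<equiv> \<Sum>\<^sub>\<infinity>x\<in>carrier G. (f (x \<otimes> a) - f x)\<^sup>2"

text \<open>Summation by parts moves the difference from \<open>\<sigma>\<close> to
  \<open>f\<^sup>2\<close>, and a difference of squares factors. The weights leave
  \<open>1 / 2\<close> in front of \<open>sqnorm f\<close>: two generators together then cost one
  copy of it, while the divergence supplies two.\<close>

lemma flow_estimate:
  fixes f \<sigma> :: "'a \<Rightarrow> real"
  assumes a: "a \<in> carrier G" and f: "(\<lambda>x. (f x)\<^sup>2) summable_on carrier G" and \<sigma>: "\<And>x. \<bar>\<sigma> x\<bar> \<le> 1"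
  shows "(\<lambda>x. (f x)\<^sup>2 * (\<sigma> x - \<sigma> (x \<otimes> inv a))) summable_on carrier G" (is ?A)
    and "(\<Sum>\<^sub>\<infinity>x\<in>carrier G. (f x)\<^sup>2 * (\<sigma> x - \<sigma> (x \<otimes> inv a))) \<le>
      2 * energy f a + 1 / 2 * sqnorm f" (is ?B)
proof -
  have fa: "(\<lambda>x. (f (x \<otimes> a))\<^sup>2) summable_on carrier G"
    using summable_on_reindex_bij_betw[OF bij_betw_right_mult[OF a], of "\<lambda>x. (f x)\<^sup>2"] f by simp
  have fa_sum: "(\<Sum>\<^sub>\<infinity>x\<in>carrier G. (f (x \<otimes> a))\<^sup>2) = sqnorm f"
    by (rule infsum_reindex_bij_betw[OF bij_betw_right_mult[OF a], of "\<lambda>x. (f x)\<^sup>2"])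
  have b: "\<bar>(f y)\<^sup>2 * \<sigma> x\<bar> \<le> 1 * (f y)\<^sup>2" for x y
    using mult_left_mono[OF \<sigma>[of x], of "(f y)\<^sup>2"] by (simp add: abs_mult)
  have s1: "(\<lambda>x. (f x)\<^sup>2 * \<sigma> x) summable_on carrier G"
    by (rule summable_on_bounded_mult[OF f]) (rule b)
  have s2: "(\<lambda>x. (f x)\<^sup>2 * \<sigma> (x \<otimes> inv a)) summable_on carrier G"
    by (rule summable_on_bounded_mult[OF f]) (rule b)
  have s3: "(\<lambda>x. (f (x \<otimes> a))\<^sup>2 * \<sigma> x) summable_on carrier G"
    by (rule summable_on_bounded_mult[OF fa]) (rule b)
  show ?A
    using summable_on_diff_real[OF s1 s2] by (simp add: right_diff_distrib)
  have d: "(\<lambda>x. (f (x \<otimes> a) - f x)\<^sup>2) summable_on carrier G"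
  proof (rule summable_on_bounded_mult[OF summable_on_add[OF fa f]])
    fix x show "\<bar>(f (x \<otimes> a) - f x)\<^sup>2\<bar> \<le> 2 * ((f (x \<otimes> a))\<^sup>2 + (f x)\<^sup>2)"
      using power2_diff_le[of "f (x \<otimes> a)" "f x"] by simp
  qed
  have "(\<Sum>\<^sub>\<infinity>x\<in>carrier G. (f x)\<^sup>2 * \<sigma> (x \<otimes> inv a)) =
      (\<Sum>\<^sub>\<infinity>x\<in>carrier G. (f (x \<otimes> a))\<^sup>2 * \<sigma> (x \<otimes> a \<otimes> inv a))"
    by (rule infsum_reindex_bij_betw[OF bij_betw_right_mult[OF a], symmetric])
  also have "\<dots> = (\<Sum>\<^sub>\<infinity>x\<in>carrier G. (f (x \<otimes> a))\<^sup>2 * \<sigma> x)"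
    using a by (intro infsum_cong) (simp add: m_assoc)
  finally have "(\<Sum>\<^sub>\<infinity>x\<in>carrier G. (f x)\<^sup>2 * (\<sigma> x - \<sigma> (x \<otimes> inv a))) =
      (\<Sum>\<^sub>\<infinity>x\<in>carrier G. (f x)\<^sup>2 * \<sigma> x - (f (x \<otimes> a))\<^sup>2 * \<sigma> x)"
    using infsum_diff_real[OF s1 s2] infsum_diff_real[OF s1 s3] by (simp add: right_diff_distrib)
  also have "\<dots> \<le> (\<Sum>\<^sub>\<infinity>x\<in>carrier G. 2 * (f (x \<otimes> a) - f x)\<^sup>2 + 1 / 4 * ((f x)\<^sup>2 + (f (x \<otimes> a))\<^sup>2))"
  proof (rule infsum_mono)
    show "(\<lambda>x. (f x)\<^sup>2 * \<sigma> x - (f (x \<otimes> a))\<^sup>2 * \<sigma> x) summable_on carrier G"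
      by (rule summable_on_diff_real[OF s1 s3])
    show "(\<lambda>x. 2 * (f (x \<otimes> a) - f x)\<^sup>2 + 1 / 4 * ((f x)\<^sup>2 + (f (x \<otimes> a))\<^sup>2)) summable_on carrier G"
      by (intro summable_on_add summable_on_cmult_right d f fa)
    fix x
    let ?p = "f x" and ?q = "f (x \<otimes> a)"
    have "?p\<^sup>2 * \<sigma> x - ?q\<^sup>2 * \<sigma> x \<le> \<bar>?p\<^sup>2 - ?q\<^sup>2\<bar> * \<bar>\<sigma> x\<bar>"
      by (simp flip: abs_mult left_diff_distrib)
    also have "\<dots> \<le> \<bar>?p\<^sup>2 - ?q\<^sup>2\<bar>"
      using mult_left_mono[OF \<sigma>[of x], of "\<bar>?p\<^sup>2 - ?q\<^sup>2\<bar>"] by simp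
    also have "\<dots> = \<bar>?p - ?q\<bar> * \<bar>?p + ?q\<bar>"
      by (simp add: power2_eq_square square_diff_square_factored abs_mult mult.commute)
    also have "\<dots> \<le> 2 * (?q - ?p)\<^sup>2 + 1 / 8 * (?p + ?q)\<^sup>2"
    proof -
      \<comment> \<open>Expand \<open>(4 * A - B)\<^sup>2 \<ge> 0\<close>. The weight
        \<open>1 / 8\<close> becomes \<open>1 / 4\<close> when the square of the sum is split, and
        \<open>1 / 2\<close> after summation over the group.\<close>
      have "A * B \<le> 2 * A\<^sup>2 + 1 / 8 * B\<^sup>2" for A B :: real
        using zero_le_power2[of "4 * A - B"] by (simp add: power2_diff power_mult_distrib)
      from this[of "\<bar>?p - ?q\<bar>" "\<bar>?p + ?q\<bar>"] show ?thesis
        by (simp add: power2_commute)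
    qed
    also have "(?p + ?q)\<^sup>2 \<le> 2 * ?p\<^sup>2 + 2 * ?q\<^sup>2"
      using power2_diff_le[of ?p "- ?q"] by simp
    finally show "?p\<^sup>2 * \<sigma> x - ?q\<^sup>2 * \<sigma> x \<le> 2 * (?q - ?p)\<^sup>2 + 1 / 4 * (?p\<^sup>2 + ?q\<^sup>2)"
      by (simp add: field_simps)
  qed
  also have "\<dots> = 2 * energy f a + 1 / 2 * sqnorm f"
    by (simp only: infsum_add[OF summable_on_cmult_right[OF d] summable_on_cmult_right[OF summable_on_add[OF f fa]]]
      infsum_cmult_right' infsum_add[OF f fa] fa_sum) simp
  finally show ?B .
qed

text \<open>On a free group the vector field that points away from the identity in the Cayley tree is bounded
  and has divergence at least \<open>2\<close> everywhere; pairing \<open>f\<^sup>2\<close> with it bounds the norm of \<open>f\<close>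
    by its energy.\<close>

lemma free_quotient_spectral_gap:
  fixes f :: "'a \<Rightarrow> real"
  assumes H: "subgroup H G" and \<psi>: "\<psi> \<in> hom (G\<lparr>carrier := H\<rparr>) (free_group Y)"
    and ab: "a \<in> H" "b \<in> H" "\<psi> a = [(y1, True)]" "\<psi> b = [(y2, True)]" "y1 \<noteq> y2"
    and f: "(\<lambda>x. (f x)\<^sup>2) summable_on carrier G"
  shows "sqnorm f \<le>
    2 * (energy f a + energy f b)"
proof -
  interpret H: subgroup H G by fact
  interpret \<psi>: group_hom "G\<lparr>carrier := H\<rparr>" "free_group Y" \<psi>
    by (intro group_hom.intro group_hom_axioms.intro subgroup_imp_group[OF H] group_free_group \<psi>)
  \<comment> \<open>A root in each left coset of \<open>H\<close>; it depends on the coset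
    only.\<close>
  define r where "r x = (SOME y. y \<in> x <# H)" for x
  have r: "inv x \<otimes> r x \<in> H" "r x \<in> carrier G" if x: "x \<in> carrier G" for x
  proof -
    have "x \<in> x <# H"
      using x H.one_closed by (force simp: l_coset_def)
    then have "r x \<in> x <# H"
      unfolding r_def by (rule someI)
    then obtain h where "h \<in> H" "r x = x \<otimes> h" by (auto simp: l_coset_def)
    then show "inv x \<otimes> r x \<in> H" "r x \<in> carrier G"
      using x H.subset by (auto simp: m_assoc[symmetric])
  qed
  have r_mult: "r (x \<otimes> h) = r x" if "x \<in> carrier G" "h \<in> H" for x h
  proof -
    have "(x \<otimes> h) <# H = x <# (h <# H)"
      using lcos_m_assoc[OF H.subset that(1)] that(2) H.subset by auto
    also have "h <# H = H"
      using coset_join3[OF _ H that(2)] that(2) H.subset by auto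
    finally show ?thesis by (simp add: r_def)
  qed
  \<comment> \<open>The position of \<open>x\<close> relative to the root of its left coset, seen in
    the Cayley tree. Right multiplication by \<open>h\<close> strips \<open>\<psi> h\<close> from
    the left end, so pushing a positive letter is a step to
    \<open>x \<otimes> inv h\<close>.\<close>
  define \<mu> where "\<mu> x = \<psi> (inv x \<otimes> r x)" for x
  have \<mu>: "\<mu> x \<in> carrier (free_group Y)" if "x \<in> carrier G" for x
    using \<psi>.hom_closed r(1)[OF that] by (simp add: \<mu>_def)
  have \<mu>_mult: "\<mu> x = foldr push (\<psi> h) (\<mu> (x \<otimes> h))" if "x \<in> carrier G" "h \<in> H" for x h
  proof -
    have h: "h \<in> carrier G" using that H.subset by blast
    have "inv x \<otimes> r x = h \<otimes> (inv (x \<otimes> h) \<otimes> r (x \<otimes> h))"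
      using that h r(2)[OF that(1)] r_mult[OF that] by (simp add: inv_mult_group m_assoc[symmetric])
    then show ?thesis
      using \<psi>.hom_mult[of h "inv (x \<otimes> h) \<otimes> r (x \<otimes> h)"] that r(1)[of "x \<otimes> h"] h by (simp add: \<mu>_def)
  qed
  \<comment> \<open>The sign tells whether putting \<open>e\<close> in front of \<open>w\<close>
    leads away from the root or, by cancellation, towards it; reversing a step changes the
    sign.\<close>
  define \<eta> :: "('c \<times> bool) list \<Rightarrow> 'c \<times> bool \<Rightarrow> real"
    where "\<eta> w e = (if w \<noteq> [] \<and> hd w = inv_letter e then -1 else 1)" for w e
  have \<eta>_flip: "\<eta> (push e w) (inv_letter e) = - \<eta> w e" if "reduced w" for e w
    using that by (cases w) (auto simp: \<eta>_def push_def reduced_Cons)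
  have \<eta>_inv: "\<eta> (\<mu> (x \<otimes> inv h)) (y, False) = - \<eta> (\<mu> x) (y, True)"
    if x: "x \<in> carrier G" and h: "h \<in> H" "\<psi> h = [(y, True)]" for x h y
  proof -
    have hG: "h \<in> carrier G" using h H.subset by blast
    have "\<mu> (x \<otimes> inv h) = push (y, True) (\<mu> x)"
      using \<mu>_mult[of "x \<otimes> inv h" h] x h hG by (simp add: m_assoc)
    then show ?thesis
      using \<eta>_flip[of "\<mu> x" "(y, True)"] \<mu>[OF x] by (simp add: in_carrier_free_group inv_letter_def)
  qed
  \<comment> \<open>At most one of the four letters cancels the head of \<open>w\<close>, whence
    \<open>3 - 1 = 2\<close>.\<close>
  have four: "\<eta> w (y1, False) + \<eta> w (y1, True) + (\<eta> w (y2, False) + \<eta> w (y2, True)) \<ge> 2" for w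
    using ab(5) by (auto simp: \<eta>_def inv_letter_def)
  define \<sigma> where "\<sigma> y x = \<eta> (\<mu> x) (y, False)" for y x
  have \<sigma>: "\<bar>\<sigma> y x\<bar> \<le> 1" for y x by (simp add: \<sigma>_def \<eta>_def)
  have abG: "a \<in> carrier G" "b \<in> carrier G" using ab H.subset by auto
  note fa = flow_estimate[OF abG(1) f, where \<sigma> = "\<sigma> y1", OF \<sigma>]
    and fb = flow_estimate[OF abG(2) f, where \<sigma> = "\<sigma> y2", OF \<sigma>]
  have "2 * sqnorm f = (\<Sum>\<^sub>\<infinity>x\<in>carrier G. 2 * (f x)\<^sup>2)"
    using f by (simp add: infsum_cmult_right)
  also have "\<dots> \<le> (\<Sum>\<^sub>\<infinity>x\<in>carrier G. (f x)\<^sup>2 * (\<sigma> y1 x - \<sigma> y1 (x \<otimes> inv a)) +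
      (f x)\<^sup>2 * (\<sigma> y2 x - \<sigma> y2 (x \<otimes> inv b)))"
  proof (rule infsum_mono)
    fix x assume x: "x \<in> carrier G"
    have "2 \<le> \<sigma> y1 x - \<sigma> y1 (x \<otimes> inv a) + (\<sigma> y2 x - \<sigma> y2 (x \<otimes> inv b))"
      using four[of "\<mu> x"] \<eta>_inv[OF x ab(1,3)] \<eta>_inv[OF x ab(2,4)] by (simp add: \<sigma>_def)
    then have "(f x)\<^sup>2 * 2 \<le> (f x)\<^sup>2 * (\<sigma> y1 x - \<sigma> y1 (x \<otimes> inv a) + (\<sigma> y2 x - \<sigma> y2 (x \<otimes> inv b)))"
      by (intro mult_left_mono) auto
    then show "2 * (f x)\<^sup>2 \<le> (f x)\<^sup>2 * (\<sigma> y1 x - \<sigma> y1 (x \<otimes> inv a)) +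
        (f x)\<^sup>2 * (\<sigma> y2 x - \<sigma> y2 (x \<otimes> inv b))"
      by (simp add: algebra_simps)
  qed (intro summable_on_add summable_on_cmult_right fa(1) fb(1) f)+
  also have "\<dots> \<le> 2 * energy f a +
      2 * energy f b + sqnorm f"
    using fa(2) fb(2) by (subst infsum_add[OF fa(1) fb(1)]) linarith
  finally show ?thesis by simp
qed

end

section \<open>The Hilbert space of square-summable families\<close>

typedef 'i ell2 = "{f :: 'i \<Rightarrow> real. (\<lambda>i. (f i)\<^sup>2) summable_on UNIV}"
  morphisms coord Abs_ell2
  by (rule exI[of _ "\<lambda>_. 0"]) simp

setup_lifting type_definition_ell2

lemma coord_summable: "(\<lambda>i. (coord z i)\<^sup>2) summable_on A"
  using coord[of z] by (auto intro: summable_on_subset_banach)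

lemma mult_summable_of_squares:
  fixes f g :: "'i \<Rightarrow> real"
  assumes "(\<lambda>i. (f i)\<^sup>2) summable_on A" "(\<lambda>i. (g i)\<^sup>2) summable_on A"
  shows "(\<lambda>i. f i * g i) summable_on A"
proof (rule summable_on_bounded_mult[OF summable_on_add[OF assms], where c = 1])
  fix i
  have "a * b \<le> a\<^sup>2 + b\<^sup>2" if "0 \<le> a" "0 \<le> b" for a b :: real
    using sum_squares_bound[of a b] mult_nonneg_nonneg[OF that] by linarith
  from this[of "\<bar>f i\<bar>" "\<bar>g i\<bar>"] show "\<bar>f i * g i\<bar> \<le> 1 * ((f i)\<^sup>2 + (g i)\<^sup>2)"
    by (simp add: abs_mult)
qed

lemma coord_mult_summable: "(\<lambda>i. coord z i * coord w i) summable_on A"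
  by (intro mult_summable_of_squares coord_summable)

lemma add_summable_of_squares:
  fixes f g :: "'i \<Rightarrow> real"
  assumes "(\<lambda>i. (f i)\<^sup>2) summable_on A" "(\<lambda>i. (g i)\<^sup>2) summable_on A"
  shows "(\<lambda>i. (f i + g i)\<^sup>2) summable_on A"
proof (rule summable_on_bounded_mult[OF summable_on_add[OF assms]])
  fix i show "\<bar>(f i + g i)\<^sup>2\<bar> \<le> 2 * ((f i)\<^sup>2 + (g i)\<^sup>2)"
    using power2_diff_le[of "f i" "- g i"] by simp
qed

instantiation ell2 :: (type) real_vector
begin

lift_definition zero_ell2 :: "'a ell2" is "\<lambda>_. 0" by simp
lift_definition plus_ell2 :: "'a ell2 \<Rightarrow> 'a ell2 \<Rightarrow> 'a ell2" is "\<lambda>f g i. f i + g i"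
  by (rule add_summable_of_squares)
lift_definition uminus_ell2 :: "'a ell2 \<Rightarrow> 'a ell2" is "\<lambda>f i. - f i" by simp
lift_definition minus_ell2 :: "'a ell2 \<Rightarrow> 'a ell2 \<Rightarrow> 'a ell2" is "\<lambda>f g i. f i - g i"
  using add_summable_of_squares[where g = "\<lambda>i. - g i" for g] by force
lift_definition scaleR_ell2 :: "real \<Rightarrow> 'a ell2 \<Rightarrow> 'a ell2" is "\<lambda>c f i. c * f i"
  by (simp add: power_mult_distrib summable_on_cmult_right)

instance
  by standard (transfer; simp add: algebra_simps fun_eq_iff)+

end

instantiation ell2 :: (type) real_inner
begin

definition inner_ell2 :: "'a ell2 \<Rightarrow> 'a ell2 \<Rightarrow> real" where
  "inner_ell2 z w = (\<Sum>\<^sub>\<infinity>i. coord z i * coord w i)"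
definition norm_ell2 :: "'a ell2 \<Rightarrow> real" where "norm_ell2 z = sqrt (inner z z)"
definition dist_ell2 :: "'a ell2 \<Rightarrow> 'a ell2 \<Rightarrow> real" where "dist_ell2 z w = norm (z - w)"
definition sgn_ell2 :: "'a ell2 \<Rightarrow> 'a ell2" where "sgn_ell2 z = z /\<^sub>R norm z"
definition uniformity_ell2 :: "('a ell2 \<times> 'a ell2) filter" where
  "uniformity_ell2 = (INF e\<in>{0<..}. principal {(z, w). dist z w < e})"
definition open_ell2 :: "'a ell2 set \<Rightarrow> bool" where
  "open_ell2 U \<longleftrightarrow> (\<forall>z\<in>U. eventually (\<lambda>(z', w). z' = z \<longrightarrow> w \<in> U) uniformity)"

instance
proof
  fix z w v :: "'a ell2" and a :: real
  show "dist z w = norm (z - w)" by (rule dist_ell2_def)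
  show "sgn z = z /\<^sub>R norm z" by (rule sgn_ell2_def)
  show "norm z = sqrt (inner z z)" by (rule norm_ell2_def)
  show "inner z w = inner w z" by (simp add: inner_ell2_def mult.commute)
  show "inner (z + w) v = inner z v + inner w v"
    by (simp add: inner_ell2_def plus_ell2.rep_eq ring_distribs infsum_add coord_mult_summable)
  show "inner (a *\<^sub>R z) w = a * inner z w"
    by (simp add: inner_ell2_def scaleR_ell2.rep_eq mult.assoc infsum_cmult_right')
  show "0 \<le> inner z z"
    by (simp add: inner_ell2_def infsum_nonneg)
  show "inner z z = 0 \<longleftrightarrow> z = 0"
  proof
    assume "inner z z = 0"
    then have "coord z i * coord z i = 0" for i
      using nonneg_infsum_le_0D[of "\<lambda>i. coord z i * coord z i" UNIV i]
        coord_mult_summable[of z z UNIV]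
      by (simp add: inner_ell2_def)
    then show "z = 0"
      by (simp add: coord_inject[symmetric] zero_ell2.rep_eq fun_eq_iff)
  qed (simp add: inner_ell2_def zero_ell2.rep_eq)
qed (simp_all add: uniformity_ell2_def open_ell2_def)

end

lemma coord_simps [simp]:
  "coord 0 i = 0" "coord (z + w) i = coord z i + coord w i"
    "coord (z - w) i = coord z i - coord w i"
  "coord (- z) i = - coord z i" "coord (c *\<^sub>R z) i = c * coord z i"
  by (simp_all add: zero_ell2.rep_eq plus_ell2.rep_eq minus_ell2.rep_eq uminus_ell2.rep_eq scaleR_ell2.rep_eq)

lemma coord_sum: "coord (\<Sum>j\<in>J. z j) i = (\<Sum>j\<in>J. coord (z j) i)"
  by (induction J rule: infinite_finite_induct) auto

lemma ell2_eqI: "(\<And>i. coord z i = coord w i) \<Longrightarrow> z = w"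
  by (simp add: coord_inject[symmetric] fun_eq_iff)

lemma norm_ell2_sq: "(norm z)\<^sup>2 = (\<Sum>\<^sub>\<infinity>i. (coord z i)\<^sup>2)"
  unfolding power2_norm_eq_inner inner_ell2_def by (simp add: power2_eq_square)

lemma sum_coord_le_norm: "finite F \<Longrightarrow> (\<Sum>i\<in>F. (coord z i)\<^sup>2) \<le> (norm z)\<^sup>2"
  unfolding norm_ell2_sq by (rule finite_sum_le_infsum) (auto simp: coord_summable)

lemma coord_le_norm: "\<bar>coord z i\<bar> \<le> norm z"
proof -
  have "(coord z i)\<^sup>2 \<le> (norm z)\<^sup>2"
    using sum_coord_le_norm[of "{i}" z] by simp
  then show ?thesis
    using abs_le_square_iff[of "coord z i" "norm z"] by simp
qed

lemma ell2_bounded_sums: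
  assumes "\<And>F. finite F \<Longrightarrow> (\<Sum>i\<in>F. (f i)\<^sup>2) \<le> (C :: real)"
  shows "(\<lambda>i. (f i)\<^sup>2) summable_on UNIV" "(\<Sum>\<^sub>\<infinity>i. (f i)\<^sup>2) \<le> C"
proof -
  show s: "(\<lambda>i. (f i)\<^sup>2) summable_on UNIV"
    by (rule nonneg_bdd_above_summable_on) (use assms in \<open>auto intro!: bdd_aboveI2[where M = C]\<close>)
  show "(\<Sum>\<^sub>\<infinity>i. (f i)\<^sup>2) \<le> C"
    by (rule infsum_le_finite_sums[OF s]) (use assms in auto)
qed

instance ell2 :: (type) complete_space
proof
  fix z :: "nat \<Rightarrow> 'a ell2" assume z: "Cauchy z"
  have "Cauchy (\<lambda>n. coord (z n) i)" for i
  proof (rule metric_CauchyI)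
    fix e :: real assume "e > 0"
    then obtain N where N: "\<forall>m\<ge>N. \<forall>n\<ge>N. dist (z m) (z n) < e"
      using metric_CauchyD[OF z] by blast
    have "dist (coord (z m) i) (coord (z n) i) \<le> dist (z m) (z n)" for m n
      using coord_le_norm[of "z m - z n" i] by (simp add: dist_norm)
    then show "\<exists>N. \<forall>m\<ge>N. \<forall>n\<ge>N. dist (coord (z m) i) (coord (z n) i) < e"
      using N by (meson le_less_trans)
  qed
  then have "\<exists>f. \<forall>i. (\<lambda>n. coord (z n) i) \<longlonglongrightarrow> f i"
    by (intro choice) (simp add: Cauchy_convergent_iff convergent_def)
  then obtain f where f: "\<And>i. (\<lambda>n. coord (z n) i) \<longlonglongrightarrow> f i" by blast
  \<comment> \<open>The Cauchy estimate passes to the limit on finite sets of coordinates, where the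
    sum is continuous.\<close>
  have bound: "(\<Sum>i\<in>F. (f i - coord (z n) i)\<^sup>2) \<le> e\<^sup>2"
    if "\<forall>m\<ge>N. \<forall>n\<ge>N. dist (z m) (z n) < e" "n \<ge> N" "finite F" for e N n F
  proof (rule tendsto_upperbound)
    show "(\<lambda>m. \<Sum>i\<in>F. (coord (z m) i - coord (z n) i)\<^sup>2) \<longlonglongrightarrow> (\<Sum>i\<in>F. (f i - coord (z n) i)\<^sup>2)"
      by (intro tendsto_intros f)
    show "\<forall>\<^sub>F m in sequentially. (\<Sum>i\<in>F. (coord (z m) i - coord (z n) i)\<^sup>2) \<le> e\<^sup>2"
    proof (rule eventually_sequentiallyI)
      fix m assume "N \<le> m"
      then have "norm (z m - z n) < e"
        using that(1,2) by (simp add: dist_norm)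
      then have "(norm (z m - z n))\<^sup>2 \<le> e\<^sup>2"
        by (simp add: power_mono)
      then show "(\<Sum>i\<in>F. (coord (z m) i - coord (z n) i)\<^sup>2) \<le> e\<^sup>2"
        using sum_coord_le_norm[OF that(3), of "z m - z n"] by simp
    qed
  qed simp
  obtain N1 where N1: "\<forall>m\<ge>N1. \<forall>n\<ge>N1. dist (z m) (z n) < 1"
    using metric_CauchyD[OF z, of 1] by auto
  have "(\<lambda>i. (f i - coord (z N1) i)\<^sup>2) summable_on UNIV"
    by (rule ell2_bounded_sums(1)) (rule bound[OF N1 order_refl])
  then have "(\<lambda>i. (f i)\<^sup>2) summable_on UNIV"
    using add_summable_of_squares[of "\<lambda>i. f i - coord (z N1) i" UNIV "coord (z N1)", OF _ coord_summable] by simp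
  then have cf: "coord (Abs_ell2 f) = f"
    by (simp add: Abs_ell2_inverse)
  have "z \<longlonglongrightarrow> Abs_ell2 f"
  proof (rule metric_LIMSEQ_I)
    fix e :: real assume e: "e > 0"
    then obtain N where N: "\<forall>m\<ge>N. \<forall>n\<ge>N. dist (z m) (z n) < e / 2"
      using metric_CauchyD[OF z, of "e / 2"] by auto
    have "dist (z n) (Abs_ell2 f) < e" if "n \<ge> N" for n
    proof -
      have "(norm (Abs_ell2 f - z n))\<^sup>2 \<le> (e / 2)\<^sup>2"
        unfolding norm_ell2_sq coord_simps cf
        by (rule ell2_bounded_sums(2)) (rule bound[OF N that])
      then have "norm (Abs_ell2 f - z n) \<le> e / 2"
        using e by (simp add: power2_le_iff_abs_le)
      then show ?thesis using e by (simp add: dist_norm norm_minus_commute)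
    qed
    then show "\<exists>N. \<forall>n\<ge>N. dist (z n) (Abs_ell2 f) < e" by blast
  qed
  then show "convergent z" by (auto simp: convergent_def)
qed

text \<open>A minimizing sequence for the distance is Cauchy by the parallelogram law, because
  midpoints stay in \<open>V\<close>; completeness and closedness supply the nearest point.\<close>

lemma orthogonal_projection_exists:
  fixes V :: "'a :: {real_inner, complete_space} set"
  assumes V: "subspace V" "closed V"
  shows "\<exists>p\<in>V. \<forall>v\<in>V. inner p v = inner x v"
proof -
  define d where "d = (INF v\<in>V. (norm (x - v))\<^sup>2)"
  have bdd: "bdd_below ((\<lambda>v. (norm (x - v))\<^sup>2) ` V)"
    by (rule bdd_belowI2[where m = 0]) simp
  have ne: "V \<noteq> {}" using subspace_0[OF V(1)] by blast
  have d_le: "d \<le> (norm (x - v))\<^sup>2" if "v \<in> V" for v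
    unfolding d_def by (rule cINF_lower[OF bdd that])
  have "\<exists>v\<in>V. (norm (x - v))\<^sup>2 < d + 1 / real (Suc n)" for n
    using cInf_lessD[of "(\<lambda>v. (norm (x - v))\<^sup>2) ` V" "d + 1 / real (Suc n)"] ne
      by (auto simp: d_def)
  then obtain y where y: "\<And>n. y n \<in> V" "\<And>n. (norm (x - y n))\<^sup>2 < d + 1 / real (Suc n)"
    by metis
  have par: "(norm (y n - y m))\<^sup>2 \<le> 2 / real (Suc n) + 2 / real (Suc m)" for n m
  proof -
    have "(1 / 2) *\<^sub>R (y n + y m) \<in> V"
      using y(1) V(1) by (simp add: subspace_add subspace_scale)
    then have "d \<le> (norm (x - (1 / 2) *\<^sub>R (y n + y m)))\<^sup>2"
      by (rule d_le)
    moreover have "(norm (y n - y m))\<^sup>2 = 2 * (norm (x - y n))\<^sup>2 +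
        2 * (norm (x - y m))\<^sup>2 - 4 * (norm (x - (1 / 2) *\<^sub>R (y n + y m)))\<^sup>2"
      by (simp add: power2_norm_eq_inner inner_diff_left inner_diff_right inner_add_left inner_add_right
        inner_commute algebra_simps)
    ultimately show ?thesis using y(2)[of n] y(2)[of m] by linarith
  qed
  have "Cauchy y"
  proof (rule metric_CauchyI)
    fix e :: real assume e: "e > 0"
    obtain N where N: "4 / e\<^sup>2 < real N"
      using reals_Archimedean2 by blast
    have "dist (y m) (y n) < e" if "m \<ge> N" "n \<ge> N" for m n
    proof -
      have N': "4 / e\<^sup>2 < real (Suc k)" if "k \<ge> N" for k using N that by linarith
      then have "2 / real (Suc k) < e\<^sup>2 / 2" if "k \<ge> N" for k
        using N'[OF that] e by (simp add: field_simps)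
      then have "(norm (y m - y n))\<^sup>2 < e\<^sup>2"
        using par[of m n] that by (smt (verit) field_sum_of_halves)
      then show ?thesis
        using e by (simp add: dist_norm power2_less_imp_less)
    qed
    then show "\<exists>N. \<forall>m\<ge>N. \<forall>n\<ge>N. dist (y m) (y n) < e" by blast
  qed
  then obtain p where p: "y \<longlonglongrightarrow> p"
    using Cauchy_convergent_iff convergent_def by blast
  have pV: "p \<in> V"
    using closed_sequentially[OF V(2)] y(1) p by blast
  have "(norm (x - p))\<^sup>2 \<le> d"
  proof (rule LIMSEQ_le)
    show "(\<lambda>n. (norm (x - y n))\<^sup>2) \<longlonglongrightarrow> (norm (x - p))\<^sup>2"
      by (intro tendsto_intros p)
    show "(\<lambda>n. d + 1 / real (Suc n)) \<longlonglongrightarrow> d"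
      using tendsto_add[OF tendsto_const LIMSEQ_inverse_real_of_nat, of d]
        by (simp add: inverse_eq_divide)
    show "\<exists>N. \<forall>n\<ge>N. (norm (x - y n))\<^sup>2 \<le> d + 1 / real (Suc n)"
      using y(2) less_imp_le by blast
  qed
  then have min: "(norm (x - p))\<^sup>2 \<le> (norm (x - v))\<^sup>2" if "v \<in> V" for v
    using d_le[OF that] by linarith
  have "inner p v = inner x v" if v: "v \<in> V" for v
  proof (cases "v = 0")
    case False
    \<comment> \<open>This step minimizes the distance to \<open>x\<close> along the line
      \<open>p + t v\<close>; optimality of \<open>p\<close> then forces the inner product to
      vanish.\<close>
    define t where "t = inner (x - p) v / inner v v"
    have vv: "inner v v > 0" using False by simp
    have "p + t *\<^sub>R v \<in> V" using pV v V(1) by (simp add: subspace_add subspace_scale)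
    then have "(norm (x - p))\<^sup>2 \<le> (norm ((x - p) - t *\<^sub>R v))\<^sup>2"
      using min by (simp add: diff_diff_eq)
    also have "\<dots> = (norm (x - p))\<^sup>2 - 2 * t * inner (x - p) v + t * t * inner v v"
      by (simp add: power2_norm_eq_inner inner_diff_left inner_diff_right inner_commute algebra_simps)
    also have "t * t * inner v v = t * inner (x - p) v"
      using vv by (simp add: t_def)
    finally have "t * inner (x - p) v \<le> 0" by simp
    moreover have "t * inner (x - p) v = (inner (x - p) v)\<^sup>2 / inner v v"
      by (simp add: t_def power2_eq_square)
    ultimately have "(inner (x - p) v)\<^sup>2 \<le> 0"
      using vv by (simp add: divide_le_0_iff)
    then show ?thesis by (simp add: inner_diff_left)
  qed simp
  then show ?thesis using pV by blast
qed

section \<open>Comparison of equivariant traces\<close>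

lemma summable_on_finite_sum:
  fixes f :: "'j \<Rightarrow> 'i \<Rightarrow> real"
  assumes "\<And>j. j \<in> J \<Longrightarrow> f j summable_on A"
  shows "(\<lambda>i. \<Sum>j\<in>J. f j i) summable_on A" "(\<Sum>\<^sub>\<infinity>i\<in>A. \<Sum>j\<in>J. f j i) = (\<Sum>j\<in>J. infsum (f j) A)"
  using assms
  by (induction J rule: infinite_finite_induct) (auto simp: summable_on_add infsum_add)

lift_definition unit_vector :: "'i \<Rightarrow> 'i ell2" is "\<lambda>i j. if j = i then 1 else 0"
  by (rule finite_nonzero_values_imp_summable_on) simp

lift_definition restr :: "'i set \<Rightarrow> 'i ell2 \<Rightarrow> 'i ell2" is "\<lambda>A f i. if i \<in> A then f i else 0"
  by (rule summable_on_bounded_mult[where c = 1]) auto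

lemma inner_unit_vector: "inner z (unit_vector i) = coord z i"
proof -
  have "inner z (unit_vector i) = (\<Sum>\<^sub>\<infinity>j\<in>{i}. coord z j)"
    unfolding inner_ell2_def by (rule infsum_cong_neutral) (auto simp: unit_vector.rep_eq)
  then show ?thesis by simp
qed

lemma inner_restr: "inner (restr A z) w = (\<Sum>\<^sub>\<infinity>i\<in>A. coord z i * coord w i)"
  unfolding inner_ell2_def by (rule infsum_cong_neutral) (auto simp: restr.rep_eq)

lemma inner_restr_commute: "inner (restr A z) w = inner z (restr A w)"
  unfolding inner_ell2_def by (rule infsum_cong) (auto simp: restr.rep_eq)

lemma inner_restr_self: "inner (restr A z) z = (norm (restr A z))\<^sup>2"
  unfolding power2_norm_eq_inner inner_ell2_def by (rule infsum_cong) (auto simp: restr.rep_eq)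

lemma restr_compl: "restr (- A) z = z - restr A z"
  by (rule ell2_eqI) (simp add: restr.rep_eq)

text \<open>\<open>P\<close> is the orthogonal projection onto \<open>V\<close> and \<open>restr U\<close> the one onto the vectors supported in \<open>U\<close>.
  The powers of \<open>T = P (1 - restr U) P\<close> tend strongly to \<open>0\<close>, so \<open>P\<close> is the limit of \<open>P - T\<^sup>n\<close>,
  whose diagonal entries are sums over \<open>U\<close> of the kernel \<open>k n\<close>; the column sums of \<open>k n\<close> over \<open>U\<close>
  are at most \<open>1\<close>. For equivariant \<open>V\<close> and \<open>U\<close>, exchanging the sums bounds the trace of \<open>P\<close>
  by that of \<open>restr U\<close>.\<close>

locale projection_pair =
  fixes V :: "'i ell2 set" and U :: "'i set" and P :: "'i ell2 \<Rightarrow> 'i ell2"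
  assumes closed: "closed V"
    and P_in: "P z \<in> V"
    and P_inner: "v \<in> V \<Longrightarrow> inner (P z) v = inner z v"
    and separating: "z \<in> V \<Longrightarrow> (\<And>i. i \<in> U \<Longrightarrow> coord z i = 0) \<Longrightarrow> z = 0"
begin

definition T :: "'i ell2 \<Rightarrow> 'i ell2" where "T z = P (restr (- U) z)"

definition y :: "nat \<Rightarrow> 'i \<Rightarrow> 'i ell2" where "y l i = (T ^^ l) (P (unit_vector i))"

definition \<beta> :: "nat \<Rightarrow> 'i \<Rightarrow> real" where "\<beta> l i = inner (y l i) (y 0 i)"

text \<open>The entrywise product of the kernels of \<open>P\<close> and of a truncated Neumann
  series of \<open>T\<close> on \<open>V\<close>. Since \<open>1 - T\<close> is the compression of
  \<open>restr U\<close> to \<open>V\<close>, the series approximates an inverse of that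
  compression.\<close>

definition k :: "nat \<Rightarrow> 'i \<Rightarrow> 'i \<Rightarrow> real" where "k n i j = coord (y 0 i) j * (\<Sum>l<n. coord (y l i) j)"

lemma y_in: "y l i \<in> V"
  by (cases l) (simp_all add: y_def T_def P_in)

lemma y_Suc: "y (Suc l) i = T (y l i)"
  by (simp add: y_def)

lemma inner_T: "w \<in> V \<Longrightarrow> inner (T z) w = inner (restr (- U) z) w"
  by (simp add: T_def P_inner)

lemma coord_eq_inner: "z \<in> V \<Longrightarrow> coord z i = inner z (y 0 i)"
  using P_inner[of z "unit_vector i"] by (simp add: y_def inner_commute inner_unit_vector)

lemma inner_diff_T: "w \<in> V \<Longrightarrow> inner (z - T z) w = inner (restr U z) w"
  by (simp add: inner_diff_left inner_T restr_compl)

lemma T_self_adjoint: "z \<in> V \<Longrightarrow> w \<in> V \<Longrightarrow> inner (T z) w = inner z (T w)"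
  using inner_T[of w z] inner_T[of z w] inner_restr_commute[of "- U" z w]
    by (simp add: inner_commute)

lemma inner_y_shift: "inner (y l i) (y (Suc m) j) = inner (y (Suc l) i) (y m j)"
  by (simp add: y_Suc T_self_adjoint y_in)

text \<open>\<open>T\<close> is self-adjoint on \<open>V\<close>, so only the sum of the exponents
  matters and \<open>\<beta>\<close> is a moment sequence of \<open>T\<close>.\<close>

lemma inner_y_y: "inner (y l i) (y m j) = inner (y (l + m) i) (y 0 j)"
  by (induction m arbitrary: l) (simp_all add: inner_y_shift)

lemma inner_y: "inner (y l i) (y m i) = \<beta> (l + m) i"
  by (simp add: \<beta>_def inner_y_y[of l i m])

lemma \<beta>_even: "\<beta> (m + m) i = (norm (y m i))\<^sup>2"
  by (simp add: inner_y[symmetric] power2_norm_eq_inner)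

lemma \<beta>_odd: "\<beta> (Suc (m + m)) i = (norm (restr (- U) (y m i)))\<^sup>2"
  using inner_y[of "Suc m" i m] by (simp add: y_Suc inner_T y_in inner_restr_self)

lemma even_odd_cases:
  obtains m where "l = m + m" | m where "l = Suc (m + m)"
  by (metis add_Suc_right mult_2 oddE evenE Suc_eq_plus1)

lemma \<beta>_nonneg: "\<beta> l i \<ge> 0"
  by (cases rule: even_odd_cases[of l]) (simp_all add: \<beta>_even \<beta>_odd)

text \<open>For even \<open>l\<close> the difference is the squared norm of a restriction to
  \<open>U\<close>; for odd \<open>l\<close> the inequality says that the projection
  \<open>P\<close> is a contraction.\<close>

lemma \<beta>_decreasing: "\<beta> (Suc l) i \<le> \<beta> l i"
proof (cases rule: even_odd_cases[of l])
  case (1 m)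
  have "\<beta> l i - \<beta> (Suc l) i = inner (y m i - T (y m i)) (y m i)"
    using inner_y[of m i m] inner_y[of "Suc m" i m] 1 by (simp add: y_Suc inner_diff_left)
  also have "\<dots> = (norm (restr U (y m i)))\<^sup>2"
    by (simp add: inner_diff_T y_in inner_restr_self)
  finally show ?thesis using zero_le_power2[of "norm (restr U (y m i))"] by linarith
next
  case (2 m)
  let ?r = "restr (- U) (y m i)"
  have "(norm (P ?r))\<^sup>2 = inner ?r (P ?r)"
    using P_inner[OF P_in, of ?r ?r] by (simp add: power2_norm_eq_inner)
  also have "\<dots> \<le> norm ?r * norm (P ?r)"
    by (rule norm_cauchy_schwarz)
  finally have "norm (P ?r) \<le> norm ?r"
    by (cases "norm (P ?r) = 0") (auto simp: power2_eq_square)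
  then have "(norm (P ?r))\<^sup>2 \<le> (norm ?r)\<^sup>2"
    by (simp add: power_mono)
  moreover have "\<beta> (Suc l) i = (norm (P ?r))\<^sup>2"
    using \<beta>_even[of "Suc m" i] 2 by (simp add: y_Suc T_def)
  ultimately show ?thesis using 2 \<beta>_odd by simp
qed

text \<open>Convergence of the moments makes \<open>y m i\<close> a Cauchy sequence in
  \<open>m\<close>. The squared norm of its part on \<open>U\<close> is a difference of consecutive
  moments, so the limit vanishes on \<open>U\<close> and is \<open>0\<close> by
  \<open>separating\<close>.\<close>

lemma \<beta>_tendsto_0: "(\<lambda>l. \<beta> l i) \<longlonglongrightarrow> 0"
proof -
  have "decseq (\<lambda>l. \<beta> l i)"
    by (rule decseq_SucI) (rule \<beta>_decreasing)
  then obtain b where b: "(\<lambda>l. \<beta> l i) \<longlonglongrightarrow> b"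
    using decseq_convergent[of "\<lambda>l. \<beta> l i" 0] \<beta>_nonneg by metis
  have dist: "(norm (y m i - y n i))\<^sup>2 = \<beta> (m + m) i - 2 * \<beta> (m + n) i + \<beta> (n + n) i" for m n
    by (simp add: power2_norm_eq_inner inner_diff_left inner_diff_right inner_y add.commute)
  have "Cauchy (\<lambda>m. y m i)"
  proof (rule metric_CauchyI)
    fix e :: real assume e: "e > 0"
    then obtain N where N: "\<And>l. l \<ge> N \<Longrightarrow> \<bar>\<beta> l i - b\<bar> < e\<^sup>2 / 4"
      using LIMSEQ_D[OF b, of "e\<^sup>2 / 4"] by auto
    have "dist (y m i) (y n i) < e" if "m \<ge> N" "n \<ge> N" for m n
    proof -
      have "(norm (y m i - y n i))\<^sup>2 < e\<^sup>2"
      proof -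
        have "\<bar>\<beta> (m + m) i - b\<bar> < e\<^sup>2 / 4" "\<bar>\<beta> (m + n) i - b\<bar> < e\<^sup>2 / 4"
            "\<bar>\<beta> (n + n) i - b\<bar> < e\<^sup>2 / 4"
          using that by (intro N; simp)+
        then show ?thesis using dist[of m n] by linarith
      qed
      then show ?thesis using e by (simp add: dist_norm power2_less_imp_less)
    qed
    then show "\<exists>N. \<forall>m\<ge>N. \<forall>n\<ge>N. dist (y m i) (y n i) < e" by blast
  qed
  then obtain z where z: "(\<lambda>m. y m i) \<longlonglongrightarrow> z"
    using Cauchy_convergent_iff convergent_def by blast
  have zV: "z \<in> V"
    by (rule closed_sequentially[OF closed _ z]) (rule y_in)
  have "z = 0"
  proof (rule separating[OF zV])
    fix j assume j: "j \<in> U"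
    have r: "(norm (restr U (y m i)))\<^sup>2 = \<beta> (m + m) i - \<beta> (Suc (m + m)) i" for m
      using inner_y[of m i m] inner_y[of "Suc m" i m] inner_diff_T[OF y_in, of "y m i" m i]
      by (simp add: y_Suc inner_diff_left inner_restr_self)
    have "(\<lambda>m. \<beta> (m + m) i) \<longlonglongrightarrow> b"
      using LIMSEQ_subseq_LIMSEQ[OF b, of "\<lambda>m. m + m"] by (simp add: strict_mono_def o_def)
    moreover have "(\<lambda>m. \<beta> (Suc (m + m)) i) \<longlonglongrightarrow> b"
      using LIMSEQ_subseq_LIMSEQ[OF b, of "\<lambda>m. Suc (m + m)"] by (simp add: strict_mono_def o_def)
    ultimately have lim: "(\<lambda>m. (norm (restr U (y m i)))\<^sup>2) \<longlonglongrightarrow> 0"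
      unfolding r using tendsto_diff[of "\<lambda>m. \<beta> (m + m) i" b sequentially "\<lambda>m. \<beta> (Suc (m + m)) i" b]
        by simp
    have le: "(coord (y m i) j)\<^sup>2 \<le> (norm (restr U (y m i)))\<^sup>2" for m
      using power_mono[OF coord_le_norm[of "restr U (y m i)" j] abs_ge_zero, of 2] j
        by (simp add: restr.rep_eq)
    have "(\<lambda>m. (coord (y m i) j)\<^sup>2) \<longlonglongrightarrow> 0"
      by (rule tendsto_sandwich[OF always_eventually always_eventually tendsto_const lim])
        (simp_all add: le)
    moreover have "(\<lambda>m. coord (y m i) j) \<longlonglongrightarrow> coord z j"
      unfolding inner_unit_vector[symmetric] by (intro tendsto_intros z)
    then have "(\<lambda>m. (coord (y m i) j)\<^sup>2) \<longlonglongrightarrow> (coord z j)\<^sup>2"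
      by (rule tendsto_power)
    ultimately show "coord z j = 0"
      using LIMSEQ_unique by fastforce
  qed
  then have "(\<lambda>m. \<beta> m i) \<longlonglongrightarrow> 0"
    unfolding \<beta>_def using tendsto_inner[OF z tendsto_const, of "y 0 i"] by simp
  then show ?thesis .
qed

lemma k_sym: "k n i j = k n j i"
proof -
  have "coord (y l i) j = coord (y l j) i" for l
    using coord_eq_inner[OF y_in, of l i j] coord_eq_inner[OF y_in, of l j i] inner_y_y[of 0 j l i]
    by (simp add: inner_commute)
  then show ?thesis by (simp add: k_def)
qed

lemma k_eq: "k n i j = coord (\<Sum>l<n. y l i) j * coord (y 0 i) j"
  by (simp add: k_def coord_sum mult.commute)

lemma k_summable: "(\<lambda>j. k n i j) summable_on A"
  unfolding k_eq by (rule coord_mult_summable)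

text \<open>Restriction to \<open>U\<close> compresses to \<open>1 - T\<close> on \<open>V\<close>,
  so the sum of powers telescopes.\<close>

lemma telescope: "inner (restr U (\<Sum>l<n. y l i)) w = inner (y 0 i - y n i) w" if "w \<in> V"
proof -
  have "inner (restr U (\<Sum>l<n. y l i)) w = (\<Sum>l<n. inner (restr U (y l i)) w)"
    by (simp add: inner_restr_commute[of _ _ w] inner_sum_left)
  also have "\<dots> = (\<Sum>l<n. inner (y l i) w - inner (y (Suc l) i) w)"
    using inner_diff_T[OF that] by (simp add: inner_diff_left y_Suc)
  also have "\<dots> = inner (y 0 i) w - inner (y n i) w"
    by (rule sum_lessThan_telescope')
  finally show ?thesis by (simp add: inner_diff_left)
qed

lemma k_row_sum: "(\<Sum>\<^sub>\<infinity>j\<in>U. k n i j) = \<beta> 0 i - \<beta> n i"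
  using telescope[OF y_in[of 0 i], where n = n and i = i] unfolding k_eq inner_restr
    by (simp add: inner_diff_left \<beta>_def)

text \<open>Expand the nonnegative squared norm of \<open>unit_vector i - restr U W\<close>, where
  \<open>W\<close> is the partial sum of powers. By \<open>telescope\<close> this bounds the sum of
  the first \<open>n\<close> moments by \<open>1\<close>, and the column sum equals that
  sum.\<close>

lemma k_column_sum:
  assumes i: "i \<in> U"
  shows "(\<Sum>\<^sub>\<infinity>j. k n j i) \<le> 1"
proof -
  let ?W = "\<lambda>n. \<Sum>l<n. y l i"
  have W: "inner (?W n) (y m i) = (\<Sum>l<n. \<beta> (l + m) i)" for n m
    by (simp add: inner_sum_left inner_y)
  have "0 \<le> inner (unit_vector i - restr U (?W n)) (unit_vector i - restr U (?W n))"
    by (rule inner_ge_zero)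
  also have "\<dots> = 1 - 2 * coord (?W n) i + inner (restr U (?W n)) (?W n)"
    using i by (simp add: inner_diff_left inner_diff_right inner_unit_vector inner_restr_commute[of U "?W n" "unit_vector i"]
        inner_commute[of "unit_vector i"] unit_vector.rep_eq restr.rep_eq inner_restr_self
          power2_norm_eq_inner)
  also have "inner (restr U (?W n)) (?W n) = (\<Sum>l<n. \<beta> l i) - (\<Sum>l<n. \<beta> (l + n) i)"
  proof -
    have "inner (restr U (?W n)) (?W n) = (\<Sum>l<n. inner (restr U (?W n)) (y l i))"
      by (rule inner_sum_right)
    also have "\<dots> = (\<Sum>l<n. inner (y 0 i) (y l i) - inner (y n i) (y l i))"
      by (simp add: telescope y_in inner_diff_left)
    finally show ?thesis by (simp add: inner_y sum_subtractf add.commute)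
  qed
  also have "coord (?W n) i = (\<Sum>l<n. \<beta> l i)"
    by (simp add: coord_sum coord_eq_inner y_in \<beta>_def)
  finally have "(\<Sum>l<n. \<beta> l i) + (\<Sum>l<n. \<beta> (l + n) i) \<le> 1" by simp
  moreover have "(\<Sum>l<n. \<beta> (l + n) i) \<ge> 0"
    by (rule sum_nonneg) (rule \<beta>_nonneg)
  moreover have "(\<Sum>\<^sub>\<infinity>j. k n j i) = (\<Sum>l<n. \<beta> l i)"
    unfolding k_sym[of n _ i] unfolding k_eq using W[of n 0] by (simp add: inner_ell2_def)
  ultimately show ?thesis by linarith
qed

lemma P_unique: "p \<in> V \<Longrightarrow> (\<And>v. v \<in> V \<Longrightarrow> inner p v = inner z v) \<Longrightarrow> subspace V \<Longrightarrow> p = P z"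
proof -
  assume p: "p \<in> V" "\<And>v. v \<in> V \<Longrightarrow> inner p v = inner z v" "subspace V"
  then have "inner (p - P z) (p - P z) = 0"
    using P_in[of z] P_inner[of "p - P z" z] p(2)[of "p - P z"] subspace_diff[OF p(3)]
    by (simp add: inner_diff_left)
  then show "p = P z" by simp
qed

end

text \<open>Meant for bijective \<open>\<tau>\<close>: composition with other maps may destroy
  square-summability, and then \<open>Abs_ell2\<close> says nothing.\<close>

definition reindex :: "('i \<Rightarrow> 'i) \<Rightarrow> 'i ell2 \<Rightarrow> 'i ell2" where
  "reindex \<tau> z = Abs_ell2 (\<lambda>i. coord z (\<tau> i))"

lemma coord_reindex: "bij \<tau> \<Longrightarrow> coord (reindex \<tau> z) i = coord z (\<tau> i)"
  using summable_on_reindex_bij_betw[of \<tau> UNIV UNIV "\<lambda>i. (coord z i)\<^sup>2"] coord_summable[of z UNIV]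
  by (simp add: reindex_def Abs_ell2_inverse)

lemma inner_reindex:
  assumes "bij \<tau>"
  shows "inner (reindex \<tau> z) w = inner z (reindex (inv_into UNIV \<tau>) w)"
proof -
  have "inner z (reindex (inv_into UNIV \<tau>) w) =
      (\<Sum>\<^sub>\<infinity>i. coord z (\<tau> i) * coord w (inv_into UNIV \<tau> (\<tau> i)))"
    unfolding inner_ell2_def coord_reindex[OF bij_imp_bij_inv[OF assms]]
    by (rule infsum_reindex_bij_betw[OF assms, symmetric])
  then show ?thesis
    using assms by (simp add: inner_ell2_def coord_reindex bij_is_inj)
qed

context projection_pair
begin

definition invariant :: "('i \<Rightarrow> 'i) \<Rightarrow> bool" where
  "invariant \<tau> \<longleftrightarrow> bij \<tau> \<and> (\<forall>i. \<tau> i \<in> U \<longleftrightarrow> i \<in> U) \<and> (\<forall>v\<in>V. reindex \<tau> v \<in> V \<and>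
    reindex (inv_into UNIV \<tau>) v \<in> V)"

lemma reindex_P:
  assumes "bij \<tau>" "\<And>v. v \<in> V \<Longrightarrow> reindex \<tau> v \<in> V" "\<And>v. v \<in> V \<Longrightarrow> reindex (inv_into UNIV \<tau>) v \<in> V"
    "subspace V"
  shows "reindex \<tau> (P z) = P (reindex \<tau> z)"
proof (rule P_unique)
  fix v assume "v \<in> V"
  then show "inner (reindex \<tau> (P z)) v = inner (reindex \<tau> z) v"
    using assms by (simp add: inner_reindex P_inner)
qed (use assms P_in in auto)

lemma reindex_unit_vector: "bij \<tau> \<Longrightarrow> reindex \<tau> (unit_vector (\<tau> i)) = unit_vector i"
  by (intro ell2_eqI) (auto simp: coord_reindex unit_vector.rep_eq bij_is_inj inj_eq)

lemma norm_P_unit_vector: "(norm (P (unit_vector i)))\<^sup>2 = coord (P (unit_vector i)) i"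
  using P_inner[OF P_in, of "unit_vector i" "unit_vector i"]
  by (simp add: power2_norm_eq_inner inner_unit_vector[symmetric] inner_commute)

text \<open>Stated without reference to \<open>U\<close>, because it is applied to translations by
  all of \<open>G\<close>, whereas invariance of \<open>U\<close> is available for
  \<open>H\<close>.\<close>

lemma norm_P_invariant:
  assumes "bij \<tau>" "\<And>v. v \<in> V \<Longrightarrow> reindex \<tau> v \<in> V" "\<And>v. v \<in> V \<Longrightarrow> reindex (inv_into UNIV \<tau>) v \<in> V"
    "subspace V"
  shows "(norm (P (unit_vector (\<tau> i))))\<^sup>2 = (norm (P (unit_vector i)))\<^sup>2"
  using reindex_P[OF assms, of "unit_vector (\<tau> i)"]
    coord_reindex[OF assms(1), of "P (unit_vector (\<tau> i))" i]
  by (simp add: norm_P_unit_vector reindex_unit_vector[OF assms(1)])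

lemma reindex_y:
  assumes "invariant \<tau>" "subspace V"
  shows "reindex \<tau> (y l (\<tau> i)) = y l i"
proof -
  have P: "reindex \<tau> (P z) = P (reindex \<tau> z)" for z
    using assms by (intro reindex_P) (auto simp: invariant_def)
  show ?thesis
  proof (induction l)
    case 0
    show ?case
      using P assms(1) by (simp add: y_def reindex_unit_vector invariant_def)
  next
    case (Suc l)
    have "reindex \<tau> (restr (- U) z) = restr (- U) (reindex \<tau> z)" for z
      using assms(1) by (intro ell2_eqI) (auto simp: coord_reindex invariant_def restr.rep_eq)
    then show ?case using Suc P by (simp add: y_Suc T_def)
  qed
qed

lemma k_invariant:
  assumes "invariant \<tau>" "subspace V"
  shows "k n (\<tau> i) (\<tau> j) = k n i j"
proof -
  have "coord (y l (\<tau> i)) (\<tau> j) = coord (y l i) j" for l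
    using reindex_y[OF assms, of l i] coord_reindex[of \<tau> "y l (\<tau> i)" j] assms(1)
      by (simp add: invariant_def)
  then show ?thesis by (simp add: k_def)
qed

text \<open>Mass transport. A row sum over \<open>U\<close> is a sum over translates of
  \<open>U0\<close>; invariance of \<open>k\<close> moves the translation to the row index, and the
  translates of \<open>R\<close> fill \<open>Z\<close>. What remains are \<open>card U0\<close>
  column sums, each at most \<open>1\<close>.\<close>

theorem trace_bound:
  fixes \<tau> :: "'h \<Rightarrow> 'i \<Rightarrow> 'i"
  assumes V: "subspace V" and \<tau>: "\<And>h. h \<in> H \<Longrightarrow> invariant (\<tau> h)"
    and U0: "finite U0" "U0 \<subseteq> U" "bij_betw (\<lambda>(h, u). \<tau> h u) (H \<times> U0) U"
    and Z: "bij_betw (\<lambda>(r, h). inv_into UNIV (\<tau> h) r) (R \<times> H) Z"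
      "\<And>z i. z \<in> V \<Longrightarrow> i \<notin> Z \<Longrightarrow> coord z i = 0"
    and J: "finite J" "J \<subseteq> R"
  shows "(\<Sum>r\<in>J. (norm (P (unit_vector r)))\<^sup>2) \<le> card U0"
proof -
  have bound: "(\<Sum>r\<in>J. \<beta> 0 r - \<beta> n r) \<le> card U0" for n
  proof -
    define F where "F = (\<lambda>(r, h). \<Sum>u\<in>U0. k n (inv_into UNIV (\<tau> h) r) u)"
    have ks: "(\<lambda>i. k n i u) summable_on A" for A u
      using k_summable[of n u] by (simp add: k_sym[of n _ u])
    have kF: "(\<lambda>(r, h). k n (inv_into UNIV (\<tau> h) r) u) summable_on R \<times> H" for u
      using summable_on_reindex_bij_betw[OF Z(1), of "\<lambda>i. k n i u"] ks
        by (simp add: case_prod_unfold)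
    have F: "F summable_on R \<times> H"
      unfolding F_def
        using summable_on_finite_sum(1)[of U0 "\<lambda>u (r, h). k n (inv_into UNIV (\<tau> h) r) u" "R \<times> H"] kF
      by (simp add: case_prod_unfold)
    have row: "(\<Sum>\<^sub>\<infinity>h\<in>H. F (r, h)) = \<beta> 0 r - \<beta> n r" for r
    proof -
      have s: "(\<lambda>(h, u). k n r (\<tau> h u)) summable_on H \<times> U0"
        using summable_on_reindex_bij_betw[OF U0(3), of "\<lambda>j. k n r j"] k_summable
          by (simp add: case_prod_unfold)
      have "(\<Sum>\<^sub>\<infinity>h\<in>H. F (r, h)) = (\<Sum>\<^sub>\<infinity>h\<in>H. \<Sum>\<^sub>\<infinity>u\<in>U0. k n r (\<tau> h u))"
      proof (rule infsum_cong)
        fix h assume h: "h \<in> H"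
        have "k n (inv_into UNIV (\<tau> h) r) u = k n r (\<tau> h u)" for u
          using k_invariant[OF \<tau>[OF h] V, of n "inv_into UNIV (\<tau> h) r" u] \<tau>[OF h]
          by (simp add: invariant_def bij_is_surj surj_f_inv_f)
        then show "F (r, h) = (\<Sum>\<^sub>\<infinity>u\<in>U0. k n r (\<tau> h u))"
          using U0(1) by (simp add: F_def)
      qed
      also have "\<dots> = (\<Sum>\<^sub>\<infinity>(h, u)\<in>H \<times> U0. k n r (\<tau> h u))"
        using infsum_Sigma_banach[OF s] by simp
      also have "\<dots> = (\<Sum>\<^sub>\<infinity>j\<in>U. k n r j)"
        using infsum_reindex_bij_betw[OF U0(3), of "\<lambda>j. k n r j"] by (simp add: case_prod_unfold)
      finally show ?thesis by (simp add: k_row_sum)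
    qed
    have "(\<Sum>r\<in>J. \<beta> 0 r - \<beta> n r) \<le> (\<Sum>\<^sub>\<infinity>r\<in>R. \<beta> 0 r - \<beta> n r)"
    proof (rule finite_sum_le_infsum[OF _ J])
      show "(\<lambda>r. \<beta> 0 r - \<beta> n r) summable_on R"
        using summable_on_Sigma_banach[of "\<lambda>r h. F (r, h)" R "\<lambda>_. H"] F row by simp
      have "\<beta> n r \<le> \<beta> 0 r" for r
        using \<beta>_decreasing by (induction n) (auto intro: order_trans)
      then show "0 \<le> \<beta> 0 r - \<beta> n r" for r by simp
    qed
    also have "\<dots> = infsum F (R \<times> H)"
      using infsum_Sigma_banach[OF F] row by simp
    also have "\<dots> = (\<Sum>u\<in>U0. \<Sum>\<^sub>\<infinity>(r, h)\<in>R \<times> H. k n (inv_into UNIV (\<tau> h) r) u)"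
      unfolding F_def
        using summable_on_finite_sum(2)[of U0 "\<lambda>u (r, h). k n (inv_into UNIV (\<tau> h) r) u" "R \<times> H"] kF
      by (simp add: case_prod_unfold)
    also have "\<dots> \<le> (\<Sum>u\<in>U0. 1)"
    proof (rule sum_mono)
      fix u assume u: "u \<in> U0"
      have "(\<Sum>\<^sub>\<infinity>(r, h)\<in>R \<times> H. k n (inv_into UNIV (\<tau> h) r) u) = (\<Sum>\<^sub>\<infinity>i\<in>Z. k n i u)"
        using infsum_reindex_bij_betw[OF Z(1), of "\<lambda>i. k n i u"] by (simp add: case_prod_unfold)
      also have "\<dots> = (\<Sum>\<^sub>\<infinity>i. k n i u)"
      proof (rule infsum_cong_neutral)
        fix i assume "i \<in> UNIV - Z"
        then show "k n i u = 0"
          unfolding k_sym[of n i u] by (simp add: k_def Z(2)[OF y_in])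
      qed auto
      also have "\<dots> \<le> 1"
        by (rule k_column_sum) (use u U0(2) in auto)
      finally show "(\<Sum>\<^sub>\<infinity>(r, h)\<in>R \<times> H. k n (inv_into UNIV (\<tau> h) r) u) \<le> 1" .
    qed
    finally show ?thesis by simp
  qed
  \<comment> \<open>The subtracted moments disappear in the limit, leaving the diagonal entries of
    \<open>P\<close>.\<close>
  have "(\<lambda>n. \<Sum>r\<in>J. \<beta> 0 r - \<beta> n r) \<longlonglongrightarrow> (\<Sum>r\<in>J. \<beta> 0 r - 0)"
    by (intro tendsto_intros \<beta>_tendsto_0)
  then have "(\<Sum>r\<in>J. \<beta> 0 r - 0) \<le> card U0"
    by (rule LIMSEQ_le_const2) (use bound in auto)
  moreover have "\<beta> 0 r = (norm (P (unit_vector r)))\<^sup>2" for r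
    using \<beta>_even[of 0 r] by (simp add: y_def)
  ultimately show ?thesis by simp
qed

end

section \<open>Commensurated subgroups\<close>

context group
begin

lemma set_mult_eq_UN_rcosets: "H <#> T = (\<Union>r\<in>T. H #> r)"
  by (auto simp: set_mult_def r_coset_def)

lemma finite_set_mult: "finite A \<Longrightarrow> finite B \<Longrightarrow> finite (A <#> B)"
  by (simp add: set_mult_def)

text \<open>Increments along a product telescope and right translation permutes the group, so finite
  energy on the generators passes to every fixed \<open>t\<close>.\<close>

lemma gradient_square_summable:
  fixes u :: "'a \<Rightarrow> real"
  assumes S: "S \<subseteq> carrier G" and E: "\<And>s. s \<in> S \<Longrightarrow> (\<lambda>x. (u (x \<otimes> s) - u x)\<^sup>2) summable_on carrier G"
    and t: "t \<in> generate G S"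
  shows "(\<lambda>x. (u (x \<otimes> t) - u x)\<^sup>2) summable_on carrier G"
  using t
proof (induction rule: generate.induct)
  case one
  have "(\<lambda>x. (u (x \<otimes> \<one>) - u x)\<^sup>2) summable_on carrier G \<longleftrightarrow> (\<lambda>x. 0 :: real) summable_on carrier G"
    by (rule summable_on_cong) simp
  then show ?case by simp
next
  case (incl s)
  then show ?case by (rule E)
next
  case (inv s)
  then have s: "s \<in> carrier G" using S by blast
  have "(\<lambda>x. (u (x \<otimes> inv s \<otimes> s) - u (x \<otimes> inv s))\<^sup>2) summable_on carrier G"
    using summable_on_reindex_bij_betw[OF bij_betw_right_mult[of "inv s"], of "\<lambda>x. (u (x \<otimes> s) - u x)\<^sup>2"] E[OF inv] s
    by simp
  moreover have "(u (x \<otimes> inv s \<otimes> s) - u (x \<otimes> inv s))\<^sup>2 = (u (x \<otimes> inv s) - u x)\<^sup>2" if "x \<in> carrier G"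
      for x
    using that s by (simp add: m_assoc power2_commute)
  ultimately show ?case
    using summable_on_cong[of "carrier G" "\<lambda>x. (u (x \<otimes> inv s \<otimes> s) - u (x \<otimes> inv s))\<^sup>2" "\<lambda>x. (u (x \<otimes> inv s) - u x)\<^sup>2"]
    by simp
next
  case (eng h1 h2)
  then have h: "h1 \<in> carrier G" "h2 \<in> carrier G"
    using generate_in_carrier[OF S] by auto
  have "(\<lambda>x. (u (x \<otimes> h1 \<otimes> h2) - u (x \<otimes> h1))\<^sup>2) summable_on carrier G"
    using summable_on_reindex_bij_betw[OF bij_betw_right_mult[OF h(1)], of "\<lambda>x. (u (x \<otimes> h2) - u x)\<^sup>2"] eng.IH(2)
    by simp
  then show ?case
  proof (rule summable_on_bounded_mult[OF summable_on_add[OF _ eng.IH(1)]])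
    fix x assume "x \<in> carrier G"
    then show "\<bar>(u (x \<otimes> (h1 \<otimes> h2)) - u x)\<^sup>2\<bar> \<le>
        2 * ((u (x \<otimes> h1 \<otimes> h2) - u (x \<otimes> h1))\<^sup>2 + (u (x \<otimes> h1) - u x)\<^sup>2)"
      using power2_diff_le[of "u (x \<otimes> h1 \<otimes> h2) - u (x \<otimes> h1)" "- (u (x \<otimes> h1) - u x)"] h
      power2_commute[of "u x" "u (x \<otimes> h1)"]
      by (simp add: m_assoc)
  qed
qed

text \<open>Summation by parts turns the total energy of \<open>v\<close> into the pairing of
  \<open>v\<close> with minus its Laplacian, which is \<open>0\<close>.\<close>

lemma square_summable_harmonic_constant:
  fixes v :: "'a \<Rightarrow> real"
  assumes S: "finite S" "S \<subseteq> carrier G" and v: "(\<lambda>x. (v x)\<^sup>2) summable_on carrier G"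
    and harm: "harmonic S v"
    and g: "g \<in> carrier G" "s \<in> S"
  shows "v (g \<otimes> s) = v g"
proof -
  define z where "z s x = v (x \<otimes> s) - v x" for s x
  have sh: "(\<lambda>x. (v (x \<otimes> t))\<^sup>2) summable_on carrier G" if "t \<in> carrier G" for t
    using summable_on_reindex_bij_betw[OF bij_betw_right_mult[OF that], of "\<lambda>x. (v x)\<^sup>2"] v by simp
  have z2: "(\<lambda>x. (z t x)\<^sup>2) summable_on carrier G" if "t \<in> carrier G" for t
    unfolding z_def using add_summable_of_squares[OF sh[OF that], of "\<lambda>x. - v x"] v by simp
  have z2': "(\<lambda>x. (z t (x \<otimes> inv t))\<^sup>2) summable_on carrier G" if "t \<in> carrier G" for t
    using summable_on_reindex_bij_betw[OF bij_betw_right_mult[of "inv t"], of "\<lambda>x. (z t x)\<^sup>2"]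
      z2[OF that] that by simp
  note prod = mult_summable_of_squares
  have part: "sqnorm (z t) = (\<Sum>\<^sub>\<infinity>x\<in>carrier G. v x * (z t (x \<otimes> inv t) - z t x))"
    if t: "t \<in> carrier G" for t
  proof -
    have "sqnorm (z t) = (\<Sum>\<^sub>\<infinity>x\<in>carrier G. v (x \<otimes> t) * z t x - v x * z t x)"
      by (simp add: z_def power2_eq_square left_diff_distrib)
    also have "\<dots> = (\<Sum>\<^sub>\<infinity>x\<in>carrier G. v (x \<otimes> t) * z t x) - (\<Sum>\<^sub>\<infinity>x\<in>carrier G. v x * z t x)"
      by (intro infsum_diff_real prod sh[OF t] z2[OF t] v)
    also have "(\<Sum>\<^sub>\<infinity>x\<in>carrier G. v (x \<otimes> t) * z t x) =
        (\<Sum>\<^sub>\<infinity>x\<in>carrier G. v (x \<otimes> t) * z t (x \<otimes> t \<otimes> inv t))"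
      using t by (intro infsum_cong) (simp add: m_assoc)
    also have "\<dots> = (\<Sum>\<^sub>\<infinity>x\<in>carrier G. v x * z t (x \<otimes> inv t))"
      by (rule infsum_reindex_bij_betw[OF bij_betw_right_mult[OF t], of "\<lambda>x. v x * z t (x \<otimes> inv t)"])
    also have "\<dots> - (\<Sum>\<^sub>\<infinity>x\<in>carrier G. v x * z t x) =
        (\<Sum>\<^sub>\<infinity>x\<in>carrier G. v x * z t (x \<otimes> inv t) - v x * z t x)"
      by (intro infsum_diff_real[symmetric] prod z2'[OF t] z2[OF t] v)
    finally show ?thesis by (simp add: right_diff_distrib)
  qed
  have SG: "t \<in> carrier G" if "t \<in> S" for t using that S by blast
  have "(\<Sum>t\<in>S. \<Sum>\<^sub>\<infinity>x\<in>carrier G. (z t x)\<^sup>2) = (\<Sum>t\<in>S. \<Sum>\<^sub>\<infinity>x\<in>carrier G. v x * (z t (x \<otimes> inv t) - z t x))"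
    by (intro sum.cong refl part SG)
  also have "\<dots> = (\<Sum>\<^sub>\<infinity>x\<in>carrier G. \<Sum>t\<in>S. v x * (z t (x \<otimes> inv t) - z t x))"
  proof (rule summable_on_finite_sum(2)[symmetric])
    fix t assume "t \<in> S"
    then show "(\<lambda>x. v x * (z t (x \<otimes> inv t) - z t x)) summable_on carrier G"
      using summable_on_diff_real[OF prod[OF v z2'[OF SG]] prod[OF v z2[OF SG]]]
        by (simp add: right_diff_distrib)
  qed
  also have "\<dots> = (\<Sum>\<^sub>\<infinity>x\<in>carrier G. 0)"
  proof (rule infsum_cong)
    fix x assume x: "x \<in> carrier G"
    have "(\<Sum>t\<in>S. z t (x \<otimes> inv t) - z t x) = - (\<Sum>t\<in>S. (v (x \<otimes> t) - v x) - (v x - v (x \<otimes> inv t)))"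
      unfolding sum_negf[symmetric] using x SG by (intro sum.cong refl) (simp add: z_def m_assoc)
    also have "\<dots> = 0"
      using harm x by (simp add: harmonic_def)
    finally show "(\<Sum>t\<in>S. v x * (z t (x \<otimes> inv t) - z t x)) = 0"
      by (simp add: sum_distrib_left[symmetric])
  qed
  finally have "(\<Sum>t\<in>S. \<Sum>\<^sub>\<infinity>x\<in>carrier G. (z t x)\<^sup>2) = 0" by simp
  then have "sqnorm (z s) = 0"
    using g(2) S(1) sum_nonneg_eq_0_iff[of S "\<lambda>t. \<Sum>\<^sub>\<infinity>x\<in>carrier G. (z t x)\<^sup>2"]
      by (simp add: infsum_nonneg)
  then have "(z s g)\<^sup>2 = 0"
    using nonneg_infsum_le_0D[of "\<lambda>x. (z s x)\<^sup>2" "carrier G" g] z2[OF SG[OF g(2)]] g(1) by simp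
  then show ?thesis by (simp add: z_def)
qed

text \<open>After subtraction of a constant the values on \<open>H t\<close> are increments along
  \<open>t\<close>, hence square-summable. This passes to \<open>t H\<close> by covering, where the
  spectral gap bounds the norm by the energy along \<open>a\<close> and \<open>b\<close>. The bound
  is uniform over finite unions of left cosets, so it holds on all of \<open>G\<close>.\<close>

lemma harmonic_constant_on_commensurated:
  fixes u :: "'a \<Rightarrow> real"
  assumes S: "finite S" "S \<subseteq> carrier G" "generate G S = carrier G" and H: "subgroup H G"
    and A: "A \<subseteq> S" "generate G A = H"
    and \<psi>: "\<psi> \<in> hom (G\<lparr>carrier := H\<rparr>) (free_group Y)"
      "a \<in> H" "b \<in> H" "\<psi> a = [(y1, True)]" "\<psi> b = [(y2, True)]" "y1 \<noteq> y2"
    and comm: "\<And>t. t \<in> carrier G \<Longrightarrow> \<exists>T. finite T \<and> T \<subseteq> carrier G \<and> t <# H \<subseteq> H <#> T"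
    and harm: "harmonic S u" and E: "(\<lambda>(g, s). (u (g \<otimes> s) - u g)\<^sup>2) summable_on carrier G \<times> S"
    and const: "\<And>h s. h \<in> H \<Longrightarrow> s \<in> A \<Longrightarrow> u (h \<otimes> s) = u h"
    and g: "g \<in> carrier G" "s \<in> S"
  shows "u (g \<otimes> s) = u g"
proof -
  interpret H: subgroup H G by fact
  have HG: "h \<in> carrier G" if "h \<in> H" for h using that H.subset by blast
  have AG: "A \<subseteq> carrier G" using A S by blast
  have "\<forall>x\<in>H. u (x \<otimes> h) = u x" if "h \<in> generate G A" for h
    using that
  proof (induction rule: generate.induct)
    case one
    then show ?case using HG by simp
  next
    case (incl h)
    then show ?case using const by blast
  next
    case (inv h)
    then have h: "h \<in> H" using A(2) generate.incl by fastforce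
    show ?case
    proof
      fix x assume x: "x \<in> H"
      then have "u (x \<otimes> inv h \<otimes> h) = u (x \<otimes> inv h)"
        using const[of "x \<otimes> inv h" h] inv h by simp
      then show "u (x \<otimes> inv h) = u x"
        using x h HG by (simp add: m_assoc)
    qed
  next
    case (eng h1 h2)
    then have h: "h1 \<in> H" "h2 \<in> H" using A(2) by auto
    show ?case
    proof
      fix x assume x: "x \<in> H"
      then have "u (x \<otimes> h1 \<otimes> h2) = u x"
        using eng.IH h by simp
      then show "u (x \<otimes> (h1 \<otimes> h2)) = u x"
        using x h HG by (simp add: m_assoc)
    qed
  qed
  then have uH: "u h = u \<one>" if "h \<in> H" for h
    using that A(2) H.one_closed HG by (metis l_one)
  define v where "v x = u x - u \<one>" for x
  have vH: "v h = 0" if "h \<in> H" for h using uH[OF that] by (simp add: v_def)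
  have Es: "(\<lambda>x. (u (x \<otimes> s) - u x)\<^sup>2) summable_on carrier G" if "s \<in> S" for s
  proof -
    have "(\<lambda>(g, s). (u (g \<otimes> s) - u g)\<^sup>2) summable_on (\<lambda>x. (x, s)) ` carrier G"
      by (rule summable_on_subset_banach[OF E]) (use that in auto)
    then show ?thesis
      by (subst (asm) summable_on_reindex) (auto simp: inj_on_def o_def)
  qed
  have Et: "(\<lambda>x. (v (x \<otimes> t) - v x)\<^sup>2) summable_on carrier G" if "t \<in> carrier G" for t
    using gradient_square_summable[OF S(2) Es] that S(3) by (simp add: v_def)
  have coset: "(\<lambda>x. (v x)\<^sup>2) summable_on H #> t" if t: "t \<in> carrier G" for t
  proof -
    have "(\<lambda>h. (v (h \<otimes> t) - v h)\<^sup>2) summable_on H"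
      by (rule summable_on_subset_banach[OF Et[OF t] H.subset])
    then have "(\<lambda>h. (v (h \<otimes> t))\<^sup>2) summable_on H"
      by (rule summable_on_cong[THEN iffD1, rotated]) (simp add: vH)
    moreover have "inj_on (\<lambda>h. h \<otimes> t) H"
      using t HG by (auto simp: inj_on_def)
    ultimately have "(\<lambda>x. (v x)\<^sup>2) summable_on (\<lambda>h. h \<otimes> t) ` H"
      by (subst summable_on_reindex) (auto simp: o_def)
    moreover have "H #> t = (\<lambda>h. h \<otimes> t) ` H"
      by (auto simp: r_coset_def)
    ultimately show ?thesis by simp
  qed
  have finite_union: "(\<lambda>x. (v x)\<^sup>2) summable_on (\<Union>i\<in>I. B i)"
    if "finite I" "\<And>i. i \<in> I \<Longrightarrow> (\<lambda>x. (v x)\<^sup>2) summable_on B i" for I :: "'a set" and B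
    using that
  proof (induction I rule: finite_induct)
    case (insert i I)
    then show ?case
      using summable_on_union[of "\<lambda>x. (v x)\<^sup>2" "B i" "\<Union>i\<in>I. B i"] by simp
  qed simp
  have lcoset: "(\<lambda>x. (v x)\<^sup>2) summable_on (t <# H)" if t: "t \<in> carrier G" for t
  proof -
    obtain T where "finite T" "T \<subseteq> carrier G" "t <# H \<subseteq> H <#> T"
      using comm[OF t] by blast
    then show ?thesis
      using finite_union[of T "\<lambda>r. H #> r"] coset summable_on_subset_banach
      unfolding set_mult_eq_UN_rcosets by blast
  qed
  define C where "C = 2 * (energy v a + energy v b)"
  have bound: "(\<Sum>x\<in>F. (v x)\<^sup>2) \<le> C" if F: "finite F" "F \<subseteq> carrier G" for F
  proof -
    \<comment> \<open>Right multiplication by \<open>H\<close> preserves this union of left cosets.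
      Cutting \<open>v\<close> off outside it therefore creates no increments along \<open>a\<close>
      or \<open>b\<close> across the boundary, and the bound \<open>C\<close> does not depend on
      \<open>F\<close>.\<close>
    define D where "D = (\<Union>x\<in>F. x <# H)"
    have D: "D \<subseteq> carrier G"
      using F(2) HG by (auto simp: D_def l_coset_def)
    have "x \<in> x <# H" if "x \<in> carrier G" for x
      using UN_I[OF H.one_closed, of x "\<lambda>h. {x \<otimes> h}"] that by (simp add: l_coset_def)
    then have FD: "F \<subseteq> D"
      using F(2) by (auto simp: D_def)
    have Dh: "x \<otimes> h \<in> D \<longleftrightarrow> x \<in> D" if x: "x \<in> carrier G" and h: "h \<in> H" for x h
    proof -
      have "x \<otimes> h \<in> y <# H \<longleftrightarrow> x \<in> y <# H" if y: "y \<in> carrier G" for y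
      proof
        assume "x \<otimes> h \<in> y <# H"
        then obtain k where k: "k \<in> H" "x \<otimes> h = y \<otimes> k" by (auto simp: l_coset_def)
        then have "x = y \<otimes> (k \<otimes> inv h)"
          using x y h HG inv_solve_right[of x "y \<otimes> k" h] by (simp add: m_assoc)
        then show "x \<in> y <# H" using k h by (auto simp: l_coset_def)
      next
        assume "x \<in> y <# H"
        then obtain k where k: "k \<in> H" "x = y \<otimes> k" by (auto simp: l_coset_def)
        then have "x \<otimes> h = y \<otimes> (k \<otimes> h)" using y h HG by (simp add: m_assoc)
        then show "x \<otimes> h \<in> y <# H" using k h by (auto simp: l_coset_def)
      qed
      then show ?thesis using F(2) by (auto simp: D_def)
    qed
    define f where "f x = (if x \<in> D then v x else 0)" for x
    have "(\<lambda>x. (v x)\<^sup>2) summable_on D"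
      unfolding D_def by (rule finite_union) (use F lcoset in auto)
    then have f2: "(\<lambda>x. (f x)\<^sup>2) summable_on carrier G"
      by (rule summable_on_cong_neutral[THEN iffD1, rotated -1]) (use D in \<open>auto simp: f_def\<close>)
    have grad: "energy f h \<le> energy v h" if h: "h \<in> H" for h
    proof (rule infsum_mono)
      show le: "(f (x \<otimes> h) - f x)\<^sup>2 \<le> (v (x \<otimes> h) - v x)\<^sup>2" if "x \<in> carrier G" for x
        using Dh[OF that h] by (simp add: f_def)
      show "(\<lambda>x. (v (x \<otimes> h) - v x)\<^sup>2) summable_on carrier G"
        by (rule Et[OF HG[OF h]])
      then show "(\<lambda>x. (f (x \<otimes> h) - f x)\<^sup>2) summable_on carrier G"
        by (rule summable_on_bounded_mult[where c = 1]) (use le in auto)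
    qed
    have "(\<Sum>x\<in>F. (v x)\<^sup>2) = (\<Sum>x\<in>F. (f x)\<^sup>2)"
      using FD by (intro sum.cong refl) (auto simp: f_def)
    also have "\<dots> \<le> sqnorm f"
      by (rule finite_sum_le_infsum[OF f2 F]) simp
    also have "\<dots> \<le> 2 * (energy f a + energy f b)"
      by (rule free_quotient_spectral_gap[OF H \<psi> f2])
    also have "\<dots> \<le> C"
      unfolding C_def using grad[OF \<psi>(2)] grad[OF \<psi>(3)] by simp
    finally show ?thesis .
  qed
  have "(\<lambda>x. (v x)\<^sup>2) summable_on carrier G"
    by (rule nonneg_bdd_above_summable_on) (use bound in \<open>auto intro!: bdd_aboveI2[where M = C]\<close>)
  moreover have "harmonic S v"
    using harm by (simp add: harmonic_def v_def)
  ultimately have "v (g \<otimes> s) = v g"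
    using square_summable_harmonic_constant[OF S(1,2)] g by blast
  then show ?thesis by (simp add: v_def)
qed


text \<open>Square-summability is asked of the gradient only, not of the potential \<open>u\<close>.
  For a finite generating set these vectors represent the reduced first
  \<open>l\<^sup>2\<close>-cohomology of the group.\<close>

definition dirichlet_space :: "'a set \<Rightarrow> ('a \<times> 'a) ell2 set" where
  "dirichlet_space S = {z. (\<forall>i. i \<notin> carrier G \<times> S \<longrightarrow> coord z i = 0) \<and>
     (\<exists>u. harmonic S u \<and> (\<forall>g\<in>carrier G. \<forall>s\<in>S. coord z (g, s) = u (g \<otimes> s) - u g))}"

lemma harmonic_add: "harmonic S u \<Longrightarrow> harmonic S v \<Longrightarrow> harmonic S (\<lambda>g. u g + v g)"
proof -
  assume uv: "harmonic S u" "harmonic S v"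
  have "(\<Sum>s\<in>S. u (g \<otimes> s) + v (g \<otimes> s) - (u g + v g) - (u g + v g - (u (g \<otimes> inv s) +
      v (g \<otimes> inv s)))) =
      laplacian S u g + laplacian S v g" for g
    unfolding sum.distrib[symmetric] by (intro sum.cong refl) simp
  then show "harmonic S (\<lambda>g. u g + v g)"
    using uv by (simp add: harmonic_def)
qed

lemma harmonic_scale: "harmonic S u \<Longrightarrow> harmonic S (\<lambda>g. c * u g)"
proof -
  assume u: "harmonic S u"
  have "(\<Sum>s\<in>S. c * u (g \<otimes> s) - c * u g - (c * u g - c * u (g \<otimes> inv s))) =
      c * laplacian S u g" for g
    unfolding sum_distrib_left by (intro sum.cong refl) (simp add: algebra_simps)
  then show "harmonic S (\<lambda>g. c * u g)"
    using u by (simp add: harmonic_def)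
qed

lemma subspace_dirichlet_space: "subspace (dirichlet_space S)"
proof (rule subspaceI)
  show "0 \<in> dirichlet_space S"
    by (auto simp: dirichlet_space_def harmonic_def intro!: exI[of _ "\<lambda>_. 0"])
next
  fix z w assume "z \<in> dirichlet_space S" "w \<in> dirichlet_space S"
  then obtain u v where uv: "harmonic S u" "harmonic S v"
    "\<forall>g\<in>carrier G. \<forall>s\<in>S. coord z (g, s) = u (g \<otimes> s) - u g"
      "\<forall>g\<in>carrier G. \<forall>s\<in>S. coord w (g, s) = v (g \<otimes> s) - v g"
    and 0: "\<forall>i. i \<notin> carrier G \<times> S \<longrightarrow> coord z i = 0" "\<forall>i. i \<notin> carrier G \<times> S \<longrightarrow> coord w i = 0"
    unfolding dirichlet_space_def by blast
  show "z + w \<in> dirichlet_space S"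
    unfolding dirichlet_space_def using 0 uv harmonic_add[OF uv(1,2)]
    by (intro CollectI conjI exI[of _ "\<lambda>g. u g + v g"]) auto
next
  fix c z assume "z \<in> dirichlet_space S"
  then obtain u where u: "harmonic S u" "\<forall>g\<in>carrier G. \<forall>s\<in>S. coord z (g, s) = u (g \<otimes> s) - u g"
    and 0: "\<forall>i. i \<notin> carrier G \<times> S \<longrightarrow> coord z i = 0"
    unfolding dirichlet_space_def by blast
  show "c *\<^sub>R z \<in> dirichlet_space S"
    unfolding dirichlet_space_def using 0 u harmonic_scale[OF u(1)]
    by (intro CollectI conjI exI[of _ "\<lambda>g. c * u g"]) (auto simp: right_diff_distrib)
qed

text \<open>Convergence of the gradients gives convergence of the increments along every word, so
  the potentials normalized at \<open>\<one>\<close> converge pointwise; differences and the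
  Laplacian pass to that limit.\<close>

lemma closed_dirichlet_space:
  assumes S: "S \<subseteq> carrier G" "generate G S = carrier G"
  shows "closed (dirichlet_space S)"
  unfolding closed_sequential_limits
proof (intro allI impI, elim conjE)
  fix z l assume z: "\<forall>n. z n \<in> dirichlet_space S" and lim: "z \<longlonglongrightarrow> l"
  have c: "(\<lambda>n. coord (z n) i) \<longlonglongrightarrow> coord l i" for i
    unfolding inner_unit_vector[symmetric] by (intro tendsto_intros lim)
  have "\<forall>n. \<exists>u. harmonic S u \<and> (\<forall>g\<in>carrier G. \<forall>s\<in>S. coord (z n) (g, s) = u (g \<otimes> s) - u g)"
    using z unfolding dirichlet_space_def by blast
  then obtain u where u: "\<And>n. harmonic S (u n)"
      "\<And>n g s. g \<in> carrier G \<Longrightarrow> s \<in> S \<Longrightarrow> coord (z n) (g, s) = u n (g \<otimes> s) - u n g"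
    using choice[of "\<lambda>n u. harmonic S u \<and> (\<forall>g\<in>carrier G. \<forall>s\<in>S. coord (z n) (g, s) =
      u (g \<otimes> s) - u g)"] by blast
  have conv: "\<forall>x\<in>carrier G. convergent (\<lambda>n. u n (x \<otimes> g) - u n x)" if "g \<in> generate G S" for g
    using that
  proof (induction rule: generate.induct)
    case one
    then show ?case by (simp add: convergent_const)
  next
    case (incl s)
    then have "(\<lambda>n. u n (x \<otimes> s) - u n x) \<longlonglongrightarrow> coord l (x, s)" if "x \<in> carrier G" for x
      using c[of "(x, s)"] u(2)[OF that] by simp
    then show ?case by (auto simp: convergent_def)
  next
    case (inv s)
    show ?case
    proof
      fix x assume x: "x \<in> carrier G"
      have s: "s \<in> carrier G" using inv S by blast
      have "(\<lambda>n. - coord (z n) (x \<otimes> inv s, s)) \<longlonglongrightarrow> - coord l (x \<otimes> inv s, s)"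
        by (intro tendsto_intros c)
      moreover have "- coord (z n) (x \<otimes> inv s, s) = u n (x \<otimes> inv s) - u n x" for n
        using u(2)[of "x \<otimes> inv s" s n] x s inv by (simp add: m_assoc)
      ultimately show "convergent (\<lambda>n. u n (x \<otimes> inv s) - u n x)"
        by (auto simp: convergent_def)
    qed
  next
    case (eng h1 h2)
    then have h: "h1 \<in> carrier G" "h2 \<in> carrier G" using S by auto
    show ?case
    proof
      fix x assume x: "x \<in> carrier G"
      have "convergent (\<lambda>n. (u n (x \<otimes> h1 \<otimes> h2) - u n (x \<otimes> h1)) + (u n (x \<otimes> h1) - u n x))"
        using eng.IH x h by (intro convergent_add) auto
      then show "convergent (\<lambda>n. u n (x \<otimes> (h1 \<otimes> h2)) - u n x)"
        using x h by (simp add: m_assoc)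
    qed
  qed
  define w where "w g = lim (\<lambda>n. u n g - u n \<one>)" for g
  have w: "(\<lambda>n. u n g - u n \<one>) \<longlonglongrightarrow> w g" if "g \<in> carrier G" for g
    using bspec[OF conv[of g] one_closed] that S(2) unfolding w_def
      by (simp add: convergent_LIMSEQ_iff)
  have "coord l (g, s) = w (g \<otimes> s) - w g" if "g \<in> carrier G" "s \<in> S" for g s
  proof (rule LIMSEQ_unique[OF c])
    have "(\<lambda>n. (u n (g \<otimes> s) - u n \<one>) - (u n g - u n \<one>)) \<longlonglongrightarrow> w (g \<otimes> s) - w g"
      by (intro tendsto_diff w) (use that S in auto)
    then show "(\<lambda>n. coord (z n) (g, s)) \<longlonglongrightarrow> w (g \<otimes> s) - w g"
      using u(2)[OF that] by simp
  qed
  moreover have "harmonic S w"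
    unfolding harmonic_def
  proof
    fix g assume g: "g \<in> carrier G"
    have "(\<lambda>n. \<Sum>s\<in>S. ((u n (g \<otimes> s) - u n \<one>) - (u n g - u n \<one>)) - ((u n g - u n \<one>) - (u n (g \<otimes> inv s) - u n \<one>)))
        \<longlonglongrightarrow> laplacian S w g"
      by (intro tendsto_sum tendsto_diff w) (use g S in auto)
    moreover have
        "(\<Sum>s\<in>S. ((u n (g \<otimes> s) - u n \<one>) - (u n g - u n \<one>)) - ((u n g - u n \<one>) - (u n (g \<otimes> inv s) - u n \<one>))) = 0" for n
      using u(1)[of n] g by (simp add: harmonic_def)
    ultimately show "laplacian S w g = 0"
      using LIMSEQ_unique[OF _ tendsto_const] by simp
  qed
  moreover have "coord l i = 0" if "i \<notin> carrier G \<times> S" for i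
  proof -
    have "coord (z n) i = 0" for n
      using z that unfolding dirichlet_space_def by blast
    then show ?thesis
      using LIMSEQ_unique[OF c[of i], of 0] by simp
  qed
  ultimately show "l \<in> dirichlet_space S"
    unfolding dirichlet_space_def by blast
qed

text \<open>Outside the group it is the identity, which makes it a bijection of the whole index
  type.\<close>

definition translate :: "'a \<Rightarrow> 'a \<times> 'a \<Rightarrow> 'a \<times> 'a" where
  "translate h = (\<lambda>(g, s). (if g \<in> carrier G then h \<otimes> g else g, s))"

lemma translate_inverse:
  assumes "h \<in> carrier G"
  shows "bij (translate h)" "inv_into UNIV (translate h) = translate (inv h)"
proof -
  have 1: "translate h (translate (inv h) i) = i" "translate (inv h) (translate h i) = i" for i
    using assms by (auto simp: translate_def m_assoc[symmetric] split: prod.splits if_splits)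
  then show "bij (translate h)"
    by (metis bijI' )
  show "inv_into UNIV (translate h) = translate (inv h)"
    by (rule inv_unique_comp) (auto simp: fun_eq_iff 1)
qed

lemma reindex_translate_dirichlet_space:
  assumes h: "h \<in> carrier G" and S: "S \<subseteq> carrier G" and z: "z \<in> dirichlet_space S"
  shows "reindex (translate h) z \<in> dirichlet_space S"
proof -
  obtain u where u: "harmonic S u" "\<forall>g\<in>carrier G. \<forall>s\<in>S. coord z (g, s) = u (g \<otimes> s) - u g"
    and 0: "\<forall>i. i \<notin> carrier G \<times> S \<longrightarrow> coord z i = 0"
    using z unfolding dirichlet_space_def by blast
  note c = coord_reindex[OF translate_inverse(1)[OF h], of z]
  have "harmonic S (\<lambda>g. u (h \<otimes> g))"
    unfolding harmonic_def
  proof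
    fix g assume g: "g \<in> carrier G"
    have "(\<Sum>s\<in>S. u (h \<otimes> (g \<otimes> s)) - u (h \<otimes> g) - (u (h \<otimes> g) - u (h \<otimes> (g \<otimes> inv s)))) =
        (\<Sum>s\<in>S. u (h \<otimes> g \<otimes> s) - u (h \<otimes> g) - (u (h \<otimes> g) - u (h \<otimes> g \<otimes> inv s)))"
      using g h S by (intro sum.cong refl) (auto simp: m_assoc subset_iff)
    then show "(\<Sum>s\<in>S. u (h \<otimes> (g \<otimes> s)) - u (h \<otimes> g) - (u (h \<otimes> g) - u (h \<otimes> (g \<otimes> inv s)))) = 0"
      using u(1) g h by (simp add: harmonic_def)
  qed
  moreover have "coord (reindex (translate h) z) (g, s) = u (h \<otimes> (g \<otimes> s)) - u (h \<otimes> g)"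
      if "g \<in> carrier G" "s \<in> S" for g s
  proof -
    have "coord (reindex (translate h) z) (g, s) = coord z (h \<otimes> g, s)"
      unfolding c using that by (simp add: translate_def)
    moreover have "s \<in> carrier G" using that S by blast
    ultimately show ?thesis
      using u(2) that h by (simp add: m_assoc)
  qed
  moreover have "coord (reindex (translate h) z) i = 0" if "i \<notin> carrier G \<times> S" for i
    unfolding c using that 0 h by (cases i) (auto simp: translate_def)
  ultimately show ?thesis
    unfolding dirichlet_space_def by (intro CollectI conjI exI[of _ "\<lambda>g. u (h \<otimes> g)"]) auto
qed

text \<open>For infinite index the trace over all representatives would be infinite, so it is tested
  on a finite set \<open>J\<close> of them. Their diagonal entries agree because left translation by
  all of \<open>G\<close> preserves the space of gradients, and enough of them exceed the bound
  \<open>card A\<close>.\<close>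

theorem frf_commensurated_finite_index:
  assumes frf: "fully_residually_free G"
    and G: "finite S0" "S0 \<subseteq> carrier G" "generate G S0 = carrier G"
    and H: "subgroup H G" and A: "finite A" "A \<subseteq> H" "generate G A = H"
    and pq: "p \<in> H" "q \<in> H" "p \<otimes> q \<noteq> q \<otimes> p"
    and comm: "\<And>t. t \<in> carrier G \<Longrightarrow> \<exists>T. finite T \<and> T \<subseteq> carrier G \<and> t <# H \<subseteq> H <#> T"
  shows "finite (rcosets H)"
proof (rule ccontr)
  assume inf: "infinite (rcosets H)"
  interpret H: subgroup H G by fact
  have HG: "h \<in> carrier G" if "h \<in> H" for h using that H.subset by blast
  let ?H = "G\<lparr>carrier := H\<rparr>"
  interpret HH: group ?H using subgroup_imp_group[OF H] .
  have pqH: "p \<in> carrier ?H" "q \<in> carrier ?H" "p \<otimes>\<^bsub>?H\<^esub> q \<noteq> q \<otimes>\<^bsub>?H\<^esub> p"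
    using pq by simp_all
  \<comment> \<open>No elements have to be separated here; the aim is a pair of free generators in
    the image of \<open>H\<close> for the spectral gap.\<close>
  obtain Y :: "((nat \<times> bool) list set \<times> nat) set" and \<psi> y1 y2
    where \<psi>: "\<psi> \<in> hom ?H (free_group Y)" "\<psi> ` carrier ?H = carrier (free_group Y)"
      and y: "y1 \<in> Y" "y2 \<in> Y" "y1 \<noteq> y2"
    by (rule HH.frf_free_quotient[OF fully_residually_free_subgroup[OF frf H] finite.emptyI empty_subsetI pqH])
  then have "\<psi> ` H = carrier (free_group Y)" by simp
  note \<psi> = \<psi>(1) this
  have "[(y1, True)] \<in> \<psi> ` H" "[(y2, True)] \<in> \<psi> ` H"
    unfolding \<psi>(2) using y by (simp_all add: letter_in_free_group)
  then obtain a b where ab: "a \<in> H" "b \<in> H" "\<psi> a = [(y1, True)]" "\<psi> b = [(y2, True)]"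
    by (metis imageE)
  \<comment> \<open>The generators of \<open>H\<close> are added so that the edges of
    \<open>H\<close> are edges of the Cayley graph of \<open>G\<close>.\<close>
  define S where "S = S0 \<union> A"
  have S: "finite S" "S \<subseteq> carrier G"
    using G A HG by (auto simp: S_def)
  have genS: "generate G S = carrier G"
    using mono_generate[of S0 S] G(3) generate_incl[OF S(2)] by (auto simp: S_def)
  have AS: "A \<subseteq> S" by (simp add: S_def)
  obtain u0 where u0: "harmonic S u0" "(\<lambda>(g, s). (u0 (g \<otimes> s) - u0 g)\<^sup>2) summable_on carrier G \<times> S"
    "\<exists>s\<in>S. u0 s \<noteq> u0 \<one>"
    using harmonic_of_finite_energy_exists[OF frf S genS HG[OF pq(1)] HG[OF pq(2)] pq(3)] by blast
  define V where "V = dirichlet_space S"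
  have V: "subspace V" "closed V"
    unfolding V_def using subspace_dirichlet_space closed_dirichlet_space[OF S(2) genS] by auto
  have "\<forall>x. \<exists>p. p \<in> V \<and> (\<forall>v\<in>V. inner p v = inner x v)"
    using orthogonal_projection_exists[OF V] by blast
  from choice[OF this] obtain P where P: "\<And>x. P x \<in> V" "\<And>x v. v \<in> V \<Longrightarrow> inner (P x) v = inner x v"
    by blast
  let ?U = "H \<times> A"
  interpret projection_pair V ?U P
  proof
    fix z assume z: "z \<in> V" and zU: "\<And>i. i \<in> ?U \<Longrightarrow> coord z i = 0"
    obtain u where u: "harmonic S u" "\<forall>g\<in>carrier G. \<forall>s\<in>S. coord z (g, s) = u (g \<otimes> s) - u g"
      and 0: "\<forall>i. i \<notin> carrier G \<times> S \<longrightarrow> coord z i = 0"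
      using z unfolding V_def dirichlet_space_def by blast
    have "(\<lambda>(g, s). (u (g \<otimes> s) - u g)\<^sup>2) summable_on carrier G \<times> S"
      using coord_summable[of z "carrier G \<times> S"]
      by (rule summable_on_cong[THEN iffD1, rotated]) (use u(2) in auto)
    moreover have "u (h \<otimes> s) = u h" if "h \<in> H" "s \<in> A" for h s
    proof -
      have "coord z (h, s) = u (h \<otimes> s) - u h"
        using u(2) HG[OF that(1)] that(2) AS by blast
      then show ?thesis using zU[of "(h, s)"] that by simp
    qed
    ultimately have const: "u (g \<otimes> s) = u g" if "g \<in> carrier G" "s \<in> S" for g s
      using harmonic_constant_on_commensurated[OF S genS H AS A(3) \<psi>(1) ab y(3) comm u(1)] that
        by blast
    show "z = 0"
    proof (rule ell2_eqI)
      fix i show "coord z i = coord 0 i"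
        using u(2) 0 const by (cases i; cases "i \<in> carrier G \<times> S") auto
    qed
  qed (use P V in auto)
  have trans: "reindex (translate h) v \<in> V" "reindex (inv_into UNIV (translate h)) v \<in> V"
    if "h \<in> carrier G" "v \<in> V" for h v
    using reindex_translate_dirichlet_space[OF _ S(2)] that translate_inverse(2)[OF that(1)]
      by (auto simp: V_def)
  obtain s0 where s0: "s0 \<in> S" "u0 s0 \<noteq> u0 \<one>" using u0(3) by blast
  define \<tau> where "\<tau> = (norm (P (unit_vector (\<one>, s0))))\<^sup>2"
  \<comment> \<open>If the projection killed this unit vector, every element of \<open>V\<close>
    would vanish on the edge \<open>(\<one>, s0)\<close>, which the gradient of \<open>u0\<close>
    does not.\<close>
  have "P (unit_vector (\<one>, s0)) \<noteq> 0"
  proof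
    assume P0: "P (unit_vector (\<one>, s0)) = 0"
    define f where "f = (\<lambda>i. if i \<in> carrier G \<times> S then u0 (fst i \<otimes> snd i) - u0 (fst i) else 0)"
    have "(\<lambda>i. (f i)\<^sup>2) summable_on UNIV"
      by (rule summable_on_cong_neutral[THEN iffD1, OF _ _ _ u0(2)]) (auto simp: f_def)
    then have cf: "coord (Abs_ell2 f) = f" by (simp add: Abs_ell2_inverse)
    have "Abs_ell2 f \<in> V"
      unfolding V_def dirichlet_space_def mem_Collect_eq cf
      by (intro conjI exI[of _ u0]) (use u0(1) in \<open>auto simp: f_def\<close>)
    then have "inner (unit_vector (\<one>, s0)) (Abs_ell2 f) = 0"
      using P(2)[of "Abs_ell2 f" "unit_vector (\<one>, s0)"] P0 by simp
    then have "f (\<one>, s0) = 0"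
      using inner_unit_vector[of "Abs_ell2 f" "(\<one>, s0)"] by (simp add: cf inner_commute)
    then show False using s0 S(2) by (auto simp: f_def)
  qed
  then have \<tau>: "\<tau> > 0" by (simp add: \<tau>_def)
  have norm: "(norm (P (unit_vector (g, s0))))\<^sup>2 = \<tau>" if "g \<in> carrier G" for g
    using norm_P_invariant[OF translate_inverse(1)[OF that] trans[OF that] V(1), of "(\<one>, s0)"] that
    by (simp add: \<tau>_def translate_def)
  have rep: "\<exists>r. \<forall>C\<in>rcosets H. r C \<in> C"
  proof (rule bchoice, rule ballI)
    fix C assume "C \<in> rcosets H"
    then show "\<exists>x. x \<in> C" using rcos_self[OF _ H] by (auto simp: RCOSETS_def)
  qed
  then obtain r where r: "\<And>C. C \<in> rcosets H \<Longrightarrow> r C \<in> C" by blast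
  define R where "R = r ` (rcosets H)"
  have rC: "H #> r C = C" "r C \<in> carrier G" if C: "C \<in> rcosets H" for C
  proof -
    obtain x where "x \<in> carrier G" "C = H #> x" using C by (auto simp: RCOSETS_def)
    then show "H #> r C = C" "r C \<in> carrier G"
      using r[OF C] repr_independence[OF _ _ H] r_coset_subset_G[OF H.subset] by blast+
  qed
  have "inj_on r (rcosets H)"
    by (rule inj_onI) (metis rC(1))
  then have "infinite R" using inf by (simp add: R_def finite_image_iff)
  obtain n :: nat where n: "real (card A) < real n * \<tau>"
    using reals_Archimedean3[OF \<tau>] by blast
  obtain J where J: "finite J" "card J = n" "J \<subseteq> R"
    using infinite_arbitrarily_large[OF \<open>infinite R\<close>, of n] by blast
  have RG: "R \<subseteq> carrier G" using rC by (auto simp: R_def)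
  have "(\<Sum>i\<in>J \<times> {s0}. (norm (P (unit_vector i)))\<^sup>2) \<le> card ({\<one>} \<times> A)"
  proof (rule trace_bound[OF V(1), where \<tau> = translate and H = H and R = "R \<times> S" and Z = "carrier G \<times> S"])
    fix h assume h: "h \<in> H"
    show "invariant (translate h)"
      unfolding invariant_def
    proof (intro conjI allI ballI)
      fix i show "translate h i \<in> ?U \<longleftrightarrow> i \<in> ?U"
      proof (cases i)
        case (Pair g s)
        have "h \<otimes> g \<in> H \<longleftrightarrow> g \<in> H" if "g \<in> carrier G"
        proof
          assume "h \<otimes> g \<in> H"
          then have "inv h \<otimes> (h \<otimes> g) \<in> H" using h by simp
          then show "g \<in> H" using h HG that by (simp add: m_assoc[symmetric])
        qed (use h in simp)
        then show ?thesis using Pair HG by (auto simp: translate_def)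
      qed
    qed (use trans HG[OF h] translate_inverse(1) in auto)
  next
    show "finite ({\<one>} \<times> A)" "{\<one>} \<times> A \<subseteq> ?U" using A(1) by auto
    show "bij_betw (\<lambda>(h, u). translate h u) (H \<times> ({\<one>} \<times> A)) ?U"
      by (rule bij_betw_byWitness[where f' = "\<lambda>(h, s). (h, \<one>, s)"])
        (use HG in \<open>auto simp: translate_def\<close>)
    show "coord z i = 0" if "z \<in> V" "i \<notin> carrier G \<times> S" for z i
      using that unfolding V_def dirichlet_space_def by blast
    show "finite (J \<times> {s0})" "J \<times> {s0} \<subseteq> R \<times> S" using J s0 by auto
    have tr: "inv_into UNIV (translate h) (g, s) = (inv h \<otimes> g, s)" if "h \<in> H" "g \<in> R" for h g s
      using translate_inverse(2)[OF HG[OF that(1)]] that(2) RG by (auto simp: translate_def)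
    \<comment> \<open>Every \<open>g\<close> is uniquely \<open>inv h\<close> times an element of
      \<open>R\<close>: the factor in \<open>R\<close> represents the right coset of
      \<open>g\<close>, and \<open>h\<close> is that factor times \<open>inv g\<close>.\<close>
    show "bij_betw (\<lambda>(r, h). inv_into UNIV (translate h) r) ((R \<times> S) \<times> H) (carrier G \<times> S)"
    proof (rule bij_betw_byWitness[where f' = "\<lambda>(g, s). ((r (H #> g), s), r (H #> g) \<otimes> inv g)"])
      have R: "r (H #> (inv h \<otimes> g)) = g" if h: "h \<in> H" and g: "g \<in> R" for h g
      proof -
        obtain C where C: "C \<in> rcosets H" "g = r C" using g by (auto simp: R_def)
        have "H #> (inv h \<otimes> g) = (H #> inv h) #> g"
          using coset_mult_assoc[OF H.subset, of "inv h" g] h g RG HG by auto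
        also have "\<dots> = C"
          using coset_join2[OF _ H, of "inv h"] h HG rC(1)[OF C(1)] C(2) by simp
        finally show ?thesis using C(2) by simp
      qed
      have Q: "r (H #> g) \<in> R" "r (H #> g) \<otimes> inv g \<in> H" if g: "g \<in> carrier G" for g
      proof -
        have C: "H #> g \<in> rcosets H" using rcosetsI[OF H.subset g] .
        then show "r (H #> g) \<in> R" by (simp add: R_def)
        obtain h where "h \<in> H" "r (H #> g) = h \<otimes> g"
          using r[OF C] by (auto simp: r_coset_def)
        then show "r (H #> g) \<otimes> inv g \<in> H" using g HG by (simp add: m_assoc)
      qed
      have RG': "g \<in> carrier G" if "g \<in> R" for g using that RG by blast
      show "\<forall>x\<in>(R \<times> S) \<times> H. (case case x of (r, h) \<Rightarrow> inv_into UNIV (translate h) r of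
          (g, s) \<Rightarrow> ((r (H #> g), s), r (H #> g) \<otimes> inv g)) = x"
        using R RG' HG by (auto simp: tr inv_mult_group m_assoc[symmetric])
      show "\<forall>x\<in>carrier G \<times> S. (case case x of (g, s) \<Rightarrow> ((r (H #> g), s), r (H #> g) \<otimes> inv g) of
          (r, h) \<Rightarrow> inv_into UNIV (translate h) r) = x"
        using Q RG' HG by (auto simp: tr inv_mult_group m_assoc)
      show "(\<lambda>(r, h). inv_into UNIV (translate h) r) ` ((R \<times> S) \<times> H) \<subseteq> carrier G \<times> S"
        using RG' HG by (auto simp: tr)
      show "(\<lambda>(g, s). ((r (H #> g), s), r (H #> g) \<otimes> inv g)) ` (carrier G \<times> S) \<subseteq> (R \<times> S) \<times> H"
        using Q by auto
    qed
  qed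
  moreover have "(\<Sum>i\<in>J \<times> {s0}. (norm (P (unit_vector i)))\<^sup>2) = (\<Sum>i\<in>J \<times> {s0}. \<tau>)"
    using norm J(3) RG by (intro sum.cong refl) auto
  ultimately show False
    using n J(2) by (simp add: card_cartesian_product)
qed


section \<open>Coset covers and the two cases of the theorem\<close>

lemma finite_rcosets_imp_cover:
  assumes K: "subgroup K G" and H: "subgroup H G" "H \<subseteq> K"
    and fin: "finite (rcosets\<^bsub>G\<lparr>carrier := K\<rparr>\<^esub> H)"
  obtains T where "finite T" "T \<subseteq> K" "K \<subseteq> H <#> T"
proof -
  have eq: "rcosets\<^bsub>G\<lparr>carrier := K\<rparr>\<^esub> H = (\<lambda>x. H #> x) ` K"
    by (auto simp: RCOSETS_def r_coset_def)
  then obtain T where T: "T \<subseteq> K" "finite T" "(\<lambda>x. H #> x) ` K = (\<lambda>x. H #> x) ` T"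
    using finite_subset_image[OF fin[unfolded eq], of "\<lambda>x. H #> x" K] by auto
  have "g \<in> H <#> T" if g: "g \<in> K" for g
  proof -
    have "g \<in> H #> g"
      using rcos_self[OF _ H(1)] g subgroup.subset[OF K] by blast
    then show ?thesis using T(3) g unfolding set_mult_eq_UN_rcosets by blast
  qed
  then have "K \<subseteq> H <#> T" by (rule subsetI)
  then show ?thesis by (rule that[OF T(2,1)])
qed

lemma cover_imp_finite_rcosets:
  assumes H: "subgroup H G" and T: "finite T" "T \<subseteq> carrier G" "carrier G \<subseteq> H <#> T"
  shows "finite (rcosets H)"
proof (rule finite_subset)
  show "rcosets H \<subseteq> (\<lambda>r. H #> r) ` T"
  proof
    fix C assume "C \<in> rcosets H"
    then obtain g where g: "g \<in> carrier G" "C = H #> g" by (auto simp: RCOSETS_def)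
    then obtain r where r: "r \<in> T" "g \<in> H #> r"
      using T(3) unfolding set_mult_eq_UN_rcosets by blast
    then have "C = H #> r"
      using repr_independence[OF r(2) _ H] T(2) g(2) by blast
    then show "C \<in> (\<lambda>r. H #> r) ` T" using r(1) by blast
  qed
qed (use T in simp)

text \<open>By the pigeonhole principle two powers of \<open>g\<close> lie in the same coset of
  \<open>H\<close>.\<close>

lemma power_in_of_finite_rcosets:
  assumes K: "subgroup K G" and H: "subgroup H G" "H \<subseteq> K"
    and fin: "finite (rcosets\<^bsub>G\<lparr>carrier := K\<rparr>\<^esub> H)" and g: "g \<in> K"
  obtains n :: nat where "n > 0" "g [^] n \<in> H"
proof -
  have gG: "g \<in> carrier G" using g subgroup.subset[OF K] by blast
  have pow: "g [^] n \<in> K" for n :: nat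
    using g K by (induction n) (auto simp: subgroup.one_closed subgroup.m_closed)
  have "(\<lambda>n :: nat. H #> (g [^] n)) ` UNIV \<subseteq> rcosets\<^bsub>G\<lparr>carrier := K\<rparr>\<^esub> H"
    using pow by (auto simp: RCOSETS_def r_coset_def)
  then have "finite ((\<lambda>n :: nat. H #> (g [^] n)) ` UNIV)"
    using fin finite_subset by blast
  then obtain m n :: nat where mn: "m < n" "H #> (g [^] m) = H #> (g [^] n)"
    using finite_imageD[of "\<lambda>n :: nat. H #> (g [^] n)" UNIV] infinite_UNIV_nat unfolding inj_on_def
    by (metis linorder_neqE_nat)
  have "g [^] n \<in> H #> (g [^] m)"
    unfolding mn(2) using rcos_self[OF _ H(1)] gG by simp
  then obtain h where h: "h \<in> H" "g [^] n = h \<otimes> g [^] m" by (auto simp: r_coset_def)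
  have "g [^] (n - m) \<otimes> g [^] m = h \<otimes> g [^] m"
    using h(2) mn(1) gG nat_pow_mult[OF gG, of "n - m" m] by simp
  then have "g [^] (n - m) = h"
    using r_cancel[of "g [^] m" "g [^] (n - m)" h] gG subgroup.mem_carrier[OF H(1) h(1)] by simp
  then show ?thesis using that[of "n - m"] h(1) mn(1) by simp
qed

text \<open>If \<open>H\<close> is commutative, torsion-freeness and commutative transitivity make
  all of \<open>G1 \<union> G2\<close> commute, and products of coset representatives cover
  \<open>G\<close>. Otherwise the finite sets \<open>T\<close> with
  \<open>t <# H \<subseteq> H <#> T\<close> extend from \<open>G1\<close> and \<open>G2\<close> to
  products, and the harmonic argument applies.\<close>

theorem frf_finite_index_join:
  assumes frf: "fully_residually_free G" and gen: "generate G (G1 \<union> G2) = carrier G"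
    and G1: "subgroup G1 G" "finitely_generated (G\<lparr>carrier := G1\<rparr>)"
    and G2: "subgroup G2 G" "finitely_generated (G\<lparr>carrier := G2\<rparr>)"
    and H: "subgroup H G" "H \<subseteq> G1 \<inter> G2" "finitely_generated (G\<lparr>carrier := H\<rparr>)"
    and fin: "finite (rcosets\<^bsub>G\<lparr>carrier := G1\<rparr>\<^esub> H)" "finite (rcosets\<^bsub>G\<lparr>carrier := G2\<rparr>\<^esub> H)"
  shows "finite (rcosets H)"
proof -
  interpret H: subgroup H G by fact
  have HG: "h \<in> carrier G" if "h \<in> H" for h using that H.subset by blast
  have sub: "G1 \<subseteq> carrier G" "G2 \<subseteq> carrier G"
    using subgroup.subset[OF G1(1)] subgroup.subset[OF G2(1)] .
  obtain T1 where T1: "finite T1" "T1 \<subseteq> G1" "G1 \<subseteq> H <#> T1"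
    using finite_rcosets_imp_cover[OF G1(1) H(1) _ fin(1)] H(2) by blast
  obtain T2 where T2: "finite T2" "T2 \<subseteq> G2" "G2 \<subseteq> H <#> T2"
    using finite_rcosets_imp_cover[OF G2(1) H(1) _ fin(2)] H(2) by blast
  show ?thesis
  proof (cases "\<forall>p\<in>H. \<forall>q\<in>H. p \<otimes> q = q \<otimes> p")
    case True
    have pow: "\<exists>n :: nat. n > 0 \<and> g [^] n \<in> H" if "g \<in> G1 \<union> G2" for g
    proof (cases "g \<in> G1")
      case True
      show ?thesis
        by (rule power_in_of_finite_rcosets[OF G1(1) H(1) _ fin(1) True]) (use H(2) in auto)
    next
      case False
      then have "g \<in> G2" using that by blast
      then show ?thesis
        by (rule power_in_of_finite_rcosets[OF G2(1) H(1) _ fin(2), rotated]) (use H(2) in auto)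
    qed
    have comm: "x \<otimes> y = y \<otimes> x" if xy: "x \<in> G1 \<union> G2" "y \<in> G1 \<union> G2" for x y
    proof (cases "H = {\<one>}")
      case True
      \<comment> \<open>With \<open>H\<close> trivial, every element of \<open>G1\<close> and
        \<open>G2\<close> has finite order.\<close>
      have "g = \<one>" if "g \<in> G1 \<union> G2" for g
        using pow[OF that] frf_torsion_free[OF frf, of g] True that sub by blast
      then have "x = \<one>" "y = \<one>" using xy by blast+
      then show ?thesis by simp
    next
      case False
      then obtain h where h: "h \<in> H" "h \<noteq> \<one>" using H.one_closed by blast
      have "h \<otimes> g = g \<otimes> h" if g: "g \<in> G1 \<union> G2" for g
      proof (cases "g = \<one>")
        case False
        obtain n :: nat where n: "n > 0" "g [^] n \<in> H" using pow[OF g] by blast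
        have gG: "g \<in> carrier G" using g sub by blast
        \<comment> \<open>Transitivity goes through \<open>g [^] n\<close>, which is nontrivial,
          commutes with \<open>g\<close>, and commutes with \<open>h\<close> because it lies in
          \<open>H\<close>.\<close>
        show ?thesis
        proof (rule frf_commutative_transitive[OF frf, of "g [^] n"])
          show "g [^] n \<noteq> \<one>" by (rule frf_torsion_free[OF frf gG False n(1)])
          show "g [^] n \<otimes> h = h \<otimes> g [^] n" using True n(2) h(1) by blast
          show "g [^] n \<otimes> g = g \<otimes> g [^] n" using gG pow_mult_distrib nat_pow_comm[OF gG, of n 1]
            by simp
        qed (use gG HG h in auto)
      qed (use h HG in simp)
      then show ?thesis
        using frf_commutative_transitive[OF frf HG[OF h(1)] _ _ h(2), of x y] xy sub by blast
    qed
    have prod: "\<exists>a\<in>G1. \<exists>b\<in>G2. t = a \<otimes> b" if "t \<in> generate G (G1 \<union> G2)" for t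
      using that
    proof (induction rule: generate.induct)
      case one
      then show ?case
        using subgroup.one_closed[OF G1(1)] subgroup.one_closed[OF G2(1)]
          by (metis l_one one_closed)
    next
      case (incl h)
      then show ?case
        using subgroup.one_closed[OF G1(1)] subgroup.one_closed[OF G2(1)] sub
        by (metis Un_iff l_one r_one subsetD)
    next
      case (inv h)
      then have "inv h \<in> G1 \<union> G2"
        using subgroup.m_inv_closed[OF G1(1)] subgroup.m_inv_closed[OF G2(1)] by blast
      then show ?case
        using subgroup.one_closed[OF G1(1)] subgroup.one_closed[OF G2(1)] sub
        by (metis Un_iff l_one r_one subsetD)
    next
      case (eng h1 h2)
      then obtain a b c d where abcd: "a \<in> G1" "b \<in> G2" "h1 = a \<otimes> b" "c \<in> G1" "d \<in> G2" "h2 = c \<otimes> d"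
        by blast
      then have G: "a \<in> carrier G" "b \<in> carrier G" "c \<in> carrier G" "d \<in> carrier G" using sub by auto
      have "h1 \<otimes> h2 = a \<otimes> (b \<otimes> c) \<otimes> d" using G abcd by (simp add: m_assoc)
      also have "\<dots> = (a \<otimes> c) \<otimes> (b \<otimes> d)" using comm[of b c] abcd G by (simp add: m_assoc)
      finally show ?case
        using subgroup.m_closed[OF G1(1) abcd(1,4)] subgroup.m_closed[OF G2(1) abcd(2,5)] by blast
    qed
    show ?thesis
    proof (rule cover_imp_finite_rcosets[OF H(1)])
      have T: "T1 \<subseteq> carrier G" "T2 \<subseteq> carrier G" using T1(2) T2(2) sub by blast+
      show "finite (T1 <#> T2)" "T1 <#> T2 \<subseteq> carrier G"
        using finite_set_mult[OF T1(1) T2(1)] set_mult_closed[OF T] .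
      show "carrier G \<subseteq> H <#> (T1 <#> T2)"
      proof
        fix t assume "t \<in> carrier G"
        then obtain a b where ab: "a \<in> G1" "b \<in> G2" "t = a \<otimes> b" using prod gen by blast
        have "a \<in> H <#> T1" using ab(1) T1(3) by blast
        then obtain h r where h: "h \<in> H" "r \<in> T1" "a = h \<otimes> r"
          unfolding set_mult_def by blast
        have "b \<in> H <#> T2" using ab(2) T2(3) by blast
        then obtain k s where k: "k \<in> H" "s \<in> T2" "b = k \<otimes> s"
          unfolding set_mult_def by blast
        note hk = h k
        have G: "h \<in> carrier G" "k \<in> carrier G" "r \<in> carrier G" "s \<in> carrier G"
          using hk HG T by auto
        have "t = h \<otimes> (r \<otimes> k) \<otimes> s" using ab(3) hk G by (simp add: m_assoc)
        also have "r \<otimes> k = k \<otimes> r"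
          using comm[of r k] hk(2,4) T1(2) H(2) by blast
        also have "h \<otimes> (k \<otimes> r) \<otimes> s = (h \<otimes> k) \<otimes> (r \<otimes> s)"
          using G by (simp add: m_assoc)
        finally show "t \<in> H <#> (T1 <#> T2)" using hk by (auto simp: set_mult_def)
      qed
    qed
  next
    case False
    then obtain p q where pq: "p \<in> H" "q \<in> H" "p \<otimes> q \<noteq> q \<otimes> p" by blast
    have fg: "\<exists>S. finite S \<and> S \<subseteq> K \<and> generate G S = K"
      if K: "subgroup K G" "finitely_generated (G\<lparr>carrier := K\<rparr>)" for K
    proof -
      obtain S where "finite S" "S \<subseteq> K" "generate (G\<lparr>carrier := K\<rparr>) S = K"
        using K(2) unfolding finitely_generated_def by auto
      then show ?thesis using generate_consistent[OF _ K(1), of S] by auto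
    qed
    obtain A where A: "finite A" "A \<subseteq> H" "generate G A = H" using fg[OF H(1,3)] by blast
    obtain S1 where S1: "finite S1" "S1 \<subseteq> G1" "generate G S1 = G1" using fg[OF G1] by blast
    obtain S2 where S2: "finite S2" "S2 \<subseteq> G2" "generate G S2 = G2" using fg[OF G2] by blast
    have S: "S1 \<union> S2 \<subseteq> carrier G" using S1 S2 sub by blast
    have "G1 \<union> G2 \<subseteq> generate G (S1 \<union> S2)"
      using mono_generate[of S1 "S1 \<union> S2"] mono_generate[of S2 "S1 \<union> S2"] S1(3) S2(3) by blast
    then have "generate G (G1 \<union> G2) \<subseteq> generate G (S1 \<union> S2)"
      by (rule generate_subgroup_incl) (rule generate_is_subgroup[OF S])
    then have genS: "generate G (S1 \<union> S2) = carrier G"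
      using gen generate_incl[OF S] by blast
    have mem: "\<exists>T. finite T \<and> T \<subseteq> carrier G \<and> t <# H \<subseteq> H <#> T" if "t \<in> G1 \<union> G2" for t
    proof -
      \<comment> \<open>The coset \<open>t <# H\<close> stays inside \<open>K\<close>, and finitely
        many right cosets of \<open>H\<close> cover all of \<open>K\<close>.\<close>
      have *: ?thesis if K: "subgroup K G" "H \<subseteq> K" "t \<in> K" and T: "finite T" "T \<subseteq> K" "K \<subseteq> H <#> T"
          for K T
      proof (intro exI conjI)
        show "T \<subseteq> carrier G" using T(2) subgroup.subset[OF K(1)] by (rule subset_trans)
        have "t <# H \<subseteq> K"
          using K(2) subgroup.m_closed[OF K(1,3)] by (auto simp: l_coset_def)
        then show "t <# H \<subseteq> H <#> T" using T(3) by (rule subset_trans)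
      qed (rule T(1))
      show ?thesis
        using that *[OF G1(1) _ _ T1] *[OF G2(1) _ _ T2] H(2) by blast
    qed
    have "\<exists>T. finite T \<and> T \<subseteq> carrier G \<and> t <# H \<subseteq> H <#> T" if "t \<in> generate G (G1 \<union> G2)" for t
      using that
    proof (induction rule: generate.induct)
      case one
      show ?case
        using mem[of \<one>] subgroup.one_closed[OF G1(1)] by blast
    next
      case (incl h)
      then show ?case by (rule mem)
    next
      case (inv h)
      then show ?case
        using mem[of "inv h"] subgroup.m_inv_closed[OF G1(1)] subgroup.m_inv_closed[OF G2(1)]
          by blast
    next
      case (eng t1 t2)
      then obtain Ta Tb where Ta: "finite Ta" "Ta \<subseteq> carrier G" "t1 <# H \<subseteq> H <#> Ta"
        and Tb: "finite Tb" "Tb \<subseteq> carrier G" "t2 <# H \<subseteq> H <#> Tb" by blast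
      have t: "t1 \<in> carrier G" "t2 \<in> carrier G" using eng.hyps gen by auto
      \<comment> \<open>Moving \<open>H\<close> past \<open>t2\<close> and then past
        \<open>t1\<close> multiplies the two finite sets.\<close>
      have "t1 \<otimes> t2 <# H = t1 <# (t2 <# H)"
        using lcos_m_assoc[OF H.subset t] by simp
      also have "\<dots> \<subseteq> t1 <# (H <#> Tb)"
        using Tb(3) by (auto simp: l_coset_def)
      also have "\<dots> = (t1 <# H) <#> Tb"
        using set_mult_assoc[of "{t1}" H Tb] t H.subset Tb(2) by (simp add: l_coset_eq_set_mult)
      also have "\<dots> \<subseteq> (H <#> Ta) <#> Tb"
        by (rule mono_set_mult[OF Ta(3) subset_refl])
      also have "\<dots> = H <#> (Ta <#> Tb)"
        by (rule set_mult_assoc[OF H.subset Ta(2) Tb(2)])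
      finally have "t1 \<otimes> t2 <# H \<subseteq> H <#> (Ta <#> Tb)" .
      moreover have "finite (Ta <#> Tb)" "Ta <#> Tb \<subseteq> carrier G"
        using finite_set_mult[OF Ta(1) Tb(1)] set_mult_closed[OF Ta(2) Tb(2)] .
      ultimately show ?case by blast
    qed
    then show ?thesis
      using frf_commensurated_finite_index[OF frf _ S genS H(1) A pq] S1(1) S2(1) gen by simp
  qed
qed

end

theorem theorem6:
  fixes G :: "('a, 'b) monoid_scheme" and G1 G2 H :: "'a set"
  assumes "group G"
    and "finitely_generated G"
    and "fully_residually_free G"
    and "subgroup G1 G" and "finitely_generated (G\<lparr>carrier := G1\<rparr>)"
    and "subgroup G2 G" and "finitely_generated (G\<lparr>carrier := G2\<rparr>)"
    and "subgroup H G" and "H \<subseteq> G1 \<inter> G2" and "finitely_generated (G\<lparr>carrier := H\<rparr>)"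
    and "finite (rcosets\<^bsub>G\<lparr>carrier := G1\<rparr>\<^esub> H)"
    and "finite (rcosets\<^bsub>G\<lparr>carrier := G2\<rparr>\<^esub> H)"
  shows "finite (rcosets\<^bsub>G\<lparr>carrier := generate G (G1 \<union> G2)\<rparr>\<^esub> H)"
proof -
  interpret G: group G by fact
  let ?K = "generate G (G1 \<union> G2)"
  have sub: "G1 \<union> G2 \<subseteq> carrier G"
    using subgroup.subset[OF assms(4)] subgroup.subset[OF assms(6)] by blast
  have K: "subgroup ?K G"
    using G.generate_is_subgroup[OF sub] .
  \<comment> \<open>The generated subgroup becomes the ambient group; full residual freeness passes
    to it by restricting homomorphisms.\<close>
  interpret K: group "G\<lparr>carrier := ?K\<rparr>"
    using G.subgroup_imp_group[OF K] .
  have incl: "G1 \<union> G2 \<subseteq> ?K"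
    by (rule subsetI) (rule generate.incl)
  have "generate (G\<lparr>carrier := ?K\<rparr>) (G1 \<union> G2) = carrier (G\<lparr>carrier := ?K\<rparr>)"
    using G.generate_consistent[OF incl K] by simp
  moreover have "subgroup G1 (G\<lparr>carrier := ?K\<rparr>)" "subgroup G2 (G\<lparr>carrier := ?K\<rparr>)"
      "subgroup H (G\<lparr>carrier := ?K\<rparr>)"
    using G.subgroup_incl[OF _ K] assms(4,6,8,9) incl by auto
  ultimately show ?thesis
    using K.frf_finite_index_join[OF fully_residually_free_subgroup[OF assms(3) K], of G1 G2 H]
      assms by simp
qed

end
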